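(* There exist absolute constants $C,c>0$ and a function $\delta:\mathbb{N}\to[0,1]$ with $\delta(n)\to 0$ as $n\to\infty$ such that the following holds. Let $n\ge 2$ be an integer, $k_1,k_2\in[0,n]$, $b_1,b_2\ge 0$ integers and $\varepsilon\in(0,1)$ satisfy $$k_1+k_2-2\max(b_1,b_2) > n + C\log^3(n/\varepsilon),$$ and let $$m=\Big\lfloor(1-\delta(n))\max(k_1-b_2,\,k_2-b_1)+\tfrac12\,(k_1-2b_1+k_2-2b_2-n)-9\log\varepsilon^{-1}-c\Big\rfloor .$$ If $m\ge 1$, then the DEOR-construction (see context) gives an explicit function $E:\{0,1\}^n\times\{0,1\}^n\to\{0,1\}^m$ that is a $(k_1,k_2,\varepsilon)$ two-source extractor against $(b_1,b_2)$ entangled quantum storage.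
   Context: Logarithms are base 2. For a matrix $A$, $|A|_{\mathrm{tr}}=\frac12\mathrm{Tr}\sqrt{A^\dagger A}$. $U_m$ is the uniform distribution on $\{0,1\}^m$ (identified with the maximally mixed state). A source $X$ on $\{0,1\}^n$ has min-entropy (at least) $k$ if $\Pr[X=x]\le 2^{-k}$ for all $x$. Entangled storage: for independent sources $X,Y$, a $(b_1,b_2)$ entangled (quantum) storage is a family of states $\rho_{xy}$ generated by two non-communicating parties as follows. Alice and Bob share an arbitrary entangled state; Alice receives $x$, Bob receives $y$; each applies any quantum operation (depending on the own input) to the own qubits; Alice then stores $b_1$ of her qubits and discards the rest, Bob stores $b_2$ of his qubits and discards the rest; $\rho_{xy}$ is the resulting joint state on $b_1+b_2$ qubits. $E:\{0,1\}^n\times\{0,1\}^n\to\{0,1\}^m$ is a $(k_1,k_2,\varepsilon)$ two-source extractor against $(b_1,b_2)$ entangled quantum storage if for all independent $n$-bit sources $X,Y$ with min-entropies $k_1,k_2$ and every $(b_1,b_2)$ entangled storage $\rho_{XY}$, $$\Big|\sum_{x,y}p(x)p(y)\,|E(x,y)\rangle\langle E(x,y)|\otimes\rho_{xy}-U_m\otimes\sum_{x,y}p(x)p(y)\rho_{xy}\Big|_{\mathrm{tr}}\le\varepsilon .$$ DEOR-construction. Let $A_1,\dots,A_n$ be an efficiently computable set of $n\times n$ matrices over $GF(2)$ such that $\sum_{i\in S}A_i$ has full rank for every nonempty $S\subseteq[n]$ (such a set exists by Dodis et al.). For $\ell\le n$ let $E_D:\{0,1\}^n\times\{0,1\}^n\to\{0,1\}^\ell$,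 $E_D(x,y)=(A_1x\cdot y,\dots,A_\ell x\cdot y)$, where $x\cdot y=\sum_j x_jy_j \bmod 2$. The construction is $E(x,y)=E_S(x,E_D(x,y))$ or $E(x,y)=E_S(y,E_D(x,y))$ (whichever gives better parameters), possibly truncated to $m$ bits, where $E_S$ is the explicit seeded extractor of De, Portmann, Vidick and Renner. A function $E_S:\{0,1\}^n\times\{0,1\}^d\to\{0,1\}^{m'}$ is a $(k,\varepsilon')$ seeded extractor against $b$ quantum storage if for every $n$-bit source $X$ with min-entropy $k$ and every family of $b$-qubit states $\{\rho_x\}$, $|\sum_x p(x)\,\mathbb{E}_{u\in\{0,1\}^d}|E_S(x,u)\rangle\langle E_S(x,u)|\otimes\rho_x-U_{m'}\otimes\sum_xp(x)\rho_x|_{\mathrm{tr}}\le\varepsilon'$. The extractor of De et al. is an explicit $(k,\varepsilon')$ seeded extractor against $b$ quantum storage with seed length $d=O(\log^3(n/\varepsilon'))$ and $m'=d+k-b-8\log(k-b)-8\log\varepsilon'^{-1}-O(1)$ output bits; it may be used with a longer seed by copying the surplus seed bits to the output. *)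

theory Defs
  imports
    "HOL-Library.Z2"
    "HOL-Probability.Probability_Mass_Function"
    "Jordan_Normal_Form.DL_Rank"
    "Jordan_Normal_Form.Schur_Decomposition"
begin

type_synonym bits = "bit list"

definition bitstr :: "nat \<Rightarrow> bits set" where
  "bitstr n = {w. length w = n}"


text \<open>
  The machine model is a structured multi-tape machine whose tapes are stacks of bits
  (a two-way tape is a pair of stacks). Registers are indexed by \<open>nat\<close>, but a program mentions
  only finitely many of them, and each unit of time handles a bounded number of bits, so the
  functions computed in polynomial time are the usual ones.
\<close>

datatype prog =
    Push nat bit
  | Pop nat
  | Seq prog prog
  | IfOne nat prog prog
  | WhileNonempty nat prog

type_synonym state = "nat \<Rightarrow> bits"

inductive exec :: "prog \<Rightarrow> state \<Rightarrow> nat \<Rightarrow> state \<Rightarrow> bool" where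
  exec_Push: "exec (Push r a) \<sigma> 1 (\<sigma>(r := a # \<sigma> r))"
| exec_Pop: "exec (Pop r) \<sigma> 1 (\<sigma>(r := tl (\<sigma> r)))"
| exec_Seq: "exec p \<sigma> t \<sigma>' \<Longrightarrow> exec q \<sigma>' t' \<sigma>'' \<Longrightarrow> exec (Seq p q) \<sigma> (t + t') \<sigma>''"
| exec_IfOne: "\<sigma> r = 1 # w \<Longrightarrow> exec p \<sigma> t \<sigma>' \<Longrightarrow> exec (IfOne r p q) \<sigma> (t + 1) \<sigma>'"
| exec_IfNotOne: "(\<forall>w. \<sigma> r \<noteq> 1 # w) \<Longrightarrow> exec q \<sigma> t \<sigma>' \<Longrightarrow> exec (IfOne r p q) \<sigma> (t + 1) \<sigma>'"
| exec_WhileEmpty: "\<sigma> r = [] \<Longrightarrow> exec (WhileNonempty r p) \<sigma> 1 \<sigma>"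
| exec_WhileNonempty: "\<sigma> r \<noteq> [] \<Longrightarrow> exec p \<sigma> t \<sigma>' \<Longrightarrow> exec (WhileNonempty r p) \<sigma>' t' \<sigma>'' \<Longrightarrow>
    exec (WhileNonempty r p) \<sigma> (t + t' + 1) \<sigma>''"

text \<open>The inputs are in the first registers, all others are empty; the output is in register 0.\<close>

definition computes :: "prog \<Rightarrow> bits list \<Rightarrow> bits \<Rightarrow> nat \<Rightarrow> bool" where
  "computes P ins out T \<longleftrightarrow>
     (\<exists>t \<sigma>. t \<le> T \<and> exec P (\<lambda>r. if r < length ins then ins ! r else []) t \<sigma> \<and> \<sigma> 0 = out)"

text \<open>\<open>G\<close> is the graph of a function, with its domain.\<close>

definition polytime :: "(bits list \<times> bits) set \<Rightarrow> bool" where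
  "polytime G \<longleftrightarrow> (\<exists>P a e. \<forall>(ins, out) \<in> G.
     computes P ins out (a * Suc (sum_list (map length ins)) ^ e))"

definition unary :: "nat \<Rightarrow> bits" where
  "unary k = replicate k 1"


text \<open>A state of \<open>q\<close> qubits is a matrix of dimension \<open>2 ^ q\<close>.\<close>

definition matsum :: "nat \<Rightarrow> ('i \<Rightarrow> 'a::comm_monoid_add mat) \<Rightarrow> 'i set \<Rightarrow> 'a mat" where
  "matsum d f S = mat d d (\<lambda>ij. \<Sum>s\<in>S. f s $$ ij)"

definition tr :: "complex mat \<Rightarrow> complex" where
  "tr M = (\<Sum>i<dim_row M. M $$ (i, i))"

definition kron :: "complex mat \<Rightarrow> complex mat \<Rightarrow> complex mat" where
  "kron M N = mat (dim_row M * dim_row N) (dim_col M * dim_col N)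
     (\<lambda>(i, j). M $$ (i div dim_row N, j div dim_col N) * N $$ (i mod dim_row N, j mod dim_col N))"

definition psd :: "nat \<Rightarrow> complex mat \<Rightarrow> bool" where
  "psd d M \<longleftrightarrow> M \<in> carrier_mat d d \<and> mat_adjoint M = M \<and>
     (\<forall>v \<in> carrier_vec d. 0 \<le> (M *\<^sub>v v) \<bullet>c v)"

definition density :: "nat \<Rightarrow> complex mat \<Rightarrow> bool" where
  "density d \<rho> \<longleftrightarrow> psd d \<rho> \<and> tr \<rho> = 1"

definition mat_sqrt :: "complex mat \<Rightarrow> complex mat" where
  "mat_sqrt M = (THE R. psd (dim_row M) R \<and> R * R = M)"

definition trnorm :: "complex mat \<Rightarrow> real" where
  "trnorm M = 1 / 2 * Re (tr (mat_sqrt (mat_adjoint M * M)))"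

definition bits_val :: "bits \<Rightarrow> nat" where
  "bits_val z = foldl (\<lambda>v a. 2 * v + (if a = 1 then 1 else 0)) 0 z"

definition ketbra :: "nat \<Rightarrow> bits \<Rightarrow> complex mat" where
  "ketbra m z = mat (2 ^ m) (2 ^ m) (\<lambda>(i, j). if i = bits_val z \<and> j = bits_val z then 1 else 0)"

definition unif :: "nat \<Rightarrow> complex mat" where
  "unif m = (1 / 2 ^ m) \<cdot>\<^sub>m 1\<^sub>m (2 ^ m)"


definition source :: "nat \<Rightarrow> real \<Rightarrow> bits pmf \<Rightarrow> bool" where
  "source n k p \<longleftrightarrow> set_pmf p \<subseteq> bitstr n \<and> (\<forall>x. pmf p x \<le> 2 powr (- k))"

text \<open>Kraus (operator-sum) form of a quantum operation on a \<open>d\<close>-dimensional system.\<close>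

definition quantum_op :: "nat \<Rightarrow> nat \<Rightarrow> (nat \<Rightarrow> complex mat) \<Rightarrow> bool" where
  "quantum_op d r K \<longleftrightarrow> (\<forall>i<r. K i \<in> carrier_mat d d) \<and>
     matsum d (\<lambda>i. mat_adjoint (K i) * K i) {..<r} = 1\<^sub>m d"

definition apply_local ::
  "nat \<Rightarrow> nat \<Rightarrow> (nat \<Rightarrow> complex mat) \<Rightarrow> nat \<Rightarrow> (nat \<Rightarrow> complex mat) \<Rightarrow> complex mat \<Rightarrow> complex mat" where
  "apply_local q r K s L \<sigma> = matsum (2 ^ q)
     (\<lambda>(i, j). kron (K i) (L j) * \<sigma> * mat_adjoint (kron (K i) (L j))) ({..<r} \<times> {..<s})"

definition bra :: "nat \<Rightarrow> nat \<Rightarrow> complex mat" where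
  "bra d r = mat 1 d (\<lambda>(i, j). if j = r then 1 else 0)"

text \<open>
  Of \<open>a1 + a2\<close> qubits keep the first \<open>b1\<close> of the first \<open>a1\<close> and the first \<open>b2\<close> of the last \<open>a2\<close>:
  the partial trace over the others, as the sum over their basis states.
\<close>

definition discard :: "nat \<Rightarrow> nat \<Rightarrow> nat \<Rightarrow> nat \<Rightarrow> complex mat \<Rightarrow> complex mat" where
  "discard a1 b1 a2 b2 M = matsum (2 ^ (b1 + b2))
     (\<lambda>(r, s).
        let T = kron (kron (1\<^sub>m (2 ^ b1)) (bra (2 ^ (a1 - b1)) r))
                     (kron (1\<^sub>m (2 ^ b2)) (bra (2 ^ (a2 - b2)) s))
        in T * M * mat_adjoint T)
     ({..<2 ^ (a1 - b1)} \<times> {..<2 ^ (a2 - b2)})"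

text \<open>
  The shared state \<open>\<sigma>\<close> includes any private ancillas, so operations that keep the number of
  qubits of each party lose no generality, nor does storing an initial segment of the qubits.
\<close>

definition entangled_storage ::
  "nat \<Rightarrow> nat \<Rightarrow> nat \<Rightarrow> (bits \<Rightarrow> bits \<Rightarrow> complex mat) \<Rightarrow> bool" where
  "entangled_storage n b1 b2 \<rho> \<longleftrightarrow> (\<exists>a1 a2 \<sigma> r K s L.
     b1 \<le> a1 \<and> b2 \<le> a2 \<and> density (2 ^ (a1 + a2)) \<sigma> \<and>
     (\<forall>x \<in> bitstr n. quantum_op (2 ^ a1) (r x) (K x)) \<and>
     (\<forall>y \<in> bitstr n. quantum_op (2 ^ a2) (s y) (L y)) \<and>
     (\<forall>x \<in> bitstr n. \<forall>y \<in> bitstr n.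
        \<rho> x y = discard a1 b1 a2 b2 (apply_local (a1 + a2) (r x) (K x) (s y) (L y) \<sigma>)))"

definition two_source_extractor ::
  "nat \<Rightarrow> nat \<Rightarrow> real \<Rightarrow> real \<Rightarrow> real \<Rightarrow> nat \<Rightarrow> nat \<Rightarrow> (bits \<Rightarrow> bits \<Rightarrow> bits) \<Rightarrow> bool" where
  "two_source_extractor n m k1 k2 \<epsilon> b1 b2 E \<longleftrightarrow>
     (\<forall>x \<in> bitstr n. \<forall>y \<in> bitstr n. E x y \<in> bitstr m) \<and>
     (\<forall>p q \<rho>. source n k1 p \<and> source n k2 q \<and> entangled_storage n b1 b2 \<rho> \<longrightarrow>
       trnorm (
         matsum (2 ^ m * 2 ^ (b1 + b2))
           (\<lambda>(x, y). complex_of_real (pmf p x * pmf q y) \<cdot>\<^sub>m kron (ketbra m (E x y)) (\<rho> x y))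
           (bitstr n \<times> bitstr n)
         - kron (unif m)
           (matsum (2 ^ (b1 + b2))
              (\<lambda>(x, y). complex_of_real (pmf p x * pmf q y) \<cdot>\<^sub>m \<rho> x y)
              (bitstr n \<times> bitstr n))) \<le> \<epsilon>)"

definition seeded_extractor ::
  "nat \<Rightarrow> nat \<Rightarrow> nat \<Rightarrow> real \<Rightarrow> real \<Rightarrow> nat \<Rightarrow> (bits \<Rightarrow> bits \<Rightarrow> bits) \<Rightarrow> bool" where
  "seeded_extractor n d m k \<epsilon> b F \<longleftrightarrow>
     (\<forall>x \<in> bitstr n. \<forall>u \<in> bitstr d. F x u \<in> bitstr m) \<and>
     (\<forall>p \<rho>. source n k p \<and> (\<forall>x \<in> bitstr n. density (2 ^ b) (\<rho> x)) \<longrightarrow>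
       trnorm (
         matsum (2 ^ m * 2 ^ b)
           (\<lambda>(x, u). complex_of_real (pmf p x / 2 ^ d) \<cdot>\<^sub>m kron (ketbra m (F x u)) (\<rho> x))
           (bitstr n \<times> bitstr d)
         - kron (unif m)
           (matsum (2 ^ b) (\<lambda>x. complex_of_real (pmf p x) \<cdot>\<^sub>m \<rho> x) (bitstr n))) \<le> \<epsilon>)"


text \<open>For each \<open>n\<close>, the matrices are \<open>A n 1, \<dots>, A n n\<close>.\<close>

definition deor_matrices :: "(nat \<Rightarrow> nat \<Rightarrow> bit mat) \<Rightarrow> bool" where
  "deor_matrices A \<longleftrightarrow>
     (\<forall>n. \<forall>i \<in> {1..n}. A n i \<in> carrier_mat n n) \<and>
     (\<forall>n S. S \<subseteq> {1..n} \<and> S \<noteq> {} \<longrightarrow> vec_space.rank n (matsum n (A n) S) = n) \<and>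
     polytime {([unary n, unary i, unary r, unary c], [A n i $$ (r, c)]) | n i r c.
                 i \<in> {1..n} \<and> r < n \<and> c < n}"

definition E_D :: "(nat \<Rightarrow> nat \<Rightarrow> bit mat) \<Rightarrow> nat \<Rightarrow> nat \<Rightarrow> bits \<Rightarrow> bits \<Rightarrow> bits" where
  "E_D A n l x y =
     map (\<lambda>i. scalar_prod (A n i *\<^sub>v vec_of_list x) (vec_of_list y)) [1..<Suc l]"

text \<open>
  An explicit family \<open>ES n k b t\<close> of seeded extractors with the parameters of De, Portmann, Vidick
  and Renner, for min-entropy \<open>k\<close>, storage \<open>b\<close> and error \<open>\<epsilon>' = 1 / 2 ^ t\<close>. Only integral \<open>k\<close> and
  dyadic \<open>\<epsilon>'\<close> are required, so that the parameters can be given to an algorithm. The real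
  constants \<open>CS\<close> and \<open>cS\<close> are those hidden in the O-notation for the seed length and for the output
  length. Any seed length \<open>d\<close> from the threshold on is allowed, as surplus seed bits
  can be copied to the output. The condition \<open>b < k\<close> keeps the term \<open>log (k - b)\<close> nonnegative.
\<close>

definition dpvr_params :: "real \<Rightarrow> nat \<Rightarrow> nat \<Rightarrow> nat \<Rightarrow> nat \<Rightarrow> nat \<Rightarrow> bool" where
  "dpvr_params CS n k b t d \<longleftrightarrow>
     b < k \<and> k \<le> n \<and> 1 \<le> t \<and> CS * (log 2 (real n / (1 / 2 ^ t))) ^ 3 \<le> real d"

definition dpvr_extractor ::
  "real \<Rightarrow> real \<Rightarrow> (nat \<Rightarrow> nat \<Rightarrow> nat \<Rightarrow> nat \<Rightarrow> bits \<Rightarrow> bits \<Rightarrow> bits) \<Rightarrow> bool" where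
  "dpvr_extractor CS cS ES \<longleftrightarrow>
     (\<forall>n k b t d. dpvr_params CS n k b t d \<longrightarrow>
        (\<exists>m. seeded_extractor n d m (real k) (1 / 2 ^ t) b (ES n k b t) \<and>
             real d + real k - real b - 8 * log 2 (real k - real b) - 8 * log 2 (1 / (1 / 2 ^ t)) - cS
               \<le> real m)) \<and>
     polytime {([unary n, unary k, unary b, unary t, x, u], ES n k b t x u) | n k b t x u.
                 dpvr_params CS n k b t (length u) \<and> x \<in> bitstr n}"

text \<open>The bit \<open>s\<close> selects which of the two sources the seeded extractor is applied to.\<close>

definition deor ::
  "(nat \<Rightarrow> nat \<Rightarrow> bit mat) \<Rightarrow> (nat \<Rightarrow> nat \<Rightarrow> nat \<Rightarrow> nat \<Rightarrow> bits \<Rightarrow> bits \<Rightarrow> bits) \<Rightarrow>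
   nat \<Rightarrow> bit \<Rightarrow> nat \<Rightarrow> nat \<Rightarrow> nat \<Rightarrow> nat \<Rightarrow> nat \<Rightarrow> bits \<Rightarrow> bits \<Rightarrow> bits" where
  "deor A ES n s l k b t m x y =
     take m (ES n k b t (if s = 0 then x else y) (E_D A n l x y))"

end

theory Submission
  imports Defs "HOL-Real_Asymp.Real_Asymp"
begin

text \<open>
  Let the seeded extractor be applied to \<open>x\<close>. It is enough that \<open>E\<^sub>D(x, y)\<close> is close to uniform for an
  observer who knows \<open>x\<close> and the stored state; the two errors then add up. By Fourier expansion over
  the output bits this reduces to single parities \<open>A\<^sub>S x \<cdot> y\<close>, with \<open>A\<^sub>S = \<Sum>\<^sub>i\<^sub>\<in>\<^sub>S A\<^sub>i\<close>. For a test \<open>T\<^sub>x\<close> the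
  expectation of \<open>T\<^sub>x\<close> in the state \<open>\<rho>\<^sub>x\<^sub>y\<close> is an inner product of a vector depending on \<open>x\<close> and a vector
  depending on \<open>y\<close>, both of squared length at most \<open>2\<close> to the power \<open>b\<^sub>2\<close>, because Alice's and Bob's
  operations act on different tensor factors. As \<open>A\<^sub>S\<close> is invertible, the rows of the sign matrix of
  \<open>A\<^sub>S x \<cdot> y\<close> are orthogonal, and the Cauchy-Schwarz inequality bounds the bias by \<open>2\<close> to the power
  \<open>(n - k\<^sub>1 - k\<^sub>2) / 2 + b\<^sub>2\<close>. The case of \<open>y\<close> is symmetric.
\<close>

subsection \<open>Hermitian matrices and the trace norm\<close>

text \<open>The obstacle is that the seed \<open>E_D(x, y)\<close> is correlated with the stored
  state through both sources. The comparison is therefore made for one fixed test of the final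
  output: its diagonal blocks, selected by the output of the seeded extractor, give for every seed
  value a test that depends on \<open>x\<close> alone. All seed values and all parities together
  multiply the bias of a single parity by less than \<open>2 ^ l\<close>, so that a seed of length
  about \<open>(k1 + k2 - n) / 2 - b2 - log (1 / \<epsilon>)\<close> is affordable. Inserted into
  the output length of a seeded extractor against \<open>b1 + b2\<close> qubits, this gives the
  formula for \<open>m\<close>. Its coefficient 9 is 8 from the seeded extractor plus 1 from the
  seed length. The term \<open>8 log (k - b)\<close> is absorbed by \<delta>(n) =
  \<open>1 / log(n)^2\<close>, since the hypothesis forces \<open>k1 - b2\<close> to be at least
  \<open>8 log(n)^3\<close>. Tests are matrices of norm at most 1; their duality with the trace norm
  rests on the spectral theorem and on the uniqueness of positive square roots.\<close>

definition hermitian :: "nat \<Rightarrow> (nat \<Rightarrow> nat \<Rightarrow> complex) \<Rightarrow> bool" where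
  "hermitian n A \<longleftrightarrow> (\<forall>i<n. \<forall>j<n. A j i = cnj (A i j))"

definition orthonormal :: "nat \<Rightarrow> nat \<Rightarrow> (nat \<Rightarrow> nat \<Rightarrow> complex) \<Rightarrow> bool" where
  "orthonormal n K u \<longleftrightarrow>
     (\<forall>k<K. \<forall>k'<K. (\<Sum>i<n. u k i * cnj (u k' i)) = (if k = k' then 1 else 0))"

lemma sum_if_delta:
  fixes f :: "nat \<Rightarrow> 'a::semiring_1"
  shows "k < K \<Longrightarrow> (\<Sum>x<K. f x * (if x = k then 1 else 0)) = f k"
    "k < K \<Longrightarrow> (\<Sum>x<K. f x * (if k = x then 1 else 0)) = f k"
    "k < K \<Longrightarrow> (\<Sum>x<K. (if x = k then 1 else 0) * f x) = f k"
    "k < K \<Longrightarrow> (\<Sum>x<K. (if k = x then 1 else 0) * f x) = f k"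
  by (simp_all add: if_distrib[of "\<lambda>y. _ * y"] if_distrib[of "\<lambda>y. y * _"] cong: if_cong)

lemma of_real_sum_cmod_sq:
  "complex_of_real (\<Sum>i\<in>I. (cmod (v i))\<^sup>2) = (\<Sum>i\<in>I. v i * cnj (v i))"
  by (simp only: of_real_sum complex_norm_square)

lemma mult_mat_vec_zero: "(M :: 'a::semiring_1 mat) \<in> carrier_mat m n \<Longrightarrow> M *\<^sub>v 0\<^sub>v n = 0\<^sub>v m"
  by (intro eq_vecI) auto

text \<open>Induction over the columns from left to right: \<open>T\<close> maps the unit vector
  \<open>j\<close> into the span of the earlier ones, which it annihilates by induction, so the
  kernel hypothesis clears column \<open>j\<close>. That hypothesis is the part of hermiticity that
  survives a similarity.\<close>

lemma upper_triangular_nil_eq_0: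
  fixes T :: "complex mat"
  assumes T: "T \<in> carrier_mat n n" and ut: "upper_triangular T"
    and diag: "\<And>i. i < n \<Longrightarrow> T $$ (i, i) = 0"
    and ker: "\<And>w. w \<in> carrier_vec n \<Longrightarrow> T *\<^sub>v (T *\<^sub>v w) = 0\<^sub>v n \<Longrightarrow> T *\<^sub>v w = 0\<^sub>v n"
  shows "T = 0\<^sub>m n n"
proof -
  have mv: "(T *\<^sub>v v) $ i = (\<Sum>j<n. T $$ (i, j) * v $ j)" if "v \<in> carrier_vec n" "i < n" for v i
    using T that by (auto simp: scalar_prod_def atLeast0LessThan)
  have col: "T *\<^sub>v unit_vec n j = vec n (\<lambda>i. T $$ (i, j))" if "j < n" for j
  proof (intro eq_vecI)
    fix i assume "i < dim_vec (vec n (\<lambda>i. T $$ (i, j)))"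
    then have i: "i < n" by simp
    have "(T *\<^sub>v unit_vec n j) $ i = (\<Sum>k<n. T $$ (i, k) * unit_vec n j $ k)"
      by (rule mv) (use i in auto)
    also have "\<dots> = (\<Sum>k<n. T $$ (i, k) * (if k = j then 1 else 0))"
      using \<open>j < n\<close> by (intro sum.cong) (auto simp: unit_vec_def)
    finally show "(T *\<^sub>v unit_vec n j) $ i = vec n (\<lambda>i. T $$ (i, j)) $ i"
      using i \<open>j < n\<close> by (simp add: sum_if_delta)
  qed (use T in simp)
  have "\<forall>i<n. T $$ (i, j) = 0" if "j < n" for j using that
  proof (induction j rule: less_induct)
    case (less j)
    have low: "T $$ (i, j) = 0" if "i < n" "\<not> i < j" for i
    proof (cases "i = j")
      case False
      then have "j < i" using that by simp
      then show ?thesis using ut that T unfolding upper_triangular_def by (metis carrier_matD(1))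
    qed (use diag less.prems in auto)
    have "T *\<^sub>v (T *\<^sub>v unit_vec n j) = 0\<^sub>v n"
    proof (intro eq_vecI)
      fix i assume "i < dim_vec (0\<^sub>v n :: complex vec)"
      then have i: "i < n" by simp
      have "(T *\<^sub>v (T *\<^sub>v unit_vec n j)) $ i = (\<Sum>k<n. T $$ (i, k) * T $$ (k, j))"
        using i less.prems T by (subst mv) (auto simp: col)
      also have "\<dots> = 0"
      proof (intro sum.neutral ballI)
        fix k assume "k \<in> {..<n}"
        then have k: "k < n" by simp
        show "T $$ (i, k) * T $$ (k, j) = 0"
        proof (cases "k < j")
          case True
          then show ?thesis using less.IH[OF True k] i by simp
        next
          case False
          then show ?thesis using low[OF k] by simp
        qed
      qed
      finally show "(T *\<^sub>v (T *\<^sub>v unit_vec n j)) $ i = (0\<^sub>v n :: complex vec) $ i" using i by simp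
    qed (use T in simp)
    then have "T *\<^sub>v unit_vec n j = 0\<^sub>v n" by (rule ker[rotated]) simp
    then have "vec n (\<lambda>i. T $$ (i, j)) = 0\<^sub>v n" using col[OF less.prems] by simp
    then show ?case by (auto simp: vec_eq_iff)
  qed
  then show ?thesis using T by (intro eq_matI) auto
qed

text \<open>The squared length of \<open>A v\<close> is the inner product of \<open>A (A v)\<close>
  and \<open>v\<close>.\<close>

lemma hermitian_square_ker:
  assumes h: "hermitian n A"
    and z: "\<And>i. i < n \<Longrightarrow> (\<Sum>j<n. A i j * (\<Sum>k<n. A j k * v k)) = 0"
  shows "\<forall>i<n. (\<Sum>j<n. A i j * v j) = 0"
proof -
  define w where "w = (\<lambda>i. \<Sum>j<n. A i j * v j)"
  have "(\<Sum>i<n. w i * cnj (w i)) = (\<Sum>i<n. \<Sum>j<n. w i * cnj (A i j) * cnj (v j))"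
    unfolding w_def by (simp add: sum_distrib_left mult.assoc)
  also have "\<dots> = (\<Sum>j<n. \<Sum>i<n. A j i * w i * cnj (v j))"
    using h unfolding hermitian_def
    by (subst sum.swap) (intro sum.cong refl, metis lessThan_iff mult.commute)
  also have "\<dots> = (\<Sum>j<n. (\<Sum>i<n. A j i * w i) * cnj (v j))"
    by (simp add: sum_distrib_right)
  also have "\<dots> = 0" using z unfolding w_def by simp
  finally have "complex_of_real (\<Sum>i<n. (cmod (w i))\<^sup>2) = 0" by (simp only: of_real_sum_cmod_sq)
  then have "(\<Sum>i<n. (cmod (w i))\<^sup>2) = 0" by (simp only: of_real_eq_0_iff)
  then have "\<forall>i\<in>{..<n}. (cmod (w i))\<^sup>2 = 0"
    by (subst (asm) sum_nonneg_eq_0_iff) auto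
  then show ?thesis unfolding w_def by auto
qed

text \<open>The quadratic form \<open>q\<close> at \<open>v\<close> is real by hermiticity, and it
  equals \<open>\<mu>\<close> times the positive real number \<open>s\<close>.\<close>

lemma hermitian_eigenvalue_real:
  assumes h: "hermitian n A" and ev: "\<And>i. i < n \<Longrightarrow> (\<Sum>j<n. A i j * v j) = \<mu> * v i"
    and v: "\<exists>i<n. v i \<noteq> 0"
  shows "cnj \<mu> = \<mu>"
proof -
  define s where "s = (\<Sum>i<n. v i * cnj (v i))"
  have s_real: "s = complex_of_real (\<Sum>i<n. (cmod (v i))\<^sup>2)" unfolding s_def of_real_sum_cmod_sq ..
  have "(\<Sum>i<n. (cmod (v i))\<^sup>2) > 0" using v by (auto intro!: sum_pos2)
  then have s0: "s \<noteq> 0" "cnj s = s" unfolding s_real by (simp_all only: of_real_eq_0_iff complex_cnj_complex_of_real)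
  define q where "q = (\<Sum>i<n. \<Sum>j<n. A i j * v j * cnj (v i))"
  have q: "q = \<mu> * s"
  proof -
    have "q = (\<Sum>i<n. (\<Sum>j<n. A i j * v j) * cnj (v i))" unfolding q_def by (simp add: sum_distrib_right)
    also have "\<dots> = \<mu> * s" unfolding s_def by (simp add: ev sum_distrib_left mult.assoc)
    finally show ?thesis .
  qed
  have "cnj q = (\<Sum>i<n. \<Sum>j<n. cnj (A i j) * cnj (v j) * v i)" unfolding q_def by simp
  also have "\<dots> = (\<Sum>j<n. \<Sum>i<n. A j i * v i * cnj (v j))"
    using h unfolding hermitian_def
    by (subst sum.swap) (intro sum.cong refl, metis (no_types, lifting) lessThan_iff mult.commute mult.left_commute)
  also have "\<dots> = q" unfolding q_def ..
  finally show ?thesis using q s0 by auto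
qed

text \<open>If all eigenvalues were 0, the Schur form would have zero diagonal, and
  \<open>hermitian_square_ker\<close> carries over to it by similarity; it would then vanish,
  against \<open>nz\<close>. Hence some diagonal entry is a nonzero eigenvalue.\<close>

lemma hermitian_eigen:
  assumes h: "hermitian n A" and nz: "\<exists>i<n. \<exists>j<n. A i j \<noteq> 0"
  shows "\<exists>(\<mu>::real) v. \<mu> \<noteq> 0 \<and> (\<Sum>i<n. v i * cnj (v i)) = 1 \<and>
           (\<forall>i<n. (\<Sum>j<n. A i j * v j) = of_real \<mu> * v i)"
proof -
  define M where "M = mat n n (\<lambda>(i, j). A i j)"
  have M: "M \<in> carrier_mat n n" unfolding M_def by simp
  have Mv: "(M *\<^sub>v v) $ i = (\<Sum>j<n. A i j * v $ j)" if "v \<in> carrier_vec n" "i < n" for v i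
    using that unfolding M_def by (auto simp: scalar_prod_def atLeast0LessThan)
  obtain es where es: "char_poly M = (\<Prod>a\<leftarrow>es. [:- a, 1:])" using char_poly_factorized[OF M] by blast
  obtain T P Q where sd: "schur_decomposition M es = (T, P, Q)"
    by (cases "schur_decomposition M es")
  from schur_decomposition[OF M es sd]
  have sim: "similar_mat_wit M T P Q" and ut: "upper_triangular T" and dg: "diag_mat T = es" by auto
  from similar_mat_witD2[OF M sim]
  have T: "T \<in> carrier_mat n n" and P: "P \<in> carrier_mat n n" and Q: "Q \<in> carrier_mat n n"
    and PQ: "P * Q = 1\<^sub>m n" and QP: "Q * P = 1\<^sub>m n" and MT: "M = P * T * Q" by auto
  have "\<exists>e\<in>set es. e \<noteq> 0"
  proof (rule ccontr)
    assume "\<not> ?thesis"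
    then have es0: "\<And>e. e \<in> set es \<Longrightarrow> e = 0" by blast
    have T0: "T $$ (i, i) = 0" if "i < n" for i
      using that T by (intro es0) (auto simp: diag_mat_def simp flip: dg)
    have TQP: "T = Q * M * P"
    proof -
      have "Q * M * P = (Q * P) * T * (Q * P)"
        unfolding MT using P Q T by (simp add: assoc_mult_mat[of _ n n _ n _ n])
      then show ?thesis using QP T by simp
    qed
    have key: "T *\<^sub>v w = Q *\<^sub>v (M *\<^sub>v (P *\<^sub>v w))" if "w \<in> carrier_vec n" for w
      unfolding TQP using P Q M that by (simp add: assoc_mult_mat_vec[of _ n n _ n])
    have "T = 0\<^sub>m n n"
    proof (rule upper_triangular_nil_eq_0[OF T ut T0])
      fix w :: "complex vec" assume w: "w \<in> carrier_vec n" and z: "T *\<^sub>v (T *\<^sub>v w) = 0\<^sub>v n"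
      define v where "v = P *\<^sub>v w"
      have v: "v \<in> carrier_vec n" unfolding v_def using P w by simp
      have PQv: "P *\<^sub>v (Q *\<^sub>v x) = x" if "x \<in> carrier_vec n" for x
        using P Q PQ that by (metis assoc_mult_mat_vec one_mult_mat_vec)
      have "M *\<^sub>v (M *\<^sub>v v) = P *\<^sub>v (T *\<^sub>v (T *\<^sub>v w))"
      proof -
        have Mv: "M *\<^sub>v v \<in> carrier_vec n" "M *\<^sub>v (M *\<^sub>v v) \<in> carrier_vec n" using M v by simp_all
        have 1: "T *\<^sub>v w = Q *\<^sub>v (M *\<^sub>v v)" using key[OF w] unfolding v_def .
        have 2: "P *\<^sub>v (Q *\<^sub>v (M *\<^sub>v v)) = M *\<^sub>v v" by (rule PQv) (rule Mv)
        have "T *\<^sub>v (T *\<^sub>v w) = Q *\<^sub>v (M *\<^sub>v (M *\<^sub>v v))"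
          unfolding 1 using key[of "Q *\<^sub>v (M *\<^sub>v v)"] Q Mv by (simp only: 2 mult_mat_vec_carrier)
        then show ?thesis using PQv[OF Mv(2)] by simp
      qed
      also have "\<dots> = 0\<^sub>v n" unfolding z using P by (rule mult_mat_vec_zero)
      finally have MM: "M *\<^sub>v (M *\<^sub>v v) = 0\<^sub>v n" .
      have "\<forall>i<n. (\<Sum>j<n. A i j * v $ j) = 0"
      proof (rule hermitian_square_ker[OF h])
        fix i assume i: "i < n"
        have "(M *\<^sub>v (M *\<^sub>v v)) $ i = (\<Sum>j<n. A i j * (\<Sum>k<n. A j k * v $ k))"
          using v M i by (subst Mv) (auto simp: Mv simp del: index_mult_mat_vec)
        then show "(\<Sum>j<n. A i j * (\<Sum>k<n. A j k * v $ k)) = 0" using MM i by simp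
      qed
      then have "M *\<^sub>v v = 0\<^sub>v n" using M v by (intro eq_vecI) (auto simp: Mv simp del: index_mult_mat_vec)
      then show "T *\<^sub>v w = 0\<^sub>v n" using key[OF w] mult_mat_vec_zero[OF Q] unfolding v_def by simp
    qed
    then have "M = 0\<^sub>m n n" using MT P Q by simp
    then show False using nz unfolding M_def by (auto simp: mat_eq_iff)
  qed
  then obtain e where e: "e \<in> set es" "e \<noteq> 0" by blast
  then have "poly (char_poly M) e = 0" unfolding es poly_prod_list by (auto simp: prod_list_zero_iff)
  then have "eigenvalue M e" using eigenvalue_root_char_poly[OF M] by blast
  then obtain w where w: "w \<in> carrier_vec n" "w \<noteq> 0\<^sub>v n" "M *\<^sub>v w = e \<cdot>\<^sub>v w"
    using M unfolding eigenvalue_def eigenvector_def by auto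
  have we: "(\<Sum>j<n. A i j * w $ j) = e * w $ i" if "i < n" for i
    using Mv[OF w(1) that] w that by simp
  have wnz: "\<exists>i<n. w $ i \<noteq> 0" using w by (auto intro!: eq_vecI)
  have "cnj e = e" by (rule hermitian_eigenvalue_real[OF h _ wnz]) (rule we)
  then obtain \<mu> where \<mu>: "e = of_real \<mu>" by (metis Reals_cases Reals_cnj_iff)
  define s where "s = sqrt (\<Sum>i<n. (cmod (w $ i))\<^sup>2)"
  have "(\<Sum>i<n. (cmod (w $ i))\<^sup>2) > 0" using wnz by (auto intro!: sum_pos2)
  then have s: "s > 0" "s\<^sup>2 = (\<Sum>i<n. (cmod (w $ i))\<^sup>2)" unfolding s_def by auto
  define v where "v = (\<lambda>i. w $ i / of_real s)"
  have "(\<Sum>i<n. v i * cnj (v i)) = (\<Sum>i<n. w $ i * cnj (w $ i)) / of_real (s\<^sup>2)"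
    unfolding v_def by (simp add: sum_divide_distrib power2_eq_square)
  also have "\<dots> = 1" unfolding of_real_sum_cmod_sq[symmetric] s(2)[symmetric] using s(1) by simp
  finally have "(\<Sum>i<n. v i * cnj (v i)) = 1" .
  moreover have "\<forall>i<n. (\<Sum>j<n. A i j * v j) = of_real \<mu> * v i"
    using we unfolding v_def \<mu>[symmetric] by (simp add: sum_divide_distrib[symmetric])
  moreover have "\<mu> \<noteq> 0" using e \<mu> by auto
  ultimately show ?thesis by blast
qed

text \<open>The defect of the inequality is the squared distance from \<open>v\<close> to its
  projection \<open>w\<close>.\<close>

lemma bessel:
  assumes o: "orthonormal n K u"
  shows "(\<Sum>k<K. (cmod (\<Sum>i<n. v i * cnj (u k i)))\<^sup>2) \<le> (\<Sum>i<n. (cmod (v i))\<^sup>2)"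
proof -
  define c where "c = (\<lambda>k. \<Sum>i<n. v i * cnj (u k i))"
  define w where "w = (\<lambda>i. \<Sum>k<K. c k * u k i)"
  have vw: "(\<Sum>i<n. v i * cnj (w i)) = (\<Sum>k<K. c k * cnj (c k))"
  proof -
    have "(\<Sum>i<n. v i * cnj (w i)) = (\<Sum>i<n. \<Sum>k<K. cnj (c k) * (v i * cnj (u k i)))"
      unfolding w_def by (simp add: sum_distrib_left mult_ac)
    also have "\<dots> = (\<Sum>k<K. cnj (c k) * c k)"
      by (subst sum.swap) (simp add: sum_distrib_left[symmetric] c_def)
    finally show ?thesis by (simp add: mult.commute)
  qed
  have wu: "(\<Sum>i<n. w i * cnj (u k i)) = c k" if "k < K" for k
  proof -
    have "(\<Sum>i<n. w i * cnj (u k i)) = (\<Sum>i<n. \<Sum>k'<K. c k' * (u k' i * cnj (u k i)))"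
      unfolding w_def by (simp add: sum_distrib_right mult.assoc)
    also have "\<dots> = (\<Sum>k'<K. c k' * (\<Sum>i<n. u k' i * cnj (u k i)))"
      by (subst sum.swap) (simp add: sum_distrib_left)
    also have "\<dots> = (\<Sum>k'<K. c k' * (if k' = k then 1 else 0))"
      using o that unfolding orthonormal_def by (intro sum.cong) auto
    finally show ?thesis using that by (simp add: sum_if_delta)
  qed
  have ww: "(\<Sum>i<n. w i * cnj (w i)) = (\<Sum>k<K. c k * cnj (c k))"
  proof -
    have "(\<Sum>i<n. w i * cnj (w i)) = (\<Sum>i<n. \<Sum>k<K. cnj (c k) * (w i * cnj (u k i)))"
      unfolding w_def by (simp add: sum_distrib_left mult_ac)
    also have "\<dots> = (\<Sum>k<K. cnj (c k) * (\<Sum>i<n. w i * cnj (u k i)))"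
      by (subst sum.swap) (simp add: sum_distrib_left)
    also have "\<dots> = (\<Sum>k<K. cnj (c k) * c k)" by (simp add: wu)
    finally show ?thesis by (simp add: mult.commute)
  qed
  have "complex_of_real (\<Sum>i<n. (cmod (v i - w i))\<^sup>2) = (\<Sum>i<n. (v i - w i) * cnj (v i - w i))"
    by (rule of_real_sum_cmod_sq)
  also have "\<dots> = (\<Sum>i<n. v i * cnj (v i)) - (\<Sum>i<n. v i * cnj (w i))
      - cnj (\<Sum>i<n. v i * cnj (w i)) + (\<Sum>i<n. w i * cnj (w i))"
    by (simp add: algebra_simps sum.distrib sum_subtractf)
  also have "\<dots> = (\<Sum>i<n. v i * cnj (v i)) - (\<Sum>k<K. c k * cnj (c k))"
    unfolding vw ww by (simp add: mult.commute)
  also have "\<dots> = complex_of_real ((\<Sum>i<n. (cmod (v i))\<^sup>2) - (\<Sum>k<K. (cmod (c k))\<^sup>2))"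
    unfolding of_real_diff of_real_sum_cmod_sq ..
  finally have "(\<Sum>i<n. (cmod (v i - w i))\<^sup>2) = (\<Sum>i<n. (cmod (v i))\<^sup>2) - (\<Sum>k<K. (cmod (c k))\<^sup>2)"
    by (simp only: of_real_eq_iff)
  moreover have "0 \<le> (\<Sum>i<n. (cmod (v i - w i))\<^sup>2)" by (simp add: sum_nonneg)
  ultimately show ?thesis unfolding c_def by linarith
qed

text \<open>Double counting of the squared entries of the \<open>u k\<close>: each vector
  contributes 1, and by Bessel's inequality for a unit vector each coordinate contributes at most
  1.\<close>

lemma orthonormal_card_le:
  assumes o: "orthonormal n K u"
  shows "K \<le> n"
proof -
  have 1: "(\<Sum>k<K. (cmod (u k i))\<^sup>2) \<le> 1" if i: "i < n" for i
  proof -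
    have "(\<Sum>j<n. (cmod (if j = i then 1 else 0))\<^sup>2) = (\<Sum>j<n. if j = i then 1 else 0)"
      by (intro sum.cong) auto
    then show ?thesis using bessel[OF o, of "\<lambda>j. if j = i then 1 else 0"] i
      by (simp add: sum_if_delta)
  qed
  have 2: "(\<Sum>i<n. (cmod (u k i))\<^sup>2) = 1" if "k < K" for k
  proof -
    have "complex_of_real (\<Sum>i<n. (cmod (u k i))\<^sup>2) = 1"
      unfolding of_real_sum_cmod_sq using o that unfolding orthonormal_def by simp
    then show ?thesis by (simp only: of_real_eq_1_iff)
  qed
  have "real K = (\<Sum>k<K. \<Sum>i<n. (cmod (u k i))\<^sup>2)" by (simp add: 2)
  also have "\<dots> = (\<Sum>i<n. \<Sum>k<K. (cmod (u k i))\<^sup>2)" by (rule sum.swap)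
  also have "\<dots> \<le> (\<Sum>i<n. 1)" by (intro sum_mono) (simp add: 1)
  finally show ?thesis by simp
qed

text \<open>Deflation: subtracting the part already diagonalised leaves a hermitian \<open>B\<close>
  that kills the vectors found so far, so an eigenvector of \<open>B\<close> with nonzero eigenvalue
  is orthogonal to them. Listing only the nonzero eigenvalues spares the completion to a
  basis.\<close>

lemma hermitian_spectral:
  assumes h: "hermitian n A"
  shows "\<exists>K (l :: nat \<Rightarrow> real) u. orthonormal n K u \<and> (\<forall>k<K. l k \<noteq> 0) \<and>
     (\<forall>i<n. \<forall>j<n. A i j = (\<Sum>k<K. of_real (l k) * u k i * cnj (u k j)))"
proof -
  define ES where "ES = (\<lambda>K (l :: nat \<Rightarrow> real) u. orthonormal n K u \<and> (\<forall>k<K. l k \<noteq> 0) \<and>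
     (\<forall>k<K. \<forall>i<n. (\<Sum>j<n. A i j * u k j) = of_real (l k) * u k i))"
  have step: "?thesis \<or> (\<exists>l u. ES (Suc K) l u)" if ES: "ES K l u" for K l u
  proof -
    define B where "B = (\<lambda>i j. A i j - (\<Sum>k<K. of_real (l k) * u k i * cnj (u k j)))"
    from ES have on: "orthonormal n K u" and l0: "\<forall>k<K. l k \<noteq> 0"
      and ev: "\<And>k i. k < K \<Longrightarrow> i < n \<Longrightarrow> (\<Sum>j<n. A i j * u k j) = of_real (l k) * u k i"
      unfolding ES_def by auto
    have hB: "hermitian n B" unfolding hermitian_def
    proof (intro allI impI)
      fix i j assume "i < n" "j < n"
      then have "A j i = cnj (A i j)" using h unfolding hermitian_def by blast
      then show "B j i = cnj (B i j)" unfolding B_def by (simp add: mult_ac)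
    qed
    have Bv: "(\<Sum>j<n. B i j * v j) = (\<Sum>j<n. A i j * v j)
        - (\<Sum>k<K. of_real (l k) * u k i * (\<Sum>j<n. v j * cnj (u k j)))" for i v
    proof -
      have "(\<Sum>j<n. \<Sum>k<K. of_real (l k) * u k i * cnj (u k j) * v j)
          = (\<Sum>k<K. of_real (l k) * u k i * (\<Sum>j<n. v j * cnj (u k j)))"
        by (subst sum.swap) (simp add: sum_distrib_left mult_ac)
      then show ?thesis unfolding B_def by (simp add: left_diff_distrib sum_subtractf sum_distrib_right)
    qed
    have Bu: "(\<Sum>j<n. B i j * u k j) = 0" if "k < K" "i < n" for k i
    proof -
      have "(\<Sum>k'<K. of_real (l k') * u k' i * (\<Sum>j<n. u k j * cnj (u k' j)))
          = (\<Sum>k'<K. of_real (l k') * u k' i * (if k = k' then 1 else 0))"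
        using on that unfolding orthonormal_def by (intro sum.cong) auto
      then show ?thesis using that unfolding Bv by (simp add: ev sum_if_delta)
    qed
    show ?thesis
    proof (cases "\<exists>i<n. \<exists>j<n. B i j \<noteq> 0")
      case False
      then have "\<forall>i<n. \<forall>j<n. A i j = (\<Sum>k<K. of_real (l k) * u k i * cnj (u k j))"
        unfolding B_def by auto
      then show ?thesis using on l0 by blast
    next
      case True
      from hermitian_eigen[OF hB True] obtain \<mu> v where \<mu>: "\<mu> \<noteq> (0::real)"
        and v1: "(\<Sum>i<n. v i * cnj (v i)) = 1"
        and ve: "\<And>i. i < n \<Longrightarrow> (\<Sum>j<n. B i j * v j) = of_real \<mu> * v i" by blast
      have orth: "(\<Sum>i<n. v i * cnj (u k i)) = 0" if k: "k < K" for k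
      proof -
        have "of_real \<mu> * (\<Sum>i<n. v i * cnj (u k i)) = (\<Sum>i<n. (\<Sum>j<n. B i j * v j) * cnj (u k i))"
          by (simp add: ve sum_distrib_left mult.assoc)
        also have "\<dots> = (\<Sum>i<n. \<Sum>j<n. B i j * v j * cnj (u k i))"
          by (simp add: sum_distrib_right)
        also have "\<dots> = (\<Sum>j<n. \<Sum>i<n. v j * cnj (B j i * u k i))"
        proof (subst sum.swap, intro sum.cong refl)
          fix i j assume "i \<in> {..<n}" "j \<in> {..<n}"
          then have "B i j = cnj (B j i)" using hB unfolding hermitian_def by blast
          then show "B i j * v j * cnj (u k i) = v j * cnj (B j i * u k i)" by simp
        qed
        also have "\<dots> = (\<Sum>j<n. v j * cnj (\<Sum>i<n. B j i * u k i))"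
          by (simp add: sum_distrib_left)
        also have "\<dots> = 0" using Bu k by simp
        finally show ?thesis using \<mu> by simp
      qed
      have orth': "(\<Sum>i<n. u k i * cnj (v i)) = 0" if k: "k < K" for k
      proof -
        have "cnj (\<Sum>i<n. v i * cnj (u k i)) = (\<Sum>i<n. u k i * cnj (v i))"
          by (simp add: mult.commute)
        then show ?thesis using orth[OF k] by simp
      qed
      have Av: "(\<Sum>j<n. A i j * v j) = of_real \<mu> * v i" if "i < n" for i
        using Bv[of i v] ve[OF that] by (simp add: orth)
      have "ES (Suc K) (l(K := \<mu>)) (u(K := v))"
        unfolding ES_def orthonormal_def using on l0 ev \<mu> v1 orth orth' Av
        by (auto simp: less_Suc_eq orthonormal_def)
      then show ?thesis by blast
    qed
  qed
  have "?thesis \<or> (\<exists>l u. ES K l u)" for K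
  proof (induction K)
    case 0
    have "ES 0 (\<lambda>_. 1) (\<lambda>_ _. 0)" unfolding ES_def orthonormal_def by simp
    then show ?case by blast
  next
    case (Suc K)
    then show ?case using step by blast
  qed
  \<comment> \<open>No orthonormal family has \<open>Suc n\<close> members, so the deflation must
    have stopped before.\<close>
  from this[of "Suc n"] show ?thesis
    using orthonormal_card_le[of n "Suc n"] unfolding ES_def by auto
qed

lemma orthonormal_sum_cmod_sq:
  assumes o: "orthonormal n K u"
  shows "(\<Sum>i<n. (cmod (\<Sum>k<K. c k * u k i))\<^sup>2) = (\<Sum>k<K. (cmod (c k))\<^sup>2)"
proof -
  define w where "w = (\<lambda>i. \<Sum>k<K. c k * u k i)"
  have wu: "(\<Sum>i<n. w i * cnj (u k i)) = c k" if "k < K" for k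
  proof -
    have "(\<Sum>i<n. w i * cnj (u k i)) = (\<Sum>i<n. \<Sum>k'<K. c k' * (u k' i * cnj (u k i)))"
      unfolding w_def by (simp add: sum_distrib_right mult.assoc)
    also have "\<dots> = (\<Sum>k'<K. c k' * (\<Sum>i<n. u k' i * cnj (u k i)))"
      by (subst sum.swap) (simp add: sum_distrib_left)
    also have "\<dots> = (\<Sum>k'<K. c k' * (if k' = k then 1 else 0))"
      using o that unfolding orthonormal_def by (intro sum.cong) auto
    finally show ?thesis using that by (simp add: sum_if_delta)
  qed
  have "(\<Sum>i<n. w i * cnj (w i)) = (\<Sum>i<n. \<Sum>k<K. cnj (c k) * (w i * cnj (u k i)))"
    unfolding w_def by (simp add: sum_distrib_left mult_ac)
  also have "\<dots> = (\<Sum>k<K. cnj (c k) * (\<Sum>i<n. w i * cnj (u k i)))"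
    by (subst sum.swap) (simp add: sum_distrib_left)
  also have "\<dots> = (\<Sum>k<K. c k * cnj (c k))" by (simp add: wu mult.commute)
  finally have "complex_of_real (\<Sum>i<n. (cmod (w i))\<^sup>2) = complex_of_real (\<Sum>k<K. (cmod (c k))\<^sup>2)"
    unfolding of_real_sum_cmod_sq .
  then show ?thesis unfolding w_def by (simp only: of_real_eq_iff)
qed

section \<open>Positive matrices and their square roots\<close>

lemma mat_adjoint_dim [simp]: "dim_row (mat_adjoint M) = dim_col M" "dim_col (mat_adjoint M) = dim_row M"
  unfolding mat_adjoint_def by auto

lemma mat_adjoint_carrier: "M \<in> carrier_mat m n \<Longrightarrow> mat_adjoint M \<in> carrier_mat n m"
  by (intro carrier_matI) auto

lemma mat_adjoint_index [simp]:
  "i < dim_col M \<Longrightarrow> j < dim_row M \<Longrightarrow> mat_adjoint (M :: complex mat) $$ (i, j) = cnj (M $$ (j, i))"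
  unfolding mat_adjoint_def by (simp add: mat_of_rows_index)

lemma mat_adjoint_eq_iff:
  assumes "M \<in> carrier_mat n n"
  shows "mat_adjoint M = M \<longleftrightarrow> hermitian n (\<lambda>i j. M $$ (i, j))"
proof
  assume "mat_adjoint M = M"
  then have "cnj (M $$ (i, j)) = M $$ (j, i)" if "i < n" "j < n" for i j
    using mat_adjoint_index[of j M i] assms that by simp
  then show "hermitian n (\<lambda>i j. M $$ (i, j))" unfolding hermitian_def by simp
next
  assume h: "hermitian n (\<lambda>i j. M $$ (i, j))"
  show "mat_adjoint M = M"
  proof (intro eq_matI)
    fix i j assume "i < dim_row M" "j < dim_col M"
    then have ij: "i < n" "j < n" using assms by auto
    then have "M $$ (i, j) = cnj (M $$ (j, i))" using h unfolding hermitian_def by blast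
    then show "mat_adjoint M $$ (i, j) = M $$ (i, j)"
      using ij assms by (subst mat_adjoint_index) auto
  qed (use assms in auto)
qed

lemma psd_iff:
  "psd n M \<longleftrightarrow> M \<in> carrier_mat n n \<and> hermitian n (\<lambda>i j. M $$ (i, j)) \<and>
     (\<forall>v. 0 \<le> (\<Sum>i<n. (\<Sum>j<n. M $$ (i, j) * v j) * cnj (v i)))"
proof -
  have eq: "(M *\<^sub>v v) \<bullet>c v = (\<Sum>i<n. (\<Sum>j<n. M $$ (i, j) * v $ j) * cnj (v $ i))"
    if "M \<in> carrier_mat n n" "v \<in> carrier_vec n" for v
    using that by (auto simp: scalar_prod_def atLeast0LessThan intro!: sum.cong)
  have eq': "(M *\<^sub>v vec n v) \<bullet>c vec n v = (\<Sum>i<n. (\<Sum>j<n. M $$ (i, j) * v j) * cnj (v i))"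
    if "M \<in> carrier_mat n n" for v
    by (subst eq) (auto simp: that)
  show ?thesis
    unfolding psd_def using eq eq' mat_adjoint_eq_iff[of M n] by (metis vec_carrier)
qed

text \<open>For orthonormal \<open>u\<close> this is the functional calculus of a hermitian matrix:
  products and traces can be read off the coefficients \<open>a\<close>.\<close>

definition spec_mat :: "nat \<Rightarrow> nat \<Rightarrow> (nat \<Rightarrow> real) \<Rightarrow> (nat \<Rightarrow> nat \<Rightarrow> complex) \<Rightarrow> complex mat" where
  "spec_mat n K a u = mat n n (\<lambda>(i, j). \<Sum>k<K. of_real (a k) * u k i * cnj (u k j))"

lemma spec_mat_carrier [simp]: "spec_mat n K a u \<in> carrier_mat n n"
  unfolding spec_mat_def by simp

lemma spec_mat_index:
  "i < n \<Longrightarrow> j < n \<Longrightarrow> spec_mat n K a u $$ (i, j) = (\<Sum>k<K. of_real (a k) * u k i * cnj (u k j))"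
  unfolding spec_mat_def by simp

lemma mat_mult_index:
  "A \<in> carrier_mat m n \<Longrightarrow> B \<in> carrier_mat n p \<Longrightarrow> i < m \<Longrightarrow> j < p \<Longrightarrow>
     (A * B) $$ (i, j) = (\<Sum>k<n. A $$ (i, k) * B $$ (k, j))"
  by (auto simp: scalar_prod_def atLeast0LessThan)

lemma hermitian_spec_mat: "hermitian n (\<lambda>i j. spec_mat n K a u $$ (i, j))"
  unfolding hermitian_def by (auto simp: spec_mat_index mult_ac)

lemma psd_spec_mat:
  assumes a: "\<And>k. k < K \<Longrightarrow> 0 \<le> a k"
  shows "psd n (spec_mat n K a u)"
  unfolding psd_iff
proof (intro conjI allI hermitian_spec_mat spec_mat_carrier)
  fix v :: "nat \<Rightarrow> complex"
  define c where "c = (\<lambda>k. \<Sum>j<n. cnj (u k j) * v j)"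
  have "(\<Sum>i<n. (\<Sum>j<n. spec_mat n K a u $$ (i, j) * v j) * cnj (v i))
      = (\<Sum>i<n. \<Sum>k<K. of_real (a k) * c k * (u k i * cnj (v i)))"
  proof (intro sum.cong refl)
    fix i assume "i \<in> {..<n}"
    then have "(\<Sum>j<n. spec_mat n K a u $$ (i, j) * v j)
        = (\<Sum>j<n. \<Sum>k<K. of_real (a k) * u k i * (cnj (u k j) * v j))"
      by (intro sum.cong) (auto simp: spec_mat_index sum_distrib_right mult.assoc)
    also have "\<dots> = (\<Sum>k<K. of_real (a k) * u k i * c k)"
      unfolding c_def by (subst sum.swap) (simp add: sum_distrib_left)
    finally show "(\<Sum>j<n. spec_mat n K a u $$ (i, j) * v j) * cnj (v i)
      = (\<Sum>k<K. of_real (a k) * c k * (u k i * cnj (v i)))"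
      by (simp add: sum_distrib_left sum_distrib_right mult_ac)
  qed
  also have "\<dots> = (\<Sum>k<K. of_real (a k) * c k * cnj (c k))"
    by (subst sum.swap) (simp add: sum_distrib_left[symmetric] c_def)
  also have "\<dots> = of_real (\<Sum>k<K. a k * (cmod (c k))\<^sup>2)"
    by (simp only: of_real_sum of_real_mult complex_norm_square mult.assoc)
  also have "0 \<le> \<dots>"
    using a by (auto simp: less_eq_complex_def intro!: sum_nonneg mult_nonneg_nonneg)
  finally show "0 \<le> (\<Sum>i<n. (\<Sum>j<n. spec_mat n K a u $$ (i, j) * v j) * cnj (v i))" .
qed

lemma spec_mat_mult:
  assumes o: "orthonormal n K u"
  shows "spec_mat n K a u * spec_mat n K b u = spec_mat n K (\<lambda>k. a k * b k) u"
proof (intro eq_matI)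
  fix i m assume "i < dim_row (spec_mat n K (\<lambda>k. a k * b k) u)" "m < dim_col (spec_mat n K (\<lambda>k. a k * b k) u)"
  then have im: "i < n" "m < n" by (simp_all add: spec_mat_def)
  have "(spec_mat n K a u * spec_mat n K b u) $$ (i, m)
      = (\<Sum>j<n. spec_mat n K a u $$ (i, j) * spec_mat n K b u $$ (j, m))"
    using im by (intro mat_mult_index) auto
  also have "\<dots> = (\<Sum>j<n. \<Sum>k<K. of_real (a k) * u k i * cnj (u k j) * spec_mat n K b u $$ (j, m))"
    using im by (intro sum.cong) (auto simp: spec_mat_index[of i] sum_distrib_right)
  also have "\<dots> = (\<Sum>k<K. of_real (a k) * u k i * (\<Sum>j<n. cnj (u k j) * spec_mat n K b u $$ (j, m)))"
    by (subst sum.swap) (simp add: sum_distrib_left mult.assoc)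
  also have "\<dots> = (\<Sum>k<K. of_real (a k) * u k i * (of_real (b k) * cnj (u k m)))"
  proof (intro sum.cong refl arg_cong2[where f = times])
    fix k assume k: "k \<in> {..<K}"
    have "(\<Sum>j<n. cnj (u k j) * spec_mat n K b u $$ (j, m))
        = (\<Sum>j<n. \<Sum>k'<K. of_real (b k') * cnj (u k' m) * (u k' j * cnj (u k j)))"
      using im by (intro sum.cong) (auto simp: spec_mat_index sum_distrib_left mult_ac)
    also have "\<dots> = (\<Sum>k'<K. of_real (b k') * cnj (u k' m) * (\<Sum>j<n. u k' j * cnj (u k j)))"
      by (subst sum.swap) (simp add: sum_distrib_left)
    also have "\<dots> = (\<Sum>k'<K. of_real (b k') * cnj (u k' m) * (if k' = k then 1 else 0))"
      using o k unfolding orthonormal_def by (intro sum.cong) auto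
    also have "\<dots> = of_real (b k) * cnj (u k m)" using k by (simp add: sum_if_delta)
    finally show "(\<Sum>j<n. cnj (u k j) * spec_mat n K b u $$ (j, m)) = of_real (b k) * cnj (u k m)" .
  qed
  finally show "(spec_mat n K a u * spec_mat n K b u) $$ (i, m) = spec_mat n K (\<lambda>k. a k * b k) u $$ (i, m)"
    using im by (simp add: spec_mat_index mult_ac)
qed (auto simp: spec_mat_def)

lemma tr_spec_mat:
  assumes o: "orthonormal n K u"
  shows "tr (spec_mat n K a u) = of_real (\<Sum>k<K. a k)"
proof -
  have "tr (spec_mat n K a u) = (\<Sum>i<n. \<Sum>k<K. of_real (a k) * (u k i * cnj (u k i)))"
    unfolding tr_def by (auto simp: spec_mat_def mult.assoc)
  also have "\<dots> = (\<Sum>k<K. of_real (a k) * (\<Sum>i<n. u k i * cnj (u k i)))"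
    by (subst sum.swap) (simp add: sum_distrib_left)
  also have "\<dots> = of_real (\<Sum>k<K. a k)"
    using o unfolding orthonormal_def by simp
  finally show ?thesis .
qed

lemma hermitian_spec_matE:
  assumes "D \<in> carrier_mat n n" "hermitian n (\<lambda>i j. D $$ (i, j))"
  obtains K l u where "orthonormal n K u" "\<forall>k<K. l k \<noteq> 0" "D = spec_mat n K l u"
proof -
  from hermitian_spectral[OF assms(2)] obtain K l u where
    *: "orthonormal n K u" "\<forall>k<K. l k \<noteq> 0"
    "\<forall>i<n. \<forall>j<n. D $$ (i, j) = (\<Sum>k<K. of_real (l k) * u k i * cnj (u k j))" by blast
  have "D = spec_mat n K l u" using *(3) assms(1) by (intro eq_matI) (auto simp: spec_mat_def)
  with * show thesis by (intro that) auto
qed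

lemma spec_mat_apply:
  assumes "i < n"
  shows "(\<Sum>j<n. spec_mat n K l u $$ (i, j) * v j) = (\<Sum>k<K. of_real (l k) * u k i * (\<Sum>j<n. v j * cnj (u k j)))"
proof -
  have "(\<Sum>j<n. spec_mat n K l u $$ (i, j) * v j)
      = (\<Sum>j<n. \<Sum>k<K. of_real (l k) * u k i * (v j * cnj (u k j)))"
    using assms by (intro sum.cong) (auto simp: spec_mat_index sum_distrib_left sum_distrib_right mult_ac)
  also have "\<dots> = (\<Sum>k<K. of_real (l k) * u k i * (\<Sum>j<n. v j * cnj (u k j)))"
    by (subst sum.swap) (simp add: sum_distrib_left)
  finally show ?thesis .
qed

text \<open>If \<open>u\<close> is an eigenvector of \<open>R\<close> with eigenvalue
  \<open>\<lambda> > 0\<close>, then \<open>w = S u - \<lambda> u\<close> satisfies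
  \<open>S w = - \<lambda> w\<close> because \<open>S\<close> and \<open>R\<close> have the same
  square; positivity of \<open>S\<close> forces \<open>w = 0\<close>. On the orthogonal complement
  of these eigenvectors \<open>R\<close> vanishes, hence so does the square of \<open>S\<close>, and
  then \<open>S\<close> itself.\<close>

lemma psd_sqrt_unique:
  assumes R: "psd n R" and S: "psd n S" and eq: "R * R = S * S"
  shows "S = R"
proof -
  have Rc: "R \<in> carrier_mat n n" and Sc: "S \<in> carrier_mat n n"
    and hR: "hermitian n (\<lambda>i j. R $$ (i, j))" and hS: "hermitian n (\<lambda>i j. S $$ (i, j))"
    and pR: "\<And>v. 0 \<le> (\<Sum>i<n. (\<Sum>j<n. R $$ (i, j) * v j) * cnj (v i))"
    and pS: "\<And>v. 0 \<le> (\<Sum>i<n. (\<Sum>j<n. S $$ (i, j) * v j) * cnj (v i))"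
    using R[unfolded psd_iff] S[unfolded psd_iff] by blast+
  define r where "r = (\<lambda>v i. \<Sum>j<n. R $$ (i, j) * v j)"
  define s where "s = (\<lambda>v i. \<Sum>j<n. S $$ (i, j) * v j)"
  have rD: "r v i = (\<Sum>j<n. R $$ (i, j) * v j)" for v i unfolding r_def ..
  have sD: "s v i = (\<Sum>j<n. S $$ (i, j) * v j)" for v i unfolding s_def ..
  have sq: "(\<Sum>j<n. M $$ (i, j) * (\<Sum>k<n. M $$ (j, k) * v k)) = (\<Sum>k<n. (M * M) $$ (i, k) * v k)"
    if "i < n" "M \<in> carrier_mat n n" for M :: "complex mat" and i v
  proof -
    have "(\<Sum>j<n. M $$ (i, j) * (\<Sum>k<n. M $$ (j, k) * v k)) = (\<Sum>k<n. \<Sum>j<n. M $$ (i, j) * M $$ (j, k) * v k)"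
      by (subst sum.swap) (simp add: sum_distrib_left mult.assoc)
    also have "\<dots> = (\<Sum>k<n. (M * M) $$ (i, k) * v k)"
    proof (intro sum.cong refl)
      fix k assume "k \<in> {..<n}"
      then have "(M * M) $$ (i, k) = (\<Sum>j<n. M $$ (i, j) * M $$ (j, k))"
        by (intro mat_mult_index[OF that(2) that(2) that(1)]) simp
      then show "(\<Sum>j<n. M $$ (i, j) * M $$ (j, k) * v k) = (M * M) $$ (i, k) * v k"
        by (simp only: sum_distrib_right)
    qed
    finally show ?thesis .
  qed
  have ss: "s (s v) i = r (r v) i" if "i < n" for v i
    unfolding r_def s_def by (simp only: sq[OF that Rc] sq[OF that Sc] eq)
  obtain K l u where o: "orthonormal n K u" and l0: "\<forall>k<K. l k \<noteq> 0" and Rl: "R = spec_mat n K l u"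
    by (rule hermitian_spec_matE[OF Rc hR])
  have ru: "r (u k) i = of_real (l k) * u k i" if "k < K" "i < n" for k i
  proof -
    have "r (u k) i = (\<Sum>k'<K. of_real (l k') * u k' i * (\<Sum>j<n. u k j * cnj (u k' j)))"
      unfolding r_def Rl using that by (simp add: spec_mat_apply)
    also have "\<dots> = (\<Sum>k'<K. of_real (l k') * u k' i * (if k = k' then 1 else 0))"
      using o that unfolding orthonormal_def by (intro sum.cong) auto
    finally show ?thesis using that by (simp add: sum_if_delta)
  qed
  have lpos: "l k > 0" if "k < K" for k
  proof -
    have "(\<Sum>i<n. (r (u k) i) * cnj (u k i)) = of_real (l k) * (\<Sum>i<n. u k i * cnj (u k i))"
      using that by (simp add: ru sum_distrib_left mult.assoc)
    also have "\<dots> = of_real (l k)" using o that unfolding orthonormal_def by simp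
    finally have "0 \<le> complex_of_real (l k)" using pR[of "u k"] unfolding r_def by simp
    then show ?thesis using l0 that by (auto simp: less_eq_complex_def order.order_iff_strict)
  qed
  have slin: "s (\<lambda>i. a * v i - b * w i) i = a * s v i - b * s w i" for a b v w i
    unfolding s_def by (simp add: right_diff_distrib sum_subtractf sum_distrib_left mult_ac)
  have su: "s (u k) i = of_real (l k) * u k i" if k: "k < K" and i: "i < n" for k i
  proof -
    \<comment> \<open>The factor 1 makes \<open>w\<close> an instance of
      \<open>slin\<close>.\<close>
    define w where "w = (\<lambda>i. 1 * s (u k) i - of_real (l k) * u k i)"
    have rc: "r (\<lambda>i. of_real (l k) * u k i) j = of_real (l k) * r (u k) j" for j
      unfolding r_def by (simp add: sum_distrib_left mult_ac)
    have rr: "r (r (u k)) j = of_real (l k) * (of_real (l k) * u k j)" if "j < n" for j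
    proof -
      have "r (r (u k)) j = r (\<lambda>i. of_real (l k) * u k i) j"
        unfolding rD[of _ j] using ru[OF k] by (intro sum.cong) auto
      then show ?thesis using rc ru[OF k that] by simp
    qed
    have sw: "s w j = - of_real (l k) * w j" if "j < n" for j
    proof -
      have "s w j = 1 * s (s (u k)) j - of_real (l k) * s (u k) j"
        unfolding w_def by (rule slin)
      then show ?thesis using ss[OF that, of "u k"] rr[OF that] unfolding w_def by (simp add: algebra_simps)
    qed
    have "(\<Sum>i<n. (s w i) * cnj (w i)) = - of_real (l k) * (\<Sum>i<n. w i * cnj (w i))"
      by (simp add: sw sum_distrib_left sum_negf mult.assoc)
    also have "\<dots> = of_real (- l k * (\<Sum>i<n. (cmod (w i))\<^sup>2))"
      unfolding of_real_mult of_real_sum_cmod_sq by simp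
    finally have "0 \<le> - l k * (\<Sum>i<n. (cmod (w i))\<^sup>2)"
      using pS[of w] unfolding s_def by (simp add: less_eq_complex_def)
    then have "\<not> 0 < (\<Sum>i<n. (cmod (w i))\<^sup>2)"
      using lpos[OF k] mult_pos_pos[of "l k" "\<Sum>i<n. (cmod (w i))\<^sup>2"] by linarith
    then have "(\<Sum>i<n. (cmod (w i))\<^sup>2) \<le> 0" by linarith
    moreover have "(cmod (w i))\<^sup>2 \<le> (\<Sum>i<n. (cmod (w i))\<^sup>2)"
      using i by (intro member_le_sum) auto
    ultimately have "(cmod (w i))\<^sup>2 \<le> 0" by linarith
    then show ?thesis unfolding w_def by simp
  qed
  have rs: "r v i = s v i" if i: "i < n" for v i
  proof -
    define c where "c = (\<lambda>k. \<Sum>j<n. v j * cnj (u k j))"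
    define p where "p = (\<lambda>i. \<Sum>k<K. c k * u k i)"
    \<comment> \<open>The part of \<open>v\<close> orthogonal to the eigenvectors, on which
      \<open>R\<close> and therefore also \<open>S\<close> vanishes.\<close>
    define w where "w = (\<lambda>i. 1 * v i - 1 * p i)"
    have rlin: "r (\<lambda>i. a * v i - b * w i) i = a * r v i - b * r w i" for a b v w i
      unfolding r_def by (simp add: right_diff_distrib sum_subtractf sum_distrib_left mult_ac)
    have lin: "(\<Sum>j<n. M $$ (i, j) * p j) = (\<Sum>k<K. c k * (\<Sum>j<n. M $$ (i, j) * u k j))" for M i
      unfolding p_def sum_distrib_left
      by (subst sum.swap) (simp add: mult_ac)
    have sp: "s p i = r p i"
    proof -
      have "s p i = (\<Sum>k<K. c k * s (u k) i)" unfolding s_def by (rule lin)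
      also have "\<dots> = (\<Sum>k<K. c k * r (u k) i)" using su ru i by simp
      also have "\<dots> = r p i" unfolding r_def by (rule lin[symmetric])
      finally show ?thesis .
    qed
    have rp: "r p j = (\<Sum>k<K. of_real (l k) * u k j * c k)" if "j < n" for j
    proof -
      have "r p j = (\<Sum>k<K. c k * r (u k) j)" unfolding r_def by (rule lin)
      then show ?thesis using ru that by (simp add: mult_ac)
    qed
    have rw: "r w j = 0" if "j < n" for j
    proof -
      have "r w j = 1 * r v j - 1 * r p j" unfolding w_def by (rule rlin)
      also have "r v j = (\<Sum>k<K. of_real (l k) * u k j * c k)"
        unfolding r_def Rl c_def using that by (rule spec_mat_apply)
      finally show ?thesis using rp[OF that] by simp
    qed
    have "\<forall>i<n. (\<Sum>j<n. S $$ (i, j) * w j) = 0"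
    proof (rule hermitian_square_ker[OF hS])
      fix i assume i: "i < n"
      have "r (r w) i = 0" unfolding rD[of _ i] using rw by simp
      then have "s (s w) i = 0" using ss[OF i] by simp
      then show "(\<Sum>j<n. S $$ (i, j) * (\<Sum>k<n. S $$ (j, k) * w k)) = 0" unfolding s_def .
    qed
    then have "s w i = 0" using i unfolding s_def by blast
    then have "s v i = s p i" using slin[of 1 v 1 p i] unfolding w_def by simp
    moreover have "r v i = r p i" using rlin[of 1 v 1 p i] rw[OF i] unfolding w_def by simp
    ultimately show ?thesis using sp by simp
  qed
  show ?thesis
  proof (intro eq_matI)
    fix i j assume "i < dim_row R" "j < dim_col R"
    then have ij: "i < n" "j < n" using Rc by auto
    show "S $$ (i, j) = R $$ (i, j)"
      using rs[OF ij(1), of "\<lambda>x. if x = j then 1 else 0"] ij unfolding r_def s_def by (simp add: sum_if_delta)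
  qed (use Rc Sc in auto)
qed

section \<open>The trace norm and its dual description by contractions\<close>

lemma trnorm_spec_mat:
  assumes o: "orthonormal n K u"
  shows "trnorm (spec_mat n K l u) = 1 / 2 * (\<Sum>k<K. \<bar>l k\<bar>)"
proof -
  let ?D = "spec_mat n K l u"
  have adj: "mat_adjoint ?D = ?D"
    using hermitian_spec_mat by (subst mat_adjoint_eq_iff) auto
  have DD: "?D * ?D \<in> carrier_mat n n" by (rule mult_carrier_mat[of _ n n]) auto
  have "mat_sqrt (?D * ?D) = spec_mat n K (\<lambda>k. \<bar>l k\<bar>) u"
    unfolding mat_sqrt_def
  proof (rule the_equality)
    have d: "dim_row (?D * ?D) = n" using DD by (rule carrier_matD(1))
    show *: "psd (dim_row (?D * ?D)) (spec_mat n K (\<lambda>k. \<bar>l k\<bar>) u) \<and>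
      spec_mat n K (\<lambda>k. \<bar>l k\<bar>) u * spec_mat n K (\<lambda>k. \<bar>l k\<bar>) u = ?D * ?D"
      unfolding d by (intro conjI psd_spec_mat) (simp_all add: spec_mat_mult[OF o])
    show "R = spec_mat n K (\<lambda>k. \<bar>l k\<bar>) u" if "psd (dim_row (?D * ?D)) R \<and> R * R = ?D * ?D" for R
      using psd_sqrt_unique * that by metis
  qed
  then show ?thesis unfolding trnorm_def adj by (simp add: tr_spec_mat[OF o])
qed

text \<open>The condition bounds the norm of the transpose, which is the norm of the matrix.\<close>

definition contraction :: "nat \<Rightarrow> complex mat \<Rightarrow> bool" where
  "contraction n T \<longleftrightarrow> T \<in> carrier_mat n n \<and>
     (\<forall>v. (\<Sum>j<n. (cmod (\<Sum>i<n. T $$ (i, j) * v i))\<^sup>2) \<le> (\<Sum>i<n. (cmod (v i))\<^sup>2))"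

lemma contraction_carrier: "contraction n T \<Longrightarrow> T \<in> carrier_mat n n"
  unfolding contraction_def by (rule conjunct1)

lemma contraction_le:
  "contraction n T \<Longrightarrow> (\<Sum>j<n. (cmod (\<Sum>i<n. T $$ (i, j) * v i))\<^sup>2) \<le> (\<Sum>i<n. (cmod (v i))\<^sup>2)"
  unfolding contraction_def by (elim conjE allE)

text \<open>The Cauchy-Schwarz inequality in bilinear form, without conjugation.\<close>

lemma cmod_sum_mult_le:
  "cmod (\<Sum>i\<in>I. a i * b i) \<le> sqrt (\<Sum>i\<in>I. (cmod (a i))\<^sup>2) * sqrt (\<Sum>i\<in>I. (cmod (b i))\<^sup>2)"
proof -
  have "cmod (\<Sum>i\<in>I. a i * b i) \<le> (\<Sum>i\<in>I. \<bar>cmod (a i)\<bar> * \<bar>cmod (b i)\<bar>)"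
    by (rule order.trans[OF norm_sum]) (simp add: norm_mult)
  also have "\<dots> \<le> L2_set (\<lambda>i. cmod (a i)) I * L2_set (\<lambda>i. cmod (b i)) I" by (rule L2_set_mult_ineq)
  finally show ?thesis unfolding L2_set_def .
qed

lemma tr_mult: "A \<in> carrier_mat n n \<Longrightarrow> B \<in> carrier_mat n n \<Longrightarrow> tr (A * B) = (\<Sum>i<n. \<Sum>j<n. A $$ (i, j) * B $$ (j, i))"
  unfolding tr_def by (auto simp: mat_mult_index[of A n n B n] simp del: index_mult_mat(1))

text \<open>In the spectral decomposition of \<open>D\<close>, each eigenvector contributes its
  eigenvalue times a matrix element of \<open>T\<close>, whose modulus is at most 1. The factor 2
  undoes the \<open>1 / 2\<close> in \<open>trnorm\<close>.\<close>

lemma contraction_tr_le_trnorm: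
  assumes D: "D \<in> carrier_mat n n" "hermitian n (\<lambda>i j. D $$ (i, j))" and T: "contraction n T"
  shows "cmod (tr (T * D)) \<le> 2 * trnorm D"
proof -
  obtain K l u where o: "orthonormal n K u" and Dl: "D = spec_mat n K l u"
    by (rule hermitian_spec_matE[OF D])
  have "tr (T * D) = (\<Sum>i<n. \<Sum>j<n. T $$ (i, j) * D $$ (j, i))"
    using T D unfolding contraction_def by (intro tr_mult) auto
  also have "\<dots> = (\<Sum>i<n. \<Sum>j<n. \<Sum>k<K. of_real (l k) * (u k j * (T $$ (i, j) * cnj (u k i))))"
    unfolding Dl by (intro sum.cong) (auto simp: spec_mat_index sum_distrib_left mult_ac)
  also have "\<dots> = (\<Sum>i<n. \<Sum>k<K. \<Sum>j<n. of_real (l k) * (u k j * (T $$ (i, j) * cnj (u k i))))"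
    by (intro sum.cong refl sum.swap)
  also have "\<dots> = (\<Sum>k<K. \<Sum>i<n. \<Sum>j<n. of_real (l k) * (u k j * (T $$ (i, j) * cnj (u k i))))"
    by (rule sum.swap)
  also have "\<dots> = (\<Sum>k<K. \<Sum>j<n. \<Sum>i<n. of_real (l k) * (u k j * (T $$ (i, j) * cnj (u k i))))"
    by (intro sum.cong refl sum.swap)
  also have "\<dots> = (\<Sum>k<K. of_real (l k) * (\<Sum>j<n. u k j * (\<Sum>i<n. T $$ (i, j) * cnj (u k i))))"
    by (simp add: sum_distrib_left)
  finally have "cmod (tr (T * D)) \<le> (\<Sum>k<K. cmod (of_real (l k) * (\<Sum>j<n. u k j * (\<Sum>i<n. T $$ (i, j) * cnj (u k i)))))"
    by (simp add: norm_sum)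
  also have "\<dots> \<le> (\<Sum>k<K. \<bar>l k\<bar> * 1)"
  proof (intro sum_mono)
    fix k assume k: "k \<in> {..<K}"
    have u1: "(\<Sum>i<n. (cmod (u k i))\<^sup>2) = 1"
    proof -
      have "complex_of_real (\<Sum>i<n. (cmod (u k i))\<^sup>2) = 1"
        unfolding of_real_sum_cmod_sq using o k unfolding orthonormal_def by simp
      then show ?thesis by (simp only: of_real_eq_1_iff)
    qed
    have "(\<Sum>j<n. (cmod (\<Sum>i<n. T $$ (i, j) * cnj (u k i)))\<^sup>2) \<le> (\<Sum>i<n. (cmod (cnj (u k i)))\<^sup>2)"
      by (rule contraction_le[OF T])
    then have T1: "(\<Sum>j<n. (cmod (\<Sum>i<n. T $$ (i, j) * cnj (u k i)))\<^sup>2) \<le> 1" using u1 by simp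
    have "cmod (\<Sum>j<n. u k j * (\<Sum>i<n. T $$ (i, j) * cnj (u k i))) \<le> 1"
    proof (rule order.trans[OF cmod_sum_mult_le])
      show "sqrt (\<Sum>i<n. (cmod (u k i))\<^sup>2) * sqrt (\<Sum>j<n. (cmod (\<Sum>i<n. T $$ (i, j) * cnj (u k i)))\<^sup>2) \<le> 1"
        unfolding u1 using T1 by simp
    qed
    then show "cmod (of_real (l k) * (\<Sum>j<n. u k j * (\<Sum>i<n. T $$ (i, j) * cnj (u k i)))) \<le> \<bar>l k\<bar> * 1"
      by (simp only: norm_mult norm_of_real) (intro mult_left_mono; simp)
  qed
  also have "\<dots> = 2 * trnorm D" unfolding Dl trnorm_spec_mat[OF o] by simp
  finally show ?thesis .
qed

text \<open>The optimal test is the sign of \<open>D\<close>, taken as 0 on the kernel; it is a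
  contraction by Bessel's inequality.\<close>

lemma trnorm_attained:
  assumes D: "D \<in> carrier_mat n n" "hermitian n (\<lambda>i j. D $$ (i, j))"
  shows "\<exists>T. contraction n T \<and> tr (T * D) = of_real (2 * trnorm D)"
proof -
  obtain K l u where o: "orthonormal n K u" and Dl: "D = spec_mat n K l u"
    by (rule hermitian_spec_matE[OF D])
  define T where "T = spec_mat n K (\<lambda>k. sgn (l k)) u"
  have "contraction n T"
    unfolding contraction_def
  proof (intro conjI allI)
    show "T \<in> carrier_mat n n" unfolding T_def by simp
    fix v :: "nat \<Rightarrow> complex"
    \<comment> \<open>\<open>contraction\<close> uses the transpose of \<open>T\<close>, which is
      diagonal in the conjugated vectors; the conjugations lead back to sums over
      \<open>u\<close>.\<close>
    define c where "c = (\<lambda>k. of_real (sgn (l k)) * cnj (\<Sum>i<n. cnj (v i) * cnj (u k i)))"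
    have "(\<Sum>i<n. T $$ (i, j) * v i) = cnj (\<Sum>k<K. cnj (c k) * u k j)" if "j < n" for j
    proof -
      have "(\<Sum>i<n. T $$ (i, j) * v i) = (\<Sum>i<n. \<Sum>k<K. of_real (sgn (l k)) * (v i * u k i) * cnj (u k j))"
        using that unfolding T_def by (intro sum.cong) (auto simp: spec_mat_index sum_distrib_left mult_ac)
      also have "\<dots> = (\<Sum>k<K. c k * cnj (u k j))"
        unfolding c_def by (subst sum.swap) (simp add: sum_distrib_left sum_distrib_right)
      finally show ?thesis by simp
    qed
    then have "(\<Sum>j<n. (cmod (\<Sum>i<n. T $$ (i, j) * v i))\<^sup>2) = (\<Sum>j<n. (cmod (\<Sum>k<K. cnj (c k) * u k j))\<^sup>2)"
      by (simp del: cnj_sum)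
    also have "\<dots> = (\<Sum>k<K. (cmod (cnj (c k)))\<^sup>2)" by (rule orthonormal_sum_cmod_sq[OF o])
    also have "\<dots> \<le> (\<Sum>k<K. (cmod (\<Sum>i<n. cnj (v i) * cnj (u k i)))\<^sup>2)"
      unfolding c_def complex_mod_cnj norm_mult
      by (intro sum_mono power_mono) (auto simp: sgn_if)
    also have "\<dots> \<le> (\<Sum>i<n. (cmod (cnj (v i)))\<^sup>2)" by (rule bessel[OF o])
    finally show "(\<Sum>j<n. (cmod (\<Sum>i<n. T $$ (i, j) * v i))\<^sup>2) \<le> (\<Sum>i<n. (cmod (v i))\<^sup>2)" by simp
  qed
  moreover have "tr (T * D) = of_real (2 * trnorm D)"
    unfolding T_def Dl spec_mat_mult[OF o] tr_spec_mat[OF o] trnorm_spec_mat[OF o]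
    by (simp add: abs_sgn mult.commute)
  ultimately show ?thesis by blast
qed

subsection \<open>The bias of sign matrices under local operations\<close>

text \<open>The completeness relation of Kraus operators, stated as the isometry of the map that
  sends \<open>v\<close> to the family of all \<open>F \<alpha> v\<close>. The dimension may drop
  from \<open>D\<close> to \<open>d\<close>, because a partial trace can be absorbed into the index
  set \<open>I\<close>.\<close>

definition kraus :: "nat \<Rightarrow> nat \<Rightarrow> 'i set \<Rightarrow> ('i \<Rightarrow> nat \<Rightarrow> nat \<Rightarrow> complex) \<Rightarrow> bool" where
  "kraus D d I F \<longleftrightarrow> finite I \<and>
     (\<forall>v. (\<Sum>\<alpha>\<in>I. \<Sum>i<d. (cmod (\<Sum>a<D. F \<alpha> i a * v a))\<^sup>2) = (\<Sum>a<D. (cmod (v a))\<^sup>2))"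

lemma krausD:
  "kraus D d I F \<Longrightarrow> (\<Sum>\<alpha>\<in>I. \<Sum>i<d. (cmod (\<Sum>a<D. F \<alpha> i a * v a))\<^sup>2) = (\<Sum>a<D. (cmod (v a))\<^sup>2)"
  unfolding kraus_def by (elim conjE allE)

text \<open>The adjoint of an isometry does not increase lengths: \<open>S\<close> is the inner
  product of \<open>w\<close> with the image of \<open>h\<close>, and that image has the length of
  \<open>h\<close>, so the Cauchy-Schwarz inequality gives
  \<open>S \<le> sqrt W * sqrt S\<close>.\<close>

lemma kraus_adjoint_le:
  assumes k: "kraus D d I F"
  shows "(\<Sum>a<D. (cmod (\<Sum>\<alpha>\<in>I. \<Sum>i<d. cnj (F \<alpha> i a) * w \<alpha> i))\<^sup>2) \<le> (\<Sum>\<alpha>\<in>I. \<Sum>i<d. (cmod (w \<alpha> i))\<^sup>2)"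
proof -
  define h where "h = (\<lambda>a. \<Sum>\<alpha>\<in>I. \<Sum>i<d. cnj (F \<alpha> i a) * w \<alpha> i)"
  define S where "S = (\<Sum>a<D. (cmod (h a))\<^sup>2)"
  define W where "W = (\<Sum>\<alpha>\<in>I. \<Sum>i<d. (cmod (w \<alpha> i))\<^sup>2)"
  have S0: "S \<ge> 0" and W0: "W \<ge> 0" unfolding S_def W_def by (auto intro!: sum_nonneg)
  have "complex_of_real S = (\<Sum>a<D. \<Sum>\<alpha>\<in>I. \<Sum>i<d. cnj (F \<alpha> i a) * w \<alpha> i * cnj (h a))"
    unfolding S_def of_real_sum_cmod_sq by (simp add: h_def[THEN fun_cong] sum_distrib_right)
  also have "\<dots> = (\<Sum>\<alpha>\<in>I. \<Sum>a<D. \<Sum>i<d. cnj (F \<alpha> i a) * w \<alpha> i * cnj (h a))"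
    by (rule sum.swap)
  also have "\<dots> = (\<Sum>\<alpha>\<in>I. \<Sum>i<d. \<Sum>a<D. cnj (F \<alpha> i a) * w \<alpha> i * cnj (h a))"
    by (intro sum.cong refl sum.swap)
  also have "\<dots> = (\<Sum>\<alpha>\<in>I. \<Sum>i<d. w \<alpha> i * cnj (\<Sum>a<D. F \<alpha> i a * h a))"
    by (simp add: sum_distrib_left mult_ac)
  also have "\<dots> = (\<Sum>(\<alpha>, i)\<in>I \<times> {..<d}. w \<alpha> i * cnj (\<Sum>a<D. F \<alpha> i a * h a))"
    by (simp add: sum.cartesian_product)
  finally have "cmod (complex_of_real S) = cmod (\<Sum>z\<in>I \<times> {..<d}. w (fst z) (snd z) * cnj (\<Sum>a<D. F (fst z) (snd z) a * h a))"
    by (simp add: case_prod_beta del: norm_of_real)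
  also have "\<dots> \<le> sqrt (\<Sum>z\<in>I \<times> {..<d}. (cmod (w (fst z) (snd z)))\<^sup>2) *
      sqrt (\<Sum>z\<in>I \<times> {..<d}. (cmod (cnj (\<Sum>a<D. F (fst z) (snd z) a * h a)))\<^sup>2)"
    by (rule cmod_sum_mult_le)
  also have "(\<Sum>z\<in>I \<times> {..<d}. (cmod (w (fst z) (snd z)))\<^sup>2) = W"
    unfolding W_def by (simp add: sum.cartesian_product case_prod_beta)
  also have "(\<Sum>z\<in>I \<times> {..<d}. (cmod (cnj (\<Sum>a<D. F (fst z) (snd z) a * h a)))\<^sup>2) = S"
    unfolding S_def krausD[OF k, symmetric] complex_mod_cnj by (simp add: sum.cartesian_product case_prod_beta)
  finally have "S \<le> sqrt W * sqrt S" using S0 by simp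
  then have "sqrt S * sqrt S \<le> sqrt W * sqrt S" using S0 by simp
  then have "sqrt S \<le> sqrt W \<or> sqrt S = 0" using S0
    by (metis less_eq_real_def mult_le_cancel_right real_sqrt_ge_zero not_less)
  then have "S \<le> W" using W0 by auto
  then show ?thesis unfolding S_def W_def h_def .
qed

text \<open>Lindsey's lemma for families of vectors: the Cauchy-Schwarz inequality is applied over
  the pairs \<open>(y, \<kappa>)\<close>, and orthogonality of the rows of \<open>sg\<close> makes
  the squared length of \<open>W\<close> exactly \<open>N\<close> times that of
  \<open>a\<close>.\<close>

lemma signed_bilinear_bound:
  fixes sg :: "'x \<Rightarrow> 'y \<Rightarrow> complex"
  assumes fX: "finite X" and N: "N \<ge> 0"
    and orth: "\<And>x x'. x \<in> X \<Longrightarrow> x' \<in> X \<Longrightarrow> (\<Sum>y\<in>Y. sg x y * cnj (sg x' y)) = (if x = x' then of_real N else 0)"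
  shows "cmod (\<Sum>x\<in>X. \<Sum>y\<in>Y. sg x y * (\<Sum>\<kappa>\<in>Q. a x \<kappa> * b y \<kappa>))
    \<le> sqrt N * sqrt (\<Sum>x\<in>X. \<Sum>\<kappa>\<in>Q. (cmod (a x \<kappa>))\<^sup>2) * sqrt (\<Sum>y\<in>Y. \<Sum>\<kappa>\<in>Q. (cmod (b y \<kappa>))\<^sup>2)"
proof -
  define W where "W = (\<lambda>y \<kappa>. \<Sum>x\<in>X. sg x y * a x \<kappa>)"
  have W: "(\<Sum>y\<in>Y. (cmod (W y \<kappa>))\<^sup>2) = N * (\<Sum>x\<in>X. (cmod (a x \<kappa>))\<^sup>2)" for \<kappa>
  proof -
    have "complex_of_real (\<Sum>y\<in>Y. (cmod (W y \<kappa>))\<^sup>2)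
        = (\<Sum>y\<in>Y. \<Sum>x\<in>X. \<Sum>x'\<in>X. (a x \<kappa> * cnj (a x' \<kappa>)) * (sg x y * cnj (sg x' y)))"
      unfolding of_real_sum_cmod_sq W_def by (simp add: sum_product mult_ac)
    also have "\<dots> = (\<Sum>x\<in>X. \<Sum>y\<in>Y. \<Sum>x'\<in>X. (a x \<kappa> * cnj (a x' \<kappa>)) * (sg x y * cnj (sg x' y)))"
      by (rule sum.swap)
    also have "\<dots> = (\<Sum>x\<in>X. \<Sum>x'\<in>X. \<Sum>y\<in>Y. (a x \<kappa> * cnj (a x' \<kappa>)) * (sg x y * cnj (sg x' y)))"
      by (intro sum.cong refl sum.swap)
    also have "\<dots> = (\<Sum>x\<in>X. \<Sum>x'\<in>X. (a x \<kappa> * cnj (a x' \<kappa>)) * (\<Sum>y\<in>Y. sg x y * cnj (sg x' y)))"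
      by (simp add: sum_distrib_left)
    also have "\<dots> = (\<Sum>x\<in>X. \<Sum>x'\<in>X. (a x \<kappa> * cnj (a x' \<kappa>)) * (if x = x' then of_real N else 0))"
      by (intro sum.cong refl) (simp only: orth)
    also have "\<dots> = (\<Sum>x\<in>X. of_real N * (a x \<kappa> * cnj (a x \<kappa>)))"
      using fX by (intro sum.cong refl) (simp add: if_distrib[of "\<lambda>z. _ * z"] cong: if_cong)
    also have "\<dots> = of_real (N * (\<Sum>x\<in>X. (cmod (a x \<kappa>))\<^sup>2))"
      unfolding of_real_mult of_real_sum_cmod_sq by (simp add: sum_distrib_left)
    finally show ?thesis by (simp only: of_real_eq_iff)
  qed
  have "(\<Sum>x\<in>X. \<Sum>y\<in>Y. sg x y * (\<Sum>\<kappa>\<in>Q. a x \<kappa> * b y \<kappa>))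
      = (\<Sum>y\<in>Y. \<Sum>x\<in>X. \<Sum>\<kappa>\<in>Q. b y \<kappa> * (sg x y * a x \<kappa>))"
    by (subst sum.swap) (simp add: sum_distrib_left mult_ac)
  also have "\<dots> = (\<Sum>y\<in>Y. \<Sum>\<kappa>\<in>Q. b y \<kappa> * W y \<kappa>)"
    unfolding W_def sum_distrib_left by (intro sum.cong refl sum.swap)
  also have "\<dots> = (\<Sum>z\<in>Y \<times> Q. b (fst z) (snd z) * W (fst z) (snd z))"
    by (simp add: sum.cartesian_product case_prod_beta)
  also have "cmod \<dots> \<le> sqrt (\<Sum>z\<in>Y \<times> Q. (cmod (b (fst z) (snd z)))\<^sup>2) * sqrt (\<Sum>z\<in>Y \<times> Q. (cmod (W (fst z) (snd z)))\<^sup>2)"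
    by (rule cmod_sum_mult_le)
  also have "(\<Sum>z\<in>Y \<times> Q. (cmod (b (fst z) (snd z)))\<^sup>2) = (\<Sum>y\<in>Y. \<Sum>\<kappa>\<in>Q. (cmod (b y \<kappa>))\<^sup>2)"
    by (simp add: sum.cartesian_product case_prod_beta)
  also have "(\<Sum>z\<in>Y \<times> Q. (cmod (W (fst z) (snd z)))\<^sup>2) = (\<Sum>y\<in>Y. \<Sum>\<kappa>\<in>Q. (cmod (W y \<kappa>))\<^sup>2)"
    by (simp add: sum.cartesian_product case_prod_beta)
  also have "\<dots> = (\<Sum>\<kappa>\<in>Q. N * (\<Sum>x\<in>X. (cmod (a x \<kappa>))\<^sup>2))"
    by (subst sum.swap) (simp only: W)
  also have "\<dots> = N * (\<Sum>x\<in>X. \<Sum>\<kappa>\<in>Q. (cmod (a x \<kappa>))\<^sup>2)"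
    by (subst sum.swap) (simp add: sum_distrib_left)
  finally show ?thesis by (simp add: real_sqrt_mult mult_ac)
qed

section \<open>Expectations of tests under local operations\<close>

definition evolve where
  "evolve D1 D2 F G s i j = (\<Sum>a<D1. \<Sum>b<D2. F i a * G j b * s a b)"
  for D1 D2 :: nat and F G s :: "nat \<Rightarrow> nat \<Rightarrow> complex"

text \<open>This is \<open>Tr (t \<rho>)\<close> for the state \<rho> that arises from the shared
  vector \<open>s\<close> when the two families act on its two tensor factors. The first two indices
  of \<open>t\<close> form the row, the last two the column.\<close>

definition expectation where
  "expectation d1 d2 D1 D2 I F J G s t = (\<Sum>\<alpha>\<in>I. \<Sum>\<beta>\<in>J. \<Sum>i<d1. \<Sum>j<d2. \<Sum>i'<d1. \<Sum>j'<d2.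
     t i' j' i j * evolve D1 D2 (F \<alpha>) (G \<beta>) s i j * cnj (evolve D1 D2 (F \<alpha>) (G \<beta>) s i' j'))"
  for d1 d2 D1 D2 :: nat and t :: "nat \<Rightarrow> nat \<Rightarrow> nat \<Rightarrow> nat \<Rightarrow> complex"

text \<open>The condition of \<open>contraction\<close> for a matrix whose rows and columns are
  indexed by pairs.\<close>

definition contraction2 :: "nat \<Rightarrow> nat \<Rightarrow> (nat \<Rightarrow> nat \<Rightarrow> nat \<Rightarrow> nat \<Rightarrow> complex) \<Rightarrow> bool" where
  "contraction2 d1 d2 t \<longleftrightarrow> (\<forall>v. (\<Sum>i<d1. \<Sum>j<d2. (cmod (\<Sum>i'<d1. \<Sum>j'<d2. t i' j' i j * v i' j'))\<^sup>2)
     \<le> (\<Sum>i<d1. \<Sum>j<d2. (cmod (v i j))\<^sup>2))"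

lemma evolve_swap: "evolve D1 D2 F G s i j = evolve D2 D1 G F (\<lambda>b a. s a b) j i"
  unfolding evolve_def by (subst sum.swap) (simp add: mult_ac)

text \<open>It reduces statements about the second party to those about the first.\<close>

lemma expectation_swap:
  "expectation d1 d2 D1 D2 I F J G s t
     = expectation d2 d1 D2 D1 J G I F (\<lambda>b a. s a b) (\<lambda>j' i' j i. t i' j' i j)"
proof -
  define R where "R = (\<lambda>\<alpha> \<beta> i j. evolve D1 D2 (F \<alpha>) (G \<beta>) s i j)"
  have R: "evolve D2 D1 (G \<beta>) (F \<alpha>) (\<lambda>b a. s a b) j i = R \<alpha> \<beta> i j" for \<alpha> \<beta> i j
    unfolding R_def by (rule evolve_swap[symmetric])
  have "(\<Sum>i<d1. \<Sum>j<d2. \<Sum>i'<d1. \<Sum>j'<d2. t i' j' i j * R \<alpha> \<beta> i j * cnj (R \<alpha> \<beta> i' j'))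
      = (\<Sum>j<d2. \<Sum>i<d1. \<Sum>j'<d2. \<Sum>i'<d1. t i' j' i j * R \<alpha> \<beta> i j * cnj (R \<alpha> \<beta> i' j'))" for \<alpha> \<beta>
    by (subst sum.swap) (intro sum.cong refl sum.swap)
  then show ?thesis
    unfolding expectation_def R unfolding R_def[symmetric, THEN fun_cong, THEN fun_cong, THEN fun_cong, THEN fun_cong]
    by (subst sum.swap) (simp add: R_def)
qed

lemma contraction2_swap:
  "contraction2 d1 d2 t \<Longrightarrow> contraction2 d2 d1 (\<lambda>j' i' j i. t i' j' i j)"
  unfolding contraction2_def
proof
  fix v :: "nat \<Rightarrow> nat \<Rightarrow> complex"
  assume *: "\<forall>v. (\<Sum>i<d1. \<Sum>j<d2. (cmod (\<Sum>i'<d1. \<Sum>j'<d2. t i' j' i j * v i' j'))\<^sup>2)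
     \<le> (\<Sum>i<d1. \<Sum>j<d2. (cmod (v i j))\<^sup>2)"
  have "(\<Sum>j<d2. \<Sum>i<d1. (cmod (\<Sum>j'<d2. \<Sum>i'<d1. t i' j' i j * v j' i'))\<^sup>2)
      = (\<Sum>i<d1. \<Sum>j<d2. (cmod (\<Sum>i'<d1. \<Sum>j'<d2. t i' j' i j * v j' i'))\<^sup>2)"
    by (subst sum.swap) (intro sum.cong refl arg_cong[where f = "\<lambda>z. (cmod z)\<^sup>2"] sum.swap)
  also have "\<dots> \<le> (\<Sum>i<d1. \<Sum>j<d2. (cmod (v j i))\<^sup>2)" using *[rule_format, of "\<lambda>i j. v j i"] .
  also have "\<dots> = (\<Sum>j<d2. \<Sum>i<d1. (cmod (v j i))\<^sup>2)" by (rule sum.swap)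
  finally show "(\<Sum>j<d2. \<Sum>i<d1. (cmod (\<Sum>j'<d2. \<Sum>i'<d1. t i' j' i j * v j' i'))\<^sup>2)
    \<le> (\<Sum>j<d2. \<Sum>i<d1. (cmod (v j i))\<^sup>2)" .
qed

text \<open>An expectation is the sum over \<open>j, j', a, b\<close> of the product of these two factors; the first depends
  only on the data of the first party (and the test), the second only on those of the second.\<close>

definition fac_left where
  "fac_left d1 D1 I F s t j j' a b = (\<Sum>\<alpha>\<in>I. \<Sum>i<d1. F \<alpha> i a *
      (\<Sum>i'<d1. t i' j' i j * cnj (\<Sum>a'<D1. F \<alpha> i' a' * s a' b)))"
  for d1 D1 :: nat and t :: "nat \<Rightarrow> nat \<Rightarrow> nat \<Rightarrow> nat \<Rightarrow> complex"

definition fac_right where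
  "fac_right D2 J G s j j' a b = (\<Sum>\<beta>\<in>J. cnj (G \<beta> j' b) * (\<Sum>b'<D2. G \<beta> j b' * s a b'))"
  for D2 :: nat and s :: "nat \<Rightarrow> nat \<Rightarrow> complex"

lemma sum_rearrange:
  fixes F h c g :: "_ \<Rightarrow> _ \<Rightarrow> complex"
  shows "(\<Sum>\<alpha>\<in>I. \<Sum>\<beta>\<in>J. \<Sum>i\<in>K. (\<Sum>a\<in>A. F' \<alpha> i a * h \<beta> a) * (\<Sum>b\<in>B. c \<beta> b * g' \<alpha> i b))
     = (\<Sum>a\<in>A. \<Sum>b\<in>B. (\<Sum>\<alpha>\<in>I. \<Sum>i\<in>K. F' \<alpha> i a * g' \<alpha> i b) * (\<Sum>\<beta>\<in>J. c \<beta> b * h \<beta> a))"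
proof -
  have "(\<Sum>\<alpha>\<in>I. \<Sum>\<beta>\<in>J. \<Sum>i\<in>K. (\<Sum>a\<in>A. F' \<alpha> i a * h \<beta> a) * (\<Sum>b\<in>B. c \<beta> b * g' \<alpha> i b))
      = (\<Sum>(\<alpha>, \<beta>, i, a, b)\<in>I \<times> J \<times> K \<times> A \<times> B. F' \<alpha> i a * h \<beta> a * (c \<beta> b * g' \<alpha> i b))"
    by (simp add: sum_product sum.cartesian_product)
  also have "\<dots> = (\<Sum>(a, b, \<alpha>, i, \<beta>)\<in>A \<times> B \<times> I \<times> K \<times> J. F' \<alpha> i a * g' \<alpha> i b * (c \<beta> b * h \<beta> a))"
    by (rule sum.reindex_bij_witness[where i = "\<lambda>(a, b, \<alpha>, i, \<beta>). (\<alpha>, \<beta>, i, a, b)"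
          and j = "\<lambda>(\<alpha>, \<beta>, i, a, b). (a, b, \<alpha>, i, \<beta>)"]) (auto simp: mult_ac)
  also have "\<dots> = (\<Sum>a\<in>A. \<Sum>b\<in>B. \<Sum>\<alpha>\<in>I. \<Sum>i\<in>K. \<Sum>\<beta>\<in>J. F' \<alpha> i a * g' \<alpha> i b * (c \<beta> b * h \<beta> a))"
    by (simp add: sum.cartesian_product)
  also have "\<dots> = (\<Sum>a\<in>A. \<Sum>b\<in>B. (\<Sum>\<alpha>\<in>I. \<Sum>i\<in>K. F' \<alpha> i a * g' \<alpha> i b) * (\<Sum>\<beta>\<in>J. c \<beta> b * h \<beta> a))"
    by (simp only: sum_distrib_right, simp only: sum_distrib_left)
  finally show ?thesis .
qed

text \<open>The shared vector ties the two parties together in every amplitude. The separation comes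
  from expanding the amplitude by \<open>R1\<close>, with \<open>F\<close> outermost, and its
  conjugate by \<open>R2\<close>, with \<open>G\<close> outermost. The summation variables
  \<open>a\<close> and \<open>b\<close> exposed in this way, together with \<open>j\<close> and
  \<open>j'\<close>, are all that the two factors have in common.\<close>

lemma expectation_factor:
  "expectation d1 d2 D1 D2 I F J G s t = (\<Sum>j<d2. \<Sum>j'<d2. \<Sum>a<D1. \<Sum>b<D2.
     fac_left d1 D1 I F s t j j' a b * fac_right D2 J G s j j' a b)"
proof -
  define h where "h = (\<lambda>\<beta> j a. \<Sum>b<D2. G \<beta> j b * s a b)"
  define k where "k = (\<lambda>\<alpha> i b. \<Sum>a<D1. F \<alpha> i a * s a b)"
  have R1: "evolve D1 D2 (F \<alpha>) (G \<beta>) s i j = (\<Sum>a<D1. F \<alpha> i a * h \<beta> j a)" for \<alpha> \<beta> i j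
    unfolding evolve_def h_def by (simp add: sum_distrib_left mult.assoc)
  have R2: "evolve D1 D2 (F \<alpha>) (G \<beta>) s i j = (\<Sum>b<D2. G \<beta> j b * k \<alpha> i b)" for \<alpha> \<beta> i j
    unfolding evolve_def k_def by (subst sum.swap) (simp add: sum_distrib_left mult_ac)
  have "(\<Sum>\<alpha>\<in>I. \<Sum>\<beta>\<in>J. \<Sum>i<d1. \<Sum>j<d2. \<Sum>i'<d1. \<Sum>j'<d2.
       t i' j' i j * evolve D1 D2 (F \<alpha>) (G \<beta>) s i j * cnj (evolve D1 D2 (F \<alpha>) (G \<beta>) s i' j'))
     = (\<Sum>\<alpha>\<in>I. \<Sum>\<beta>\<in>J. \<Sum>i<d1. \<Sum>j<d2. \<Sum>j'<d2. \<Sum>i'<d1.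
       t i' j' i j * evolve D1 D2 (F \<alpha>) (G \<beta>) s i j * cnj (evolve D1 D2 (F \<alpha>) (G \<beta>) s i' j'))"
    by (intro sum.cong refl sum.swap)
  also have "\<dots> = (\<Sum>\<alpha>\<in>I. \<Sum>\<beta>\<in>J. \<Sum>i<d1. \<Sum>j<d2. \<Sum>j'<d2.
       (\<Sum>a<D1. F \<alpha> i a * h \<beta> j a) * (\<Sum>b<D2. cnj (G \<beta> j' b) * (\<Sum>i'<d1. t i' j' i j * cnj (k \<alpha> i' b))))"
  proof (intro sum.cong refl)
    fix \<alpha> \<beta> i j j'
    have "(\<Sum>i'<d1. t i' j' i j * evolve D1 D2 (F \<alpha>) (G \<beta>) s i j * cnj (evolve D1 D2 (F \<alpha>) (G \<beta>) s i' j'))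
        = evolve D1 D2 (F \<alpha>) (G \<beta>) s i j * (\<Sum>i'<d1. \<Sum>b<D2. cnj (G \<beta> j' b) * (t i' j' i j * cnj (k \<alpha> i' b)))"
      unfolding R2[of _ _ _ j'] by (simp add: sum_distrib_left mult_ac)
    also have "\<dots> = (\<Sum>a<D1. F \<alpha> i a * h \<beta> j a) * (\<Sum>b<D2. cnj (G \<beta> j' b) * (\<Sum>i'<d1. t i' j' i j * cnj (k \<alpha> i' b)))"
      unfolding R1 by (subst sum.swap) (simp add: sum_distrib_left)
    finally show "(\<Sum>i'<d1. t i' j' i j * evolve D1 D2 (F \<alpha>) (G \<beta>) s i j * cnj (evolve D1 D2 (F \<alpha>) (G \<beta>) s i' j'))
        = (\<Sum>a<D1. F \<alpha> i a * h \<beta> j a) * (\<Sum>b<D2. cnj (G \<beta> j' b) * (\<Sum>i'<d1. t i' j' i j * cnj (k \<alpha> i' b)))" .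
  qed
  also have "\<dots> = (\<Sum>j<d2. \<Sum>j'<d2. \<Sum>\<alpha>\<in>I. \<Sum>\<beta>\<in>J. \<Sum>i<d1.
       (\<Sum>a<D1. F \<alpha> i a * h \<beta> j a) * (\<Sum>b<D2. cnj (G \<beta> j' b) * (\<Sum>i'<d1. t i' j' i j * cnj (k \<alpha> i' b))))"
    unfolding sum.cartesian_product
    by (rule sum.reindex_bij_witness[where i = "\<lambda>(j, j', \<alpha>, \<beta>, i). (\<alpha>, \<beta>, i, j, j')"
          and j = "\<lambda>(\<alpha>, \<beta>, i, j, j'). (j, j', \<alpha>, \<beta>, i)"]) auto
  also have "\<dots> = (\<Sum>j<d2. \<Sum>j'<d2. \<Sum>a<D1. \<Sum>b<D2.
       (\<Sum>\<alpha>\<in>I. \<Sum>i<d1. F \<alpha> i a * (\<Sum>i'<d1. t i' j' i j * cnj (k \<alpha> i' b))) * (\<Sum>\<beta>\<in>J. cnj (G \<beta> j' b) * h \<beta> j a))"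
    by (intro sum.cong refl sum_rearrange)
  finally show ?thesis unfolding expectation_def fac_left_def fac_right_def h_def k_def .
qed

text \<open>For fixed \<open>j\<close>, \<open>j'\<close> and \<open>a\<close>, the factor is the
  adjoint of the isometry, applied to a vector supported on the component \<open>j'\<close>. The
  resulting bound is the same for every \<open>j'\<close>, so the sum over \<open>j'\<close> costs
  the factor \<open>d2\<close>; the remaining sums are evaluated by the isometry itself.\<close>

lemma fac_right_bound:
  assumes k: "kraus D2 d2 J G"
  shows "(\<Sum>j<d2. \<Sum>j'<d2. \<Sum>a<D1. \<Sum>b<D2. (cmod (fac_right D2 J G s j j' a b))\<^sup>2)
     \<le> real d2 * (\<Sum>a<D1. \<Sum>b<D2. (cmod (s a b))\<^sup>2)"
proof -
  define h where "h = (\<lambda>\<beta> j a. \<Sum>b<D2. G \<beta> j b * s a b)"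
  have 1: "(\<Sum>b<D2. (cmod (fac_right D2 J G s j j' a b))\<^sup>2) \<le> (\<Sum>\<beta>\<in>J. (cmod (h \<beta> j a))\<^sup>2)"
    if j': "j' < d2" for j j' a
  proof -
    have "(\<Sum>b<D2. (cmod (\<Sum>\<beta>\<in>J. \<Sum>i<d2. cnj (G \<beta> i b) * (if i = j' then h \<beta> j a else 0)))\<^sup>2)
        \<le> (\<Sum>\<beta>\<in>J. \<Sum>i<d2. (cmod (if i = j' then h \<beta> j a else 0))\<^sup>2)"
      by (rule kraus_adjoint_le[OF k])
    also have "\<dots> = (\<Sum>\<beta>\<in>J. \<Sum>i<d2. if i = j' then (cmod (h \<beta> j a))\<^sup>2 else 0)"
      by (intro sum.cong) auto
    also have "(\<Sum>b<D2. (cmod (\<Sum>\<beta>\<in>J. \<Sum>i<d2. cnj (G \<beta> i b) * (if i = j' then h \<beta> j a else 0)))\<^sup>2)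
        = (\<Sum>b<D2. (cmod (\<Sum>\<beta>\<in>J. \<Sum>i<d2. if i = j' then cnj (G \<beta> i b) * h \<beta> j a else 0))\<^sup>2)"
      by (intro sum.cong refl arg_cong[where f = "\<lambda>z. (cmod z)\<^sup>2"]) auto
    finally show ?thesis using j' unfolding fac_right_def h_def by simp
  qed
  have "(\<Sum>j<d2. \<Sum>j'<d2. \<Sum>a<D1. \<Sum>b<D2. (cmod (fac_right D2 J G s j j' a b))\<^sup>2)
     \<le> (\<Sum>j<d2. \<Sum>j'<d2. \<Sum>a<D1. \<Sum>\<beta>\<in>J. (cmod (h \<beta> j a))\<^sup>2)"
    using 1 by (intro sum_mono) auto
  also have "\<dots> = real d2 * (\<Sum>j<d2. \<Sum>a<D1. \<Sum>\<beta>\<in>J. (cmod (h \<beta> j a))\<^sup>2)"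
    by (simp add: sum_distrib_left)
  also have "(\<Sum>j<d2. \<Sum>a<D1. \<Sum>\<beta>\<in>J. (cmod (h \<beta> j a))\<^sup>2) = (\<Sum>a<D1. \<Sum>j<d2. \<Sum>\<beta>\<in>J. (cmod (h \<beta> j a))\<^sup>2)"
    by (rule sum.swap)
  also have "\<dots> = (\<Sum>a<D1. \<Sum>\<beta>\<in>J. \<Sum>j<d2. (cmod (h \<beta> j a))\<^sup>2)"
    by (intro sum.cong refl sum.swap)
  also have "\<dots> = (\<Sum>a<D1. \<Sum>b<D2. (cmod (s a b))\<^sup>2)"
    unfolding h_def krausD[OF k] ..
  finally show ?thesis .
qed

text \<open>Three length estimates in a row: the adjoint of the isometry handles the sum over
  \<open>a\<close>, the test the sums over \<open>j\<close> and \<open>i\<close>, and the isometry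
  those over \<open>\<alpha>\<close> and \<open>i\<close>. Only the free index \<open>j'\<close>
  costs a factor; the first party's dimension \<open>d1\<close> does not appear.\<close>

lemma fac_left_bound:
  assumes k: "kraus D1 d1 I F" and t: "contraction2 d1 d2 t"
  shows "(\<Sum>j<d2. \<Sum>j'<d2. \<Sum>a<D1. \<Sum>b<D2. (cmod (fac_left d1 D1 I F s t j j' a b))\<^sup>2)
     \<le> real d2 * (\<Sum>a<D1. \<Sum>b<D2. (cmod (s a b))\<^sup>2)"
proof -
  define k' where "k' = (\<lambda>\<alpha> i b. \<Sum>a<D1. F \<alpha> i a * s a b)"
  define g where "g = (\<lambda>j j' \<alpha> i b. \<Sum>i'<d1. t i' j' i j * cnj (k' \<alpha> i' b))"
  have 1: "(\<Sum>a<D1. (cmod (fac_left d1 D1 I F s t j j' a b))\<^sup>2) \<le> (\<Sum>\<alpha>\<in>I. \<Sum>i<d1. (cmod (g j j' \<alpha> i b))\<^sup>2)" for j j' b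
  proof -
    have "(\<Sum>a<D1. (cmod (fac_left d1 D1 I F s t j j' a b))\<^sup>2)
        = (\<Sum>a<D1. (cmod (cnj (fac_left d1 D1 I F s t j j' a b)))\<^sup>2)" by simp
    also have "\<dots> = (\<Sum>a<D1. (cmod (\<Sum>\<alpha>\<in>I. \<Sum>i<d1. cnj (F \<alpha> i a) * cnj (g j j' \<alpha> i b)))\<^sup>2)"
      unfolding fac_left_def g_def k'_def cnj_sum complex_cnj_mult ..
    also have "\<dots> \<le> (\<Sum>\<alpha>\<in>I. \<Sum>i<d1. (cmod (cnj (g j j' \<alpha> i b)))\<^sup>2)"
      by (rule kraus_adjoint_le[OF k])
    finally show ?thesis by simp
  qed
  have 2: "(\<Sum>j<d2. \<Sum>i<d1. (cmod (g j j' \<alpha> i b))\<^sup>2) \<le> (\<Sum>i<d1. (cmod (k' \<alpha> i b))\<^sup>2)" if j': "j' < d2" for j' \<alpha> b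
  proof -
    define v where "v = (\<lambda>i' j''. if j'' = j' then cnj (k' \<alpha> i' b) else 0)"
    have "(\<Sum>i<d1. \<Sum>j<d2. (cmod (\<Sum>i'<d1. \<Sum>j''<d2. t i' j'' i j * v i' j''))\<^sup>2) \<le> (\<Sum>i<d1. \<Sum>j<d2. (cmod (v i j))\<^sup>2)"
      using t unfolding contraction2_def by (rule spec)
    also have "(\<Sum>i<d1. \<Sum>j<d2. (cmod (v i j))\<^sup>2) = (\<Sum>i<d1. \<Sum>j<d2. if j = j' then (cmod (k' \<alpha> i b))\<^sup>2 else 0)"
      unfolding v_def by (intro sum.cong) auto
    also have "(\<Sum>i<d1. \<Sum>j<d2. (cmod (\<Sum>i'<d1. \<Sum>j''<d2. t i' j'' i j * v i' j''))\<^sup>2)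
        = (\<Sum>i<d1. \<Sum>j<d2. (cmod (\<Sum>i'<d1. \<Sum>j''<d2. if j'' = j' then t i' j'' i j * cnj (k' \<alpha> i' b) else 0))\<^sup>2)"
      unfolding v_def by (intro sum.cong refl arg_cong[where f = "\<lambda>z. (cmod z)\<^sup>2"]) auto
    finally have "(\<Sum>i<d1. \<Sum>j<d2. (cmod (g j j' \<alpha> i b))\<^sup>2) \<le> (\<Sum>i<d1. (cmod (k' \<alpha> i b))\<^sup>2)"
      using j' unfolding g_def by simp
    then show ?thesis by (subst sum.swap)
  qed
  have "(\<Sum>j<d2. \<Sum>j'<d2. \<Sum>a<D1. \<Sum>b<D2. (cmod (fac_left d1 D1 I F s t j j' a b))\<^sup>2)
     = (\<Sum>j<d2. \<Sum>j'<d2. \<Sum>b<D2. \<Sum>a<D1. (cmod (fac_left d1 D1 I F s t j j' a b))\<^sup>2)"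
    by (intro sum.cong refl sum.swap)
  also have "\<dots> \<le> (\<Sum>j<d2. \<Sum>j'<d2. \<Sum>b<D2. \<Sum>\<alpha>\<in>I. \<Sum>i<d1. (cmod (g j j' \<alpha> i b))\<^sup>2)"
    using 1 by (intro sum_mono) auto
  also have "\<dots> = (\<Sum>j'<d2. \<Sum>b<D2. \<Sum>\<alpha>\<in>I. \<Sum>j<d2. \<Sum>i<d1. (cmod (g j j' \<alpha> i b))\<^sup>2)"
    unfolding sum.cartesian_product
    by (rule sum.reindex_bij_witness[where i = "\<lambda>(j', b, \<alpha>, j, i). (j, j', b, \<alpha>, i)"
          and j = "\<lambda>(j, j', b, \<alpha>, i). (j', b, \<alpha>, j, i)"]) auto
  also have "\<dots> \<le> (\<Sum>j'<d2. \<Sum>b<D2. \<Sum>\<alpha>\<in>I. \<Sum>i<d1. (cmod (k' \<alpha> i b))\<^sup>2)"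
    using 2 by (intro sum_mono) auto
  also have "\<dots> = (\<Sum>j'<d2. \<Sum>b<D2. \<Sum>a<D1. (cmod (s a b))\<^sup>2)"
    unfolding k'_def krausD[OF k] ..
  also have "\<dots> = real d2 * (\<Sum>a<D1. \<Sum>b<D2. (cmod (s a b))\<^sup>2)"
    by (subst sum.swap) simp
  finally show ?thesis .
qed

lemma weighted_sum_bound:
  fixes c :: "'x \<Rightarrow> real"
  assumes "\<And>x. x \<in> X \<Longrightarrow> (\<Sum>\<kappa>\<in>Q. (cmod (f x \<kappa>))\<^sup>2) \<le> B" "(\<Sum>x\<in>X. (c x)\<^sup>2) \<le> A" "B \<ge> 0"
  shows "(\<Sum>x\<in>X. \<Sum>\<kappa>\<in>Q. (cmod (of_real (c x) * f x \<kappa>))\<^sup>2) \<le> A * B"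
proof -
  have "(\<Sum>x\<in>X. \<Sum>\<kappa>\<in>Q. (cmod (of_real (c x) * f x \<kappa>))\<^sup>2) = (\<Sum>x\<in>X. (c x)\<^sup>2 * (\<Sum>\<kappa>\<in>Q. (cmod (f x \<kappa>))\<^sup>2))"
    by (simp add: norm_mult power_mult_distrib sum_distrib_left)
  also have "\<dots> \<le> (\<Sum>x\<in>X. (c x)\<^sup>2 * B)"
    using assms by (intro sum_mono mult_left_mono) auto
  also have "\<dots> = (\<Sum>x\<in>X. (c x)\<^sup>2) * B" by (simp add: sum_distrib_right)
  also have "\<dots> \<le> A * B" using assms by (intro mult_right_mono) auto
  finally show ?thesis .
qed

lemma signed_product_bound:
  fixes sg :: "'x \<Rightarrow> 'y \<Rightarrow> complex" and p :: "'x \<Rightarrow> real" and q :: "'y \<Rightarrow> real"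
  assumes fX: "finite X" and N: "N \<ge> 0"
    and orth: "\<And>x x'. x \<in> X \<Longrightarrow> x' \<in> X \<Longrightarrow> (\<Sum>y\<in>Y. sg x y * cnj (sg x' y)) = (if x = x' then of_real N else 0)"
    and p: "(\<Sum>x\<in>X. (p x)\<^sup>2) \<le> A" and q: "(\<Sum>y\<in>Y. (q y)\<^sup>2) \<le> B"
    and a: "\<And>x. x \<in> X \<Longrightarrow> (\<Sum>\<kappa>\<in>Q. (cmod (a x \<kappa>))\<^sup>2) \<le> M" and b: "\<And>y. y \<in> Y \<Longrightarrow> (\<Sum>\<kappa>\<in>Q. (cmod (b y \<kappa>))\<^sup>2) \<le> M"
    and M: "M \<ge> 0"
  shows "cmod (\<Sum>x\<in>X. \<Sum>y\<in>Y. sg x y * of_real (p x * q y) * (\<Sum>\<kappa>\<in>Q. a x \<kappa> * b y \<kappa>)) \<le> sqrt (N * A * B) * M"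
proof -
  have A: "A \<ge> 0" "B \<ge> 0"
    using p q sum_nonneg[of X "\<lambda>x. (p x)\<^sup>2"] sum_nonneg[of Y "\<lambda>x. (q x)\<^sup>2"] by auto
  have "(\<Sum>x\<in>X. \<Sum>y\<in>Y. sg x y * of_real (p x * q y) * (\<Sum>\<kappa>\<in>Q. a x \<kappa> * b y \<kappa>))
     = (\<Sum>x\<in>X. \<Sum>y\<in>Y. sg x y * (\<Sum>\<kappa>\<in>Q. (of_real (p x) * a x \<kappa>) * (of_real (q y) * b y \<kappa>)))"
    by (simp add: sum_distrib_left mult_ac)
  also have "cmod \<dots> \<le> sqrt N * sqrt (\<Sum>x\<in>X. \<Sum>\<kappa>\<in>Q. (cmod (of_real (p x) * a x \<kappa>))\<^sup>2)
      * sqrt (\<Sum>y\<in>Y. \<Sum>\<kappa>\<in>Q. (cmod (of_real (q y) * b y \<kappa>))\<^sup>2)"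
    by (rule signed_bilinear_bound[OF fX N orth])
  also have "\<dots> \<le> sqrt N * sqrt (A * M) * sqrt (B * M)"
    using weighted_sum_bound[OF a p M] weighted_sum_bound[OF b q M] N A M
    by (intro mult_mono real_sqrt_le_mono mult_nonneg_nonneg) (auto intro!: sum_nonneg)
  also have "\<dots> = sqrt (N * A * B) * (sqrt M * sqrt M)" by (simp add: real_sqrt_mult mult_ac)
  finally show ?thesis using M by simp
qed

text \<open>A test chosen from \<open>x\<close> is admissible because tests occur only in the factor
  of the first party. What is lost is the dimension kept by the other party.\<close>

lemma expectation_bias_left:
  fixes sg :: "'x \<Rightarrow> 'y \<Rightarrow> complex" and p :: "'x \<Rightarrow> real" and q :: "'y \<Rightarrow> real"
  assumes fX: "finite X" and N: "N \<ge> 0"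
    and orth: "\<And>x x'. x \<in> X \<Longrightarrow> x' \<in> X \<Longrightarrow> (\<Sum>y\<in>Y. sg x y * cnj (sg x' y)) = (if x = x' then of_real N else 0)"
    and p: "(\<Sum>x\<in>X. (p x)\<^sup>2) \<le> A" and q: "(\<Sum>y\<in>Y. (q y)\<^sup>2) \<le> B"
    and kF: "\<And>x. x \<in> X \<Longrightarrow> kraus D1 d1 (I x) (F x)" and kG: "\<And>y. y \<in> Y \<Longrightarrow> kraus D2 d2 (J y) (G y)"
    and t: "\<And>x. x \<in> X \<Longrightarrow> contraction2 d1 d2 (t x)"
  shows "cmod (\<Sum>x\<in>X. \<Sum>y\<in>Y. sg x y * of_real (p x * q y) * expectation d1 d2 D1 D2 (I x) (F x) (J y) (G y) s (t x))
    \<le> sqrt (N * A * B) * (real d2 * (\<Sum>a<D1. \<Sum>b<D2. (cmod (s a b))\<^sup>2))"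
proof -
  define Q where "Q = {..<d2} \<times> {..<d2} \<times> {..<D1} \<times> {..<D2}"
  define a where "a = (\<lambda>x (j, j', a, b). fac_left d1 D1 (I x) (F x) s (t x) j j' a b)"
  define b where "b = (\<lambda>y (j, j', a, b). fac_right D2 (J y) (G y) s j j' a b)"
  have eq: "expectation d1 d2 D1 D2 (I x) (F x) (J y) (G y) s (t x) = (\<Sum>\<kappa>\<in>Q. a x \<kappa> * b y \<kappa>)" for x y
    unfolding expectation_factor Q_def a_def b_def by (simp add: sum.cartesian_product case_prod_beta)
  show ?thesis unfolding eq
  proof (rule signed_product_bound[OF fX N orth p q])
    show "(\<Sum>\<kappa>\<in>Q. (cmod (a x \<kappa>))\<^sup>2) \<le> real d2 * (\<Sum>a<D1. \<Sum>b<D2. (cmod (s a b))\<^sup>2)" if "x \<in> X" for x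
      using fac_left_bound[OF kF[OF that] t[OF that], where s = s] unfolding Q_def a_def
      by (simp add: sum.cartesian_product case_prod_beta)
    show "(\<Sum>\<kappa>\<in>Q. (cmod (b y \<kappa>))\<^sup>2) \<le> real d2 * (\<Sum>a<D1. \<Sum>b<D2. (cmod (s a b))\<^sup>2)" if "y \<in> Y" for y
      using fac_right_bound[OF kG[OF that], where ?D1.0 = D1 and s = s] unfolding Q_def b_def
      by (simp add: sum.cartesian_product case_prod_beta)
  qed (auto intro!: sum_nonneg mult_nonneg_nonneg)
qed

text \<open>The parties exchange roles by \<open>expectation_swap\<close>, so that the test now
  belongs to the factor indexed by \<open>y\<close>; the orthogonality used is still that of the
  rows \<open>sg x\<close>.\<close>

lemma expectation_bias_right:
  fixes sg :: "'x \<Rightarrow> 'y \<Rightarrow> complex" and p :: "'x \<Rightarrow> real" and q :: "'y \<Rightarrow> real"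
  assumes fX: "finite X" and N: "N \<ge> 0"
    and orth: "\<And>x x'. x \<in> X \<Longrightarrow> x' \<in> X \<Longrightarrow> (\<Sum>y\<in>Y. sg x y * cnj (sg x' y)) = (if x = x' then of_real N else 0)"
    and p: "(\<Sum>x\<in>X. (p x)\<^sup>2) \<le> A" and q: "(\<Sum>y\<in>Y. (q y)\<^sup>2) \<le> B"
    and kF: "\<And>x. x \<in> X \<Longrightarrow> kraus D1 d1 (I x) (F x)" and kG: "\<And>y. y \<in> Y \<Longrightarrow> kraus D2 d2 (J y) (G y)"
    and t: "\<And>y. y \<in> Y \<Longrightarrow> contraction2 d1 d2 (t y)"
  shows "cmod (\<Sum>x\<in>X. \<Sum>y\<in>Y. sg x y * of_real (p x * q y) * expectation d1 d2 D1 D2 (I x) (F x) (J y) (G y) s (t y))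
    \<le> sqrt (N * A * B) * (real d1 * (\<Sum>a<D1. \<Sum>b<D2. (cmod (s a b))\<^sup>2))"
proof -
  define Q where "Q = {..<d1} \<times> {..<d1} \<times> {..<D2} \<times> {..<D1}"
  define s' where "s' = (\<lambda>b a. s a b)"
  define t' where "t' = (\<lambda>y j' i' j i. t y i' j' i j)"
  define b where "b = (\<lambda>y (j, j', a, b). fac_left d2 D2 (J y) (G y) s' (t' y) j j' a b)"
  define a where "a = (\<lambda>x (j, j', a, b). fac_right D1 (I x) (F x) s' j j' a b)"
  have eq: "expectation d1 d2 D1 D2 (I x) (F x) (J y) (G y) s (t y) = (\<Sum>\<kappa>\<in>Q. a x \<kappa> * b y \<kappa>)" for x y
    unfolding Q_def a_def b_def s'_def t'_def
    by (subst expectation_swap, subst expectation_factor) (simp add: sum.cartesian_product case_prod_beta mult.commute)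
  have sum: "(\<Sum>a<D2. \<Sum>b<D1. (cmod (s' a b))\<^sup>2) = (\<Sum>a<D1. \<Sum>b<D2. (cmod (s a b))\<^sup>2)"
    unfolding s'_def by (rule sum.swap)
  show ?thesis unfolding eq
  proof (rule signed_product_bound[OF fX N orth p q])
    show "(\<Sum>\<kappa>\<in>Q. (cmod (b y \<kappa>))\<^sup>2) \<le> real d1 * (\<Sum>a<D1. \<Sum>b<D2. (cmod (s a b))\<^sup>2)" if "y \<in> Y" for y
      using fac_left_bound[OF kG[OF that] contraction2_swap[OF t[OF that]], where ?D2.0 = D1 and s = s'] unfolding Q_def b_def t'_def sum
      by (simp add: sum.cartesian_product case_prod_beta)
    show "(\<Sum>\<kappa>\<in>Q. (cmod (a x \<kappa>))\<^sup>2) \<le> real d1 * (\<Sum>a<D1. \<Sum>b<D2. (cmod (s a b))\<^sup>2)" if "x \<in> X" for x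
      using fac_right_bound[OF kF[OF that], where ?D1.0 = D2 and s = s'] unfolding Q_def a_def sum
      by (simp add: sum.cartesian_product case_prod_beta)
  qed (auto intro!: sum_nonneg mult_nonneg_nonneg)
qed

subsection \<open>Entangled storage\<close>

lemma sum_lessThan_mult:
  fixes f :: "nat \<Rightarrow> 'a::comm_monoid_add"
  shows "(\<Sum>k<n * q. f k) = (\<Sum>a<n. \<Sum>b<q. f (a * q + b))"
proof -
  have "(\<Sum>k<n * q. f k) = (\<Sum>a<n. sum f {a * q..<a * q + q})"
    by (simp add: sum.nat_group)
  also have "\<dots> = (\<Sum>a<n. \<Sum>b<q. f (a * q + b))"
  proof (rule sum.cong[OF refl])
    fix a :: nat
    show "sum f {a * q..<a * q + q} = (\<Sum>b<q. f (a * q + b))"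
      using sum.shift_bounds_nat_ivl[of f 0 "a * q" q] by (simp add: atLeast0LessThan add.commute)
  qed
  finally show ?thesis .
qed

lemma mult_add_less:
  fixes i j :: nat
  assumes "i < m" "j < n"
  shows "i * n + j < m * n"
proof -
  have "i * n + j < i * n + n" using assms by simp
  also have "\<dots> = Suc i * n" by simp
  also have "\<dots> \<le> m * n" using assms by (intro mult_right_mono) auto
  finally show ?thesis .
qed

section \<open>Kronecker products, sums of matrices and Gram representations\<close>

lemma kron_dim [simp]:
  "dim_row (kron A B) = dim_row A * dim_row B" "dim_col (kron A B) = dim_col A * dim_col B"
  unfolding kron_def by auto

lemma kron_carrier:
  "A \<in> carrier_mat m n \<Longrightarrow> B \<in> carrier_mat p q \<Longrightarrow> kron A B \<in> carrier_mat (m * p) (n * q)"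
  by (intro carrier_matI) auto

lemma kron_index:
  assumes "A \<in> carrier_mat m n" "B \<in> carrier_mat p q" "i < m" "k < p" "j < n" "l < q"
  shows "kron A B $$ (i * p + k, j * q + l) = A $$ (i, j) * B $$ (k, l)"
proof -
  have "i * p + k < m * p" "j * q + l < n * q" using assms by (auto intro!: mult_add_less)
  then show ?thesis using assms unfolding kron_def by auto
qed

lemma matsum_dim [simp]: "dim_row (matsum n f S) = n" "dim_col (matsum n f S) = n"
  unfolding matsum_def by auto

lemma matsum_carrier [simp]: "matsum n f S \<in> carrier_mat n n"
  unfolding matsum_def by simp

lemma matsum_index [simp]: "i < n \<Longrightarrow> j < n \<Longrightarrow> matsum n f S $$ (i, j) = (\<Sum>s\<in>S. f s $$ (i, j))"
  unfolding matsum_def by simp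

text \<open>\<open>M\<close> is a sum of rank-one matrices on the vectors \<open>m \<nu>\<close>.
  Carrying these vectors through the operations keeps the two tensor factors visible, which the
  entries of the state alone do not.\<close>

definition gram :: "nat \<Rightarrow> 'i set \<Rightarrow> ('i \<Rightarrow> nat \<Rightarrow> complex) \<Rightarrow> complex mat \<Rightarrow> bool" where
  "gram n I m M \<longleftrightarrow> finite I \<and> M \<in> carrier_mat n n \<and>
     (\<forall>e<n. \<forall>e'<n. M $$ (e, e') = (\<Sum>\<nu>\<in>I. m \<nu> e * cnj (m \<nu> e')))"

lemma gram_hermitian: "gram n I m M \<Longrightarrow> hermitian n (\<lambda>i j. M $$ (i, j))"
  unfolding gram_def hermitian_def by (auto simp: mult.commute)

lemma gram_psd:
  assumes g: "gram n I m M"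
  shows "psd n M"
  unfolding psd_iff
proof (intro conjI allI)
  show "M \<in> carrier_mat n n" using g unfolding gram_def by blast
  show "hermitian n (\<lambda>i j. M $$ (i, j))" using g by (rule gram_hermitian)
  fix v :: "nat \<Rightarrow> complex"
  have "(\<Sum>i<n. (\<Sum>j<n. M $$ (i, j) * v j) * cnj (v i))
      = (\<Sum>i<n. \<Sum>j<n. \<Sum>\<nu>\<in>I. (cnj (m \<nu> j) * v j) * (m \<nu> i * cnj (v i)))"
    using g unfolding gram_def sum_distrib_right
    by (intro sum.cong refl) (auto simp: sum_distrib_right sum_distrib_left mult_ac)
  also have "\<dots> = (\<Sum>i<n. \<Sum>\<nu>\<in>I. \<Sum>j<n. (cnj (m \<nu> j) * v j) * (m \<nu> i * cnj (v i)))"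
    by (intro sum.cong refl sum.swap)
  also have "\<dots> = (\<Sum>\<nu>\<in>I. (\<Sum>j<n. cnj (m \<nu> j) * v j) * cnj (\<Sum>i<n. cnj (m \<nu> i) * v i))"
    by (subst sum.swap) (simp add: sum_distrib_left sum_distrib_right)
  also have "\<dots> = of_real (\<Sum>\<nu>\<in>I. (cmod (\<Sum>j<n. cnj (m \<nu> j) * v j))\<^sup>2)"
    by (simp only: of_real_sum complex_norm_square)
  also have "0 \<le> \<dots>" by (simp add: less_eq_complex_def sum_nonneg)
  finally show "0 \<le> (\<Sum>i<n. (\<Sum>j<n. M $$ (i, j) * v j) * cnj (v i))" .
qed

lemma tr_gram:
  assumes g: "gram n I m M"
  shows "tr M = of_real (\<Sum>\<nu>\<in>I. \<Sum>e<n. (cmod (m \<nu> e))\<^sup>2)"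
proof -
  have "tr M = (\<Sum>e<n. \<Sum>\<nu>\<in>I. m \<nu> e * cnj (m \<nu> e))"
    using g unfolding tr_def gram_def by (intro sum.cong) auto
  also have "\<dots> = (\<Sum>\<nu>\<in>I. \<Sum>e<n. m \<nu> e * cnj (m \<nu> e))" by (rule sum.swap)
  finally show ?thesis by (simp only: of_real_sum complex_norm_square)
qed

lemma sandwich_index:
  assumes "A \<in> carrier_mat n N" "M \<in> carrier_mat N N" "e < n" "e' < n"
  shows "(A * M * mat_adjoint A) $$ (e, e') = (\<Sum>c<N. \<Sum>c'<N. A $$ (e, c') * M $$ (c', c) * cnj (A $$ (e', c)))"
proof -
  have "(A * M * mat_adjoint A) $$ (e, e') = (\<Sum>c<N. (A * M) $$ (e, c) * mat_adjoint A $$ (c, e'))"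
    using assms by (intro mat_mult_index) (auto intro: mat_adjoint_carrier)
  also have "\<dots> = (\<Sum>c<N. (\<Sum>c'<N. A $$ (e, c') * M $$ (c', c)) * cnj (A $$ (e', c)))"
    using assms by (intro sum.cong refl arg_cong2[where f = times] mat_mult_index) auto
  finally show ?thesis by (simp add: sum_distrib_right)
qed

lemma gram_sandwich:
  assumes g: "gram N I m M" and A: "A \<in> carrier_mat n N"
  shows "gram n I (\<lambda>\<nu> e. \<Sum>c<N. A $$ (e, c) * m \<nu> c) (A * M * mat_adjoint A)"
  unfolding gram_def
proof (intro conjI allI impI)
  show "finite I" using g unfolding gram_def by blast
  have M: "M \<in> carrier_mat N N" using g unfolding gram_def by blast
  show "A * M * mat_adjoint A \<in> carrier_mat n n" using A M by (auto intro: mat_adjoint_carrier)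
  fix e e' assume e: "e < n" "e' < n"
  have "(A * M * mat_adjoint A) $$ (e, e')
      = (\<Sum>c<N. \<Sum>c'<N. \<Sum>\<nu>\<in>I. (A $$ (e, c') * m \<nu> c') * cnj (A $$ (e', c) * m \<nu> c))"
    unfolding sandwich_index[OF A M e] using g unfolding gram_def
    by (intro sum.cong refl) (auto simp: sum_distrib_right sum_distrib_left mult_ac)
  also have "\<dots> = (\<Sum>c<N. \<Sum>\<nu>\<in>I. \<Sum>c'<N. (A $$ (e, c') * m \<nu> c') * cnj (A $$ (e', c) * m \<nu> c))"
    by (intro sum.cong refl sum.swap)
  also have "\<dots> = (\<Sum>\<nu>\<in>I. (\<Sum>c<N. A $$ (e, c) * m \<nu> c) * cnj (\<Sum>c<N. A $$ (e', c) * m \<nu> c))"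
    by (subst sum.swap) (simp add: sum_distrib_left sum_distrib_right)
  finally show "(A * M * mat_adjoint A) $$ (e, e')
     = (\<Sum>\<nu>\<in>I. (\<Sum>c<N. A $$ (e, c) * m \<nu> c) * cnj (\<Sum>c<N. A $$ (e', c) * m \<nu> c))" .
qed

lemma gram_matsum:
  assumes "finite S" "\<And>s. s \<in> S \<Longrightarrow> gram n (I s) (m s) (f s)"
  shows "gram n (SIGMA s:S. I s) (\<lambda>(s, \<nu>). m s \<nu>) (matsum n f S)"
  unfolding gram_def
proof (intro conjI allI impI)
  show "finite (SIGMA s:S. I s)" using assms unfolding gram_def by blast
  fix e e' assume e: "e < n" "e' < n"
  have "matsum n f S $$ (e, e') = (\<Sum>s\<in>S. \<Sum>\<nu>\<in>I s. m s \<nu> e * cnj (m s \<nu> e'))"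
    using assms(2) e unfolding gram_def by simp
  also have "\<dots> = (\<Sum>(s, \<nu>)\<in>(SIGMA s:S. I s). m s \<nu> e * cnj (m s \<nu> e'))"
    using assms unfolding gram_def by (intro sum.Sigma) auto
  finally show "matsum n f S $$ (e, e') = (\<Sum>\<nu>\<in>(SIGMA s:S. I s).
      (case \<nu> of (s, \<nu>) \<Rightarrow> m s \<nu>) e * cnj ((case \<nu> of (s, \<nu>) \<Rightarrow> m s \<nu>) e'))"
    by (simp add: case_prod_beta)
qed simp

lemma gram_smult:
  assumes "gram n I m M" "c \<ge> 0"
  shows "gram n I (\<lambda>\<nu> e. of_real (sqrt c) * m \<nu> e) (of_real c \<cdot>\<^sub>m M)"
proof -
  have c: "complex_of_real c = complex_of_real (sqrt c) * complex_of_real (sqrt c)"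
    using assms(2) by (simp flip: of_real_mult)
  show ?thesis unfolding gram_def
  proof (intro conjI allI impI)
    show "finite I" "of_real c \<cdot>\<^sub>m M \<in> carrier_mat n n" using assms(1) unfolding gram_def by auto
    fix e e' assume "e < n" "e' < n"
    then have "(of_real c \<cdot>\<^sub>m M) $$ (e, e') = of_real c * (\<Sum>\<nu>\<in>I. m \<nu> e * cnj (m \<nu> e'))"
      using assms(1) unfolding gram_def by auto
    also have "\<dots> = (\<Sum>\<nu>\<in>I. of_real (sqrt c) * m \<nu> e * cnj (of_real (sqrt c) * m \<nu> e'))"
      unfolding sum_distrib_left by (intro sum.cong refl) (subst c, simp)
    finally show "(of_real c \<cdot>\<^sub>m M) $$ (e, e') = (\<Sum>\<nu>\<in>I. of_real (sqrt c) * m \<nu> e * cnj (of_real (sqrt c) * m \<nu> e'))" .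
  qed
qed

text \<open>The square roots of the eigenvalues are moved into the eigenvectors: a state becomes an
  ensemble of unnormalised vectors.\<close>

lemma psd_gramE:
  assumes "psd n M"
  obtains K s where "gram n {..<K::nat} s M"
proof -
  have M: "M \<in> carrier_mat n n" and h: "hermitian n (\<lambda>i j. M $$ (i, j))"
    and pos: "\<And>v. 0 \<le> (\<Sum>i<n. (\<Sum>j<n. M $$ (i, j) * v j) * cnj (v i))"
    using assms[unfolded psd_iff] by blast+
  obtain K l u where o: "orthonormal n K u" and Ml: "M = spec_mat n K l u"
    by (rule hermitian_spec_matE[OF M h])
  have lpos: "l k \<ge> 0" if k: "k < K" for k
  proof -
    have "(\<Sum>i<n. (\<Sum>j<n. M $$ (i, j) * u k j) * cnj (u k i)) = (\<Sum>i<n. of_real (l k) * u k i * cnj (u k i))"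
    proof (intro sum.cong refl arg_cong2[where f = times])
      fix i assume i: "i \<in> {..<n}"
      have "(\<Sum>j<n. M $$ (i, j) * u k j) = (\<Sum>k'<K. of_real (l k') * u k' i * (\<Sum>j<n. u k j * cnj (u k' j)))"
        unfolding Ml using i by (intro spec_mat_apply) auto
      also have "\<dots> = (\<Sum>k'<K. of_real (l k') * u k' i * (if k = k' then 1 else 0))"
        using o k unfolding orthonormal_def by (intro sum.cong) auto
      finally show "(\<Sum>j<n. M $$ (i, j) * u k j) = of_real (l k) * u k i" using k by (simp add: sum_if_delta)
    qed
    also have "\<dots> = of_real (l k) * (\<Sum>i<n. u k i * cnj (u k i))" by (simp add: sum_distrib_left mult.assoc)
    also have "\<dots> = of_real (l k)" using o k unfolding orthonormal_def by simp
    finally have "0 \<le> complex_of_real (l k)" using pos[of "u k"] by simp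
    then show ?thesis by (simp add: less_eq_complex_def)
  qed
  have "gram n {..<K} (\<lambda>k e. of_real (sqrt (l k)) * u k e) M"
    unfolding gram_def
  proof (intro conjI allI impI M)
    fix e e' assume "e < n" "e' < n"
    then have "M $$ (e, e') = (\<Sum>k<K. of_real (l k) * u k e * cnj (u k e'))"
      unfolding Ml by (rule spec_mat_index)
    also have "\<dots> = (\<Sum>k<K. of_real (sqrt (l k)) * u k e * cnj (of_real (sqrt (l k)) * u k e'))"
    proof (intro sum.cong refl)
      fix k assume "k \<in> {..<K}"
      then have "complex_of_real (l k) = of_real (sqrt (l k)) * of_real (sqrt (l k))"
        using lpos by (simp flip: of_real_mult)
      then show "of_real (l k) * u k e * cnj (u k e')
        = of_real (sqrt (l k)) * u k e * cnj (of_real (sqrt (l k)) * u k e')" by simp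
    qed
    finally show "M $$ (e, e') = (\<Sum>k<K. of_real (sqrt (l k)) * u k e * cnj (of_real (sqrt (l k)) * u k e'))" .
  qed simp
  then show thesis by (rule that)
qed

text \<open>Discarding a factor of dimension \<open>R\<close> turns its basis states
  \<open>c\<close> into further Kraus indices. Every row is \<open>i * R + c\<close> for exactly one
  pair, so completeness is preserved.\<close>

lemma quantum_op_kraus:
  assumes q: "quantum_op (d * R) r K"
  shows "kraus (d * R) d ({..<r} \<times> {..<R}) (\<lambda>(\<kappa>, c) i a. K \<kappa> $$ (i * R + c, a))"
  unfolding kraus_def
proof (intro conjI allI)
  let ?D = "d * R"
  fix v :: "nat \<Rightarrow> complex"
  have K: "K \<kappa> \<in> carrier_mat ?D ?D" if "\<kappa> < r" for \<kappa> using q that unfolding quantum_op_def by blast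
  have one: "(\<Sum>\<kappa><r. \<Sum>c<?D. cnj (K \<kappa> $$ (c, a)) * K \<kappa> $$ (c, a')) = (if a = a' then 1 else 0)"
    if a: "a < ?D" "a' < ?D" for a a'
  proof -
    have "(\<Sum>\<kappa><r. \<Sum>c<?D. cnj (K \<kappa> $$ (c, a)) * K \<kappa> $$ (c, a'))
        = (\<Sum>\<kappa><r. (mat_adjoint (K \<kappa>) * K \<kappa>) $$ (a, a'))"
    proof (intro sum.cong refl)
      fix \<kappa> assume "\<kappa> \<in> {..<r}"
      then have k: "K \<kappa> \<in> carrier_mat ?D ?D" using K by simp
      have "(mat_adjoint (K \<kappa>) * K \<kappa>) $$ (a, a') = (\<Sum>c<?D. mat_adjoint (K \<kappa>) $$ (a, c) * K \<kappa> $$ (c, a'))"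
        by (rule mat_mult_index[OF mat_adjoint_carrier[OF k] k a])
      also have "\<dots> = (\<Sum>c<?D. cnj (K \<kappa> $$ (c, a)) * K \<kappa> $$ (c, a'))"
        using k a by (intro sum.cong) auto
      finally show "(\<Sum>c<?D. cnj (K \<kappa> $$ (c, a)) * K \<kappa> $$ (c, a')) = (mat_adjoint (K \<kappa>) * K \<kappa>) $$ (a, a')" ..
    qed
    also have "\<dots> = matsum ?D (\<lambda>i. mat_adjoint (K i) * K i) {..<r} $$ (a, a')"
      using a by (rule matsum_index[symmetric])
    also have "\<dots> = (1\<^sub>m ?D) $$ (a, a')" using q unfolding quantum_op_def by simp
    finally show ?thesis using a by simp
  qed
  define w where "w = (\<lambda>\<kappa> c. \<Sum>a<?D. K \<kappa> $$ (c, a) * v a)"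
  have "complex_of_real (\<Sum>\<kappa><r. \<Sum>c<?D. (cmod (w \<kappa> c))\<^sup>2)
      = (\<Sum>\<kappa><r. \<Sum>c<?D. \<Sum>a<?D. \<Sum>a'<?D. (v a * cnj (v a')) * (cnj (K \<kappa> $$ (c, a')) * K \<kappa> $$ (c, a)))"
    unfolding of_real_sum complex_norm_square w_def
    by (intro sum.cong refl) (simp add: sum_product mult_ac)
  also have "\<dots> = (\<Sum>a<?D. \<Sum>a'<?D. \<Sum>\<kappa><r. \<Sum>c<?D. (v a * cnj (v a')) * (cnj (K \<kappa> $$ (c, a')) * K \<kappa> $$ (c, a)))"
    unfolding sum.cartesian_product
    by (rule sum.reindex_bij_witness[where i = "\<lambda>(a, a', \<kappa>, c). (\<kappa>, c, a, a')" and j = "\<lambda>(\<kappa>, c, a, a'). (a, a', \<kappa>, c)"]) auto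
  also have "\<dots> = (\<Sum>a<?D. \<Sum>a'<?D. (v a * cnj (v a')) * (if a' = a then 1 else 0))"
  proof (intro sum.cong refl)
    fix a a' assume "a \<in> {..<?D}" "a' \<in> {..<?D}"
    then have "(\<Sum>\<kappa><r. \<Sum>c<?D. cnj (K \<kappa> $$ (c, a')) * K \<kappa> $$ (c, a)) = (if a' = a then 1 else 0)"
      by (intro one) auto
    then show "(\<Sum>\<kappa><r. \<Sum>c<?D. (v a * cnj (v a')) * (cnj (K \<kappa> $$ (c, a')) * K \<kappa> $$ (c, a)))
        = (v a * cnj (v a')) * (if a' = a then 1 else 0)"
      by (simp only: sum_distrib_left[symmetric])
  qed
  also have "\<dots> = (\<Sum>a<?D. v a * cnj (v a))"
    by (intro sum.cong refl sum_if_delta) auto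
  also have "\<dots> = of_real (\<Sum>a<?D. (cmod (v a))\<^sup>2)" by (simp only: of_real_sum complex_norm_square)
  finally have "(\<Sum>\<kappa><r. \<Sum>c<?D. (cmod (w \<kappa> c))\<^sup>2) = (\<Sum>a<?D. (cmod (v a))\<^sup>2)" by (simp only: of_real_eq_iff)
  then have *: "(\<Sum>\<kappa><r. \<Sum>i<d. \<Sum>c<R. (cmod (w \<kappa> (i * R + c)))\<^sup>2) = (\<Sum>a<?D. (cmod (v a))\<^sup>2)"
    unfolding sum_lessThan_mult .
  have "(\<Sum>\<alpha>\<in>{..<r} \<times> {..<R}. \<Sum>i<d. (cmod (\<Sum>a<?D. (case \<alpha> of (\<kappa>, c) \<Rightarrow> \<lambda>i a. K \<kappa> $$ (i * R + c, a)) i a * v a))\<^sup>2)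
     = (\<Sum>(\<kappa>, c)\<in>{..<r} \<times> {..<R}. \<Sum>i<d. (cmod (w \<kappa> (i * R + c)))\<^sup>2)"
    unfolding w_def by (intro sum.cong) auto
  also have "\<dots> = (\<Sum>\<kappa><r. \<Sum>c<R. \<Sum>i<d. (cmod (w \<kappa> (i * R + c)))\<^sup>2)"
    by (rule sum.cartesian_product[symmetric])
  also have "\<dots> = (\<Sum>\<kappa><r. \<Sum>i<d. \<Sum>c<R. (cmod (w \<kappa> (i * R + c)))\<^sup>2)"
    by (intro sum.cong refl sum.swap)
  finally show "(\<Sum>\<alpha>\<in>{..<r} \<times> {..<R}. \<Sum>i<d. (cmod (\<Sum>a<?D. (case \<alpha> of (\<kappa>, c) \<Rightarrow> \<lambda>i a. K \<kappa> $$ (i * R + c, a)) i a * v a))\<^sup>2)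
     = (\<Sum>a<?D. (cmod (v a))\<^sup>2)"
    unfolding * .
qed simp

section \<open>Kept and discarded qubits\<close>

lemma kron_one_bra_index:
  assumes "i < d" "r < R" "c < d * R"
  shows "kron (1\<^sub>m d) (bra R r) $$ (i, c) = (if c = i * R + r then 1 else 0)"
proof -
  have R: "R > 0" using assms by simp
  have c: "c div R < d" "c mod R < R" using assms by (auto simp: less_mult_imp_div_less R)
  \<comment> \<open>\<open>bra\<close> has a single row, so the row index \<open>i\<close> is
    written as \<open>i * 1 + 0\<close> to fit \<open>kron_index\<close>.\<close>
  have "kron (1\<^sub>m d) (bra R r) $$ (i * 1 + 0, (c div R) * R + c mod R) = (1\<^sub>m d) $$ (i, c div R) * bra R r $$ (0, c mod R)"
    by (rule kron_index[where m = d and n = d and p = 1 and q = R]) (use assms c in \<open>auto simp: bra_def\<close>)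
  moreover have "c = i * R + r \<longleftrightarrow> c div R = i \<and> c mod R = r" using assms R by auto
  ultimately show ?thesis using assms c by (auto simp: bra_def)
qed

text \<open>The matrices in the partial trace are selectors: row \<open>(i, j)\<close> has a single
  1, at the column whose digits are the kept \<open>i\<close>, \<open>j\<close> and the discarded
  \<open>r\<close>, \<open>s\<close>.\<close>

lemma discard_selector_index:
  assumes i: "i < d1" "j < d2" and r: "r < R" "s < S" and c: "c < (d1 * R) * (d2 * S)"
  shows "kron (kron (1\<^sub>m d1) (bra R r)) (kron (1\<^sub>m d2) (bra S s)) $$ (i * d2 + j, c)
    = (if c = (i * R + r) * (d2 * S) + (j * S + s) then 1 else 0)"
proof -
  let ?D1 = "d1 * R" and ?D2 = "d2 * S"
  have D2: "?D2 > 0" using i r by simp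
  have cc: "c div ?D2 < ?D1" "c mod ?D2 < ?D2" using c D2 by (auto simp: less_mult_imp_div_less)
  have js: "j * S + s < ?D2" using i r by (intro mult_add_less)
  have "kron (kron (1\<^sub>m d1) (bra R r)) (kron (1\<^sub>m d2) (bra S s)) $$ (i * d2 + j, (c div ?D2) * ?D2 + c mod ?D2)
      = kron (1\<^sub>m d1) (bra R r) $$ (i, c div ?D2) * kron (1\<^sub>m d2) (bra S s) $$ (j, c mod ?D2)"
    by (rule kron_index[where m = d1 and n = ?D1]) (use i cc in \<open>auto simp: bra_def\<close>)
  also have "\<dots> = (if c div ?D2 = i * R + r then 1 else 0) * (if c mod ?D2 = j * S + s then 1 else 0)"
    using i r cc by (simp only: kron_one_bra_index)
  finally have 1: "kron (kron (1\<^sub>m d1) (bra R r)) (kron (1\<^sub>m d2) (bra S s)) $$ (i * d2 + j, c)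
      = (if c div ?D2 = i * R + r then 1 else 0) * (if c mod ?D2 = j * S + s then 1 else 0)"
    unfolding div_mult_mod_eq .
  have "c = (i * R + r) * ?D2 + (j * S + s) \<longleftrightarrow> c div ?D2 = i * R + r \<and> c mod ?D2 = j * S + s"
    using js D2 by (metis add.commute div_mod_decomp div_mult_self3 div_less mod_less mod_mult_self3 less_not_refl2 add.left_neutral)
  then show ?thesis unfolding 1 by simp
qed

text \<open>The vectors of the Gram representation pass through the product Kraus operators and then
  through the selectors. Pairing each party's Kraus index with its discarded basis state gives them
  the form \<open>evolve\<close>, with one family for each party.\<close>

lemma storage_gram:
  assumes \<sigma>: "gram (d1 * R * (d2 * S)) {..<N::nat} v \<sigma>" and d: "d1 * R = 2 ^ a1" "d2 * S = 2 ^ a2"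
    and dd: "d1 = 2 ^ b1" "d2 = 2 ^ b2" "R = 2 ^ (a1 - b1)" "S = 2 ^ (a2 - b2)"
    and K: "\<And>\<kappa>. \<kappa> < r \<Longrightarrow> K \<kappa> \<in> carrier_mat (d1 * R) (d1 * R)" and L: "\<And>\<kappa>. \<kappa> < l \<Longrightarrow> L \<kappa> \<in> carrier_mat (d2 * S) (d2 * S)"
    and i: "i < d1" "i' < d1" and j: "j < d2" "j' < d2"
  defines "F \<equiv> \<lambda>(\<kappa>, c) i a. K \<kappa> $$ (i * R + c, a)" and "G \<equiv> \<lambda>(\<kappa>, c) j b. L \<kappa> $$ (j * S + c, b)"
  defines "s \<equiv> \<lambda>k a b. v k (a * (d2 * S) + b)"
  shows "discard a1 b1 a2 b2 (apply_local (a1 + a2) r K l L \<sigma>) $$ (i * d2 + j, i' * d2 + j')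
    = (\<Sum>\<alpha>\<in>{..<r} \<times> {..<R}. \<Sum>\<beta>\<in>{..<l} \<times> {..<S}. \<Sum>k<N.
         evolve (d1 * R) (d2 * S) (F \<alpha>) (G \<beta>) (s k) i j * cnj (evolve (d1 * R) (d2 * S) (F \<alpha>) (G \<beta>) (s k) i' j'))"
proof -
  let ?D1 = "d1 * R" and ?D2 = "d2 * S"
  let ?D = "?D1 * ?D2"
  have D: "2 ^ (a1 + a2) = ?D" unfolding d by (simp add: power_add)
  have dq: "2 ^ (b1 + b2) = d1 * d2" unfolding dd by (simp add: power_add)
  define kv where "kv = (\<lambda>((\<kappa>, \<mu>), k) e. \<Sum>c<?D. kron (K \<kappa>) (L \<mu>) $$ (e, c) * v k c)"
  have g1: "gram ?D (SIGMA s:{..<r} \<times> {..<l}. {..<N}) (\<lambda>(s, \<nu>). kv (s, \<nu>)) (apply_local (a1 + a2) r K l L \<sigma>)"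
    unfolding apply_local_def D
  proof (rule gram_matsum)
    fix z assume z: "z \<in> {..<r} \<times> {..<l}"
    then have "kron (K (fst z)) (L (snd z)) \<in> carrier_mat ?D ?D" using K L by (auto intro!: kron_carrier)
    from gram_sandwich[OF \<sigma> this]
    show "gram ?D {..<N} (\<lambda>\<nu>. kv (z, \<nu>)) (case z of (i, j) \<Rightarrow> kron (K i) (L j) * \<sigma> * mat_adjoint (kron (K i) (L j)))"
      unfolding kv_def by (simp add: case_prod_beta)
  qed simp
  define Tm where "Tm = (\<lambda>c c'. kron (kron (1\<^sub>m d1) (bra R c)) (kron (1\<^sub>m d2) (bra S c')))"
  define M where "M = apply_local (a1 + a2) r K l L \<sigma>"
  define I where "I = ({..<r} \<times> {..<l}) \<times> {..<N}"
  have g1': "gram ?D I kv M" using g1 unfolding I_def M_def by simp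
  have Tm: "Tm c c' \<in> carrier_mat (d1 * d2) ?D" for c c'
    using kron_carrier[OF kron_carrier[OF one_carrier_mat, of "bra R c" 1 R d1] kron_carrier[OF one_carrier_mat, of "bra S c'" 1 S d2]]
    unfolding Tm_def by (simp add: bra_def)
  define gv where "gv = (\<lambda>(c, c') \<nu> e. \<Sum>x<?D. Tm c c' $$ (e, x) * kv \<nu> x)"
  have "discard a1 b1 a2 b2 M = matsum (d1 * d2) (\<lambda>z. Tm (fst z) (snd z) * M * mat_adjoint (Tm (fst z) (snd z))) ({..<R} \<times> {..<S})"
    unfolding discard_def Tm_def Let_def dq dd[symmetric]
    by (rule arg_cong2[where f = "matsum (d1 * d2)"]) (auto simp: fun_eq_iff)
  also have "gram (d1 * d2) (SIGMA s:{..<R} \<times> {..<S}. I) (\<lambda>(s, \<nu>). gv s \<nu>) \<dots>"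
  proof (rule gram_matsum)
    fix z
    show "gram (d1 * d2) I (gv z) (Tm (fst z) (snd z) * M * mat_adjoint (Tm (fst z) (snd z)))"
      using gram_sandwich[OF g1' Tm[of "fst z" "snd z"]] unfolding gv_def by (simp add: case_prod_beta)
  qed simp
  finally have g2: "gram (d1 * d2) (({..<R} \<times> {..<S}) \<times> I) (\<lambda>(s, \<nu>). gv s \<nu>) (discard a1 b1 a2 b2 M)" .
  have gv: "gv (c, c') ((\<kappa>, \<mu>), k) (i * d2 + j) = evolve ?D1 ?D2 (F (\<kappa>, c)) (G (\<mu>, c')) (s k) i j"
    if ij: "i < d1" "j < d2" and c: "c < R" "c' < S" and km: "\<kappa> < r" "\<mu> < l" for i j c c' \<kappa> \<mu> k
  proof -
    let ?x1 = "i * R + c" and ?x2 = "j * S + c'"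
    have x: "?x1 < ?D1" "?x2 < ?D2" using ij c by (auto intro!: mult_add_less)
    have "gv (c, c') ((\<kappa>, \<mu>), k) (i * d2 + j)
        = (\<Sum>x<?D. (if x = ?x1 * ?D2 + ?x2 then 1 else 0) * kv ((\<kappa>, \<mu>), k) x)"
      unfolding gv_def Tm_def prod.case
      by (intro sum.cong refl arg_cong2[where f = times] discard_selector_index) (use ij c in auto)
    also have "\<dots> = kv ((\<kappa>, \<mu>), k) (?x1 * ?D2 + ?x2)"
      by (rule sum_if_delta(3)[OF mult_add_less[OF x]])
    also have "\<dots> = (\<Sum>a<?D1. \<Sum>b<?D2. kron (K \<kappa>) (L \<mu>) $$ (?x1 * ?D2 + ?x2, a * ?D2 + b) * v k (a * ?D2 + b))"
      unfolding kv_def prod.case by (rule sum_lessThan_mult)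
    also have "\<dots> = (\<Sum>a<?D1. \<Sum>b<?D2. K \<kappa> $$ (?x1, a) * L \<mu> $$ (?x2, b) * s k a b)"
      using K[OF km(1)] L[OF km(2)] x unfolding s_def
      by (intro sum.cong refl arg_cong2[where f = times] kron_index) auto
    finally show ?thesis unfolding evolve_def F_def G_def by simp
  qed
  have e: "i * d2 + j < d1 * d2" "i' * d2 + j' < d1 * d2" using i j by (auto intro!: mult_add_less)
  have "discard a1 b1 a2 b2 M $$ (i * d2 + j, i' * d2 + j')
      = (\<Sum>((c, c'), (\<kappa>, \<mu>), k)\<in>({..<R} \<times> {..<S}) \<times> I.
           gv (c, c') ((\<kappa>, \<mu>), k) (i * d2 + j) * cnj (gv (c, c') ((\<kappa>, \<mu>), k) (i' * d2 + j')))"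
    using g2 e unfolding gram_def by (simp add: case_prod_beta)
  \<comment> \<open>The indices are regrouped by party instead of by operation.\<close>
  also have "\<dots> = (\<Sum>(\<alpha>, \<beta>, k)\<in>({..<r} \<times> {..<R}) \<times> ({..<l} \<times> {..<S}) \<times> {..<N}.
         evolve ?D1 ?D2 (F \<alpha>) (G \<beta>) (s k) i j * cnj (evolve ?D1 ?D2 (F \<alpha>) (G \<beta>) (s k) i' j'))"
    unfolding I_def
    by (rule sum.reindex_bij_witness[where i = "\<lambda>((\<kappa>, c), (\<mu>, c'), k). ((c, c'), (\<kappa>, \<mu>), k)"
          and j = "\<lambda>((c, c'), (\<kappa>, \<mu>), k). ((\<kappa>, c), (\<mu>, c'), k)"]) (use i j gv in auto)
  also have "\<dots> = (\<Sum>\<alpha>\<in>{..<r} \<times> {..<R}. \<Sum>\<beta>\<in>{..<l} \<times> {..<S}. \<Sum>k<N.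
         evolve ?D1 ?D2 (F \<alpha>) (G \<beta>) (s k) i j * cnj (evolve ?D1 ?D2 (F \<alpha>) (G \<beta>) (s k) i' j'))"
    by (simp add: sum.cartesian_product)
  finally show ?thesis unfolding M_def .
qed

text \<open>The form of the storage that the bias estimates use: an ensemble of \<open>N\<close>
  shared vectors of total squared length 1, reshaped to two indices, and for each party an isometric
  family from all of its qubits to the stored ones.\<close>

definition storage_model where
  "storage_model d1 d2 X \<rho> D1 D2 N s I F J G \<longleftrightarrow>
     (\<Sum>k<N. \<Sum>a<D1. \<Sum>b<D2. (cmod (s k a b))\<^sup>2) = 1 \<and>
     (\<forall>x\<in>X. kraus D1 d1 (I x) (F x)) \<and> (\<forall>y\<in>X. kraus D2 d2 (J y) (G y)) \<and>
     (\<forall>x\<in>X. \<forall>y\<in>X. \<rho> x y \<in> carrier_mat (d1 * d2) (d1 * d2) \<and>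
       (\<forall>i<d1. \<forall>j<d2. \<forall>i'<d1. \<forall>j'<d2. \<rho> x y $$ (i * d2 + j, i' * d2 + j') =
         (\<Sum>\<alpha>\<in>I x. \<Sum>\<beta>\<in>J y. \<Sum>k<N. evolve D1 D2 (F x \<alpha>) (G y \<beta>) (s k) i j
            * cnj (evolve D1 D2 (F x \<alpha>) (G y \<beta>) (s k) i' j'))))"
  for d1 d2 D1 D2 N :: nat and s :: "nat \<Rightarrow> nat \<Rightarrow> nat \<Rightarrow> complex" and I J :: "bits \<Rightarrow> (nat \<times> nat) set"

lemma storage_modelD:
  assumes "storage_model d1 d2 X \<rho> D1 D2 N s I F J G"
  shows "(\<Sum>k<N. \<Sum>a<D1. \<Sum>b<D2. (cmod (s k a b))\<^sup>2) = 1"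
    and "x \<in> X \<Longrightarrow> kraus D1 d1 (I x) (F x)" and "y \<in> X \<Longrightarrow> kraus D2 d2 (J y) (G y)"
  using assms unfolding storage_model_def by blast+

lemma entangled_storage_model:
  assumes "entangled_storage n b1 b2 \<rho>"
  shows "\<exists>D1 D2 N s I F J G. storage_model (2 ^ b1) (2 ^ b2) (bitstr n) \<rho> D1 D2 N s I F J G"
proof -
  from assms obtain a1 a2 \<sigma> r K l L where b: "b1 \<le> a1" "b2 \<le> a2" and \<sigma>: "density (2 ^ (a1 + a2)) \<sigma>"
    and K: "\<And>x. x \<in> bitstr n \<Longrightarrow> quantum_op (2 ^ a1) (r x) (K x)"
    and L: "\<And>y. y \<in> bitstr n \<Longrightarrow> quantum_op (2 ^ a2) (l y) (L y)"
    and \<rho>: "\<And>x y. x \<in> bitstr n \<Longrightarrow> y \<in> bitstr n \<Longrightarrow>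
        \<rho> x y = discard a1 b1 a2 b2 (apply_local (a1 + a2) (r x) (K x) (l y) (L y) \<sigma>)"
    unfolding entangled_storage_def by blast
  define d1 :: nat where "d1 = 2 ^ b1"
  define d2 :: nat where "d2 = 2 ^ b2"
  define R :: nat where "R = 2 ^ (a1 - b1)"
  define S :: nat where "S = 2 ^ (a2 - b2)"
  have d: "d1 * R = 2 ^ a1" "d2 * S = 2 ^ a2"
    unfolding d1_def d2_def R_def S_def using b by (simp_all flip: power_add)
  have D: "2 ^ (a1 + a2) = d1 * R * (d2 * S)" unfolding d by (simp add: power_add)
  obtain N v where g: "gram (d1 * R * (d2 * S)) {..<N::nat} v \<sigma>"
    using psd_gramE \<sigma> unfolding density_def D by metis
  define s where "s = (\<lambda>k a b. v k (a * (d2 * S) + b))"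
  have "complex_of_real (\<Sum>k<N. \<Sum>e<d1 * R * (d2 * S). (cmod (v k e))\<^sup>2) = 1"
    using tr_gram[OF g] \<sigma> unfolding density_def by simp
  then have s1: "(\<Sum>k<N. \<Sum>a<d1 * R. \<Sum>b<d2 * S. (cmod (s k a b))\<^sup>2) = 1"
    unfolding s_def sum_lessThan_mult[of _ "d1 * R"] by (simp only: of_real_eq_1_iff)
  have "storage_model d1 d2 (bitstr n) \<rho> (d1 * R) (d2 * S) N s
     (\<lambda>x. {..<r x} \<times> {..<R}) (\<lambda>x (\<kappa>, c) i a. K x \<kappa> $$ (i * R + c, a))
     (\<lambda>y. {..<l y} \<times> {..<S}) (\<lambda>y (\<kappa>, c) j b. L y \<kappa> $$ (j * S + c, b))"
    unfolding storage_model_def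
  proof (intro conjI ballI allI impI s1)
    fix x assume x: "x \<in> bitstr n"
    show "kraus (d1 * R) d1 ({..<r x} \<times> {..<R}) (\<lambda>(\<kappa>, c) i a. K x \<kappa> $$ (i * R + c, a))"
      using K[OF x] unfolding d[symmetric] by (rule quantum_op_kraus)
  next
    fix x assume x: "x \<in> bitstr n"
    show "kraus (d2 * S) d2 ({..<l x} \<times> {..<S}) (\<lambda>(\<kappa>, c) i a. L x \<kappa> $$ (i * S + c, a))"
      using L[OF x] unfolding d[symmetric] by (rule quantum_op_kraus)
  next
    fix x y assume x: "x \<in> bitstr n" and y: "y \<in> bitstr n"
    show "\<rho> x y \<in> carrier_mat (d1 * d2) (d1 * d2)"
      unfolding \<rho>[OF x y] discard_def d1_def d2_def by (simp add: power_add)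
    fix i j i' j' assume ij: "i < d1" "j < d2" "i' < d1" "j' < d2"
    show "\<rho> x y $$ (i * d2 + j, i' * d2 + j') =
       (\<Sum>\<alpha>\<in>{..<r x} \<times> {..<R}. \<Sum>\<beta>\<in>{..<l y} \<times> {..<S}. \<Sum>k<N.
          evolve (d1 * R) (d2 * S) ((\<lambda>(\<kappa>, c) i a. K x \<kappa> $$ (i * R + c, a)) \<alpha>)
            ((\<lambda>(\<kappa>, c) j b. L y \<kappa> $$ (j * S + c, b)) \<beta>) (s k) i j
          * cnj (evolve (d1 * R) (d2 * S) ((\<lambda>(\<kappa>, c) i a. K x \<kappa> $$ (i * R + c, a)) \<alpha>)
            ((\<lambda>(\<kappa>, c) j b. L y \<kappa> $$ (j * S + c, b)) \<beta>) (s k) i' j'))"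
      unfolding \<rho>[OF x y] s_def
      by (rule storage_gram[OF g d d1_def d2_def R_def S_def _ _ ij(1,3,2,4)])
        (use K[OF x] L[OF y] in \<open>auto simp: quantum_op_def d\<close>)
  qed
  then show ?thesis unfolding d1_def d2_def by blast
qed

lemma tr_storage:
  assumes sm: "storage_model d1 d2 X \<rho> D1 D2 N s I F J G" and x: "x \<in> X" and y: "y \<in> X"
    and T: "T \<in> carrier_mat (d1 * d2) (d1 * d2)"
  shows "tr (T * \<rho> x y) = (\<Sum>k<N. expectation d1 d2 D1 D2 (I x) (F x) (J y) (G y) (s k)
           (\<lambda>i' j' i j. T $$ (i' * d2 + j', i * d2 + j)))"
proof -
  define R where "R = (\<lambda>\<alpha> \<beta> k i j. evolve D1 D2 (F x \<alpha>) (G y \<beta>) (s k) i j)"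
  have \<rho>: "\<rho> x y \<in> carrier_mat (d1 * d2) (d1 * d2)"
    and ent: "\<And>i j i' j'. i < d1 \<Longrightarrow> j < d2 \<Longrightarrow> i' < d1 \<Longrightarrow> j' < d2 \<Longrightarrow> \<rho> x y $$ (i * d2 + j, i' * d2 + j') =
       (\<Sum>\<alpha>\<in>I x. \<Sum>\<beta>\<in>J y. \<Sum>k<N. R \<alpha> \<beta> k i j * cnj (R \<alpha> \<beta> k i' j'))"
    using sm x y unfolding storage_model_def R_def by blast+
  have "tr (T * \<rho> x y) = (\<Sum>i'<d1. \<Sum>j'<d2. \<Sum>i<d1. \<Sum>j<d2.
      T $$ (i' * d2 + j', i * d2 + j) * \<rho> x y $$ (i * d2 + j, i' * d2 + j'))"
    unfolding tr_mult[OF T \<rho>] sum_lessThan_mult ..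
  also have "\<dots> = (\<Sum>i'<d1. \<Sum>j'<d2. \<Sum>i<d1. \<Sum>j<d2. \<Sum>\<alpha>\<in>I x. \<Sum>\<beta>\<in>J y. \<Sum>k<N.
      T $$ (i' * d2 + j', i * d2 + j) * R \<alpha> \<beta> k i j * cnj (R \<alpha> \<beta> k i' j'))"
    by (intro sum.cong refl) (simp add: ent sum_distrib_left mult.assoc)
  also have "\<dots> = (\<Sum>k<N. \<Sum>\<alpha>\<in>I x. \<Sum>\<beta>\<in>J y. \<Sum>i<d1. \<Sum>j<d2. \<Sum>i'<d1. \<Sum>j'<d2.
      T $$ (i' * d2 + j', i * d2 + j) * R \<alpha> \<beta> k i j * cnj (R \<alpha> \<beta> k i' j'))"
    unfolding sum.cartesian_product
    by (rule sum.reindex_bij_witness[where i = "\<lambda>(k, \<alpha>, \<beta>, i, j, i', j'). (i', j', i, j, \<alpha>, \<beta>, k)"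
          and j = "\<lambda>(i', j', i, j, \<alpha>, \<beta>, k). (k, \<alpha>, \<beta>, i, j, i', j')"]) auto
  finally show ?thesis unfolding expectation_def R_def .
qed

lemma storage_gram_form:
  assumes sm: "storage_model d1 d2 X \<rho> D1 D2 N s I F J G" and x: "x \<in> X" and y: "y \<in> X"
  shows "gram (d1 * d2) (I x \<times> J y \<times> {..<N})
    (\<lambda>(\<alpha>, \<beta>, k) e. evolve D1 D2 (F x \<alpha>) (G y \<beta>) (s k) (e div d2) (e mod d2)) (\<rho> x y)"
  unfolding gram_def
proof (intro conjI allI impI)
  show "finite (I x \<times> J y \<times> {..<N})" "\<rho> x y \<in> carrier_mat (d1 * d2) (d1 * d2)"
    using sm x y unfolding storage_model_def kraus_def by auto
  fix e e' assume e: "e < d1 * d2" "e' < d1 * d2"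
  then have d2: "d2 > 0" by (cases d2) auto
  have "e div d2 < d1" "e mod d2 < d2" "e' div d2 < d1" "e' mod d2 < d2"
    using e d2 by (auto simp: less_mult_imp_div_less)
  then have "\<rho> x y $$ (e div d2 * d2 + e mod d2, e' div d2 * d2 + e' mod d2) =
       (\<Sum>\<alpha>\<in>I x. \<Sum>\<beta>\<in>J y. \<Sum>k<N. evolve D1 D2 (F x \<alpha>) (G y \<beta>) (s k) (e div d2) (e mod d2)
          * cnj (evolve D1 D2 (F x \<alpha>) (G y \<beta>) (s k) (e' div d2) (e' mod d2)))"
    using sm x y unfolding storage_model_def by blast
  then show "\<rho> x y $$ (e, e') = (\<Sum>\<nu>\<in>I x \<times> J y \<times> {..<N}.
      (case \<nu> of (\<alpha>, \<beta>, k) \<Rightarrow> \<lambda>e. evolve D1 D2 (F x \<alpha>) (G y \<beta>) (s k) (e div d2) (e mod d2)) e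
      * cnj ((case \<nu> of (\<alpha>, \<beta>, k) \<Rightarrow> \<lambda>e. evolve D1 D2 (F x \<alpha>) (G y \<beta>) (s k) (e div d2) (e mod d2)) e'))"
    by (simp add: sum.cartesian_product case_prod_beta)
qed

text \<open>Both families are isometric: first \<open>\<alpha>\<close> and \<open>i\<close> are
  summed out, then \<open>\<beta>\<close> and \<open>j\<close>, and the total squared length of the
  ensemble remains.\<close>

lemma storage_tr:
  assumes sm: "storage_model d1 d2 X \<rho> D1 D2 N s I F J G" and x: "x \<in> X" and y: "y \<in> X"
  shows "tr (\<rho> x y) = 1"
proof -
  define R where "R = (\<lambda>\<alpha> \<beta> k i j. evolve D1 D2 (F x \<alpha>) (G y \<beta>) (s k) i j)"
  define h where "h = (\<lambda>\<beta> k j a. \<Sum>b<D2. G y \<beta> j b * s k a b)"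
  have s1: "(\<Sum>k<N. \<Sum>a<D1. \<Sum>b<D2. (cmod (s k a b))\<^sup>2) = 1"
    and kF: "kraus D1 d1 (I x) (F x)" and kG: "kraus D2 d2 (J y) (G y)"
    using storage_modelD[OF sm] x y by blast+
  have R1: "R \<alpha> \<beta> k i j = (\<Sum>a<D1. F x \<alpha> i a * h \<beta> k j a)" for \<alpha> \<beta> k i j
    unfolding R_def evolve_def h_def by (simp add: sum_distrib_left mult.assoc)
  have "(\<Sum>\<nu>\<in>I x \<times> J y \<times> {..<N}. \<Sum>e<d1 * d2. (cmod ((case \<nu> of (\<alpha>, \<beta>, k) \<Rightarrow>
       \<lambda>e. evolve D1 D2 (F x \<alpha>) (G y \<beta>) (s k) (e div d2) (e mod d2)) e))\<^sup>2)
    = (\<Sum>(\<alpha>, \<beta>, k)\<in>I x \<times> J y \<times> {..<N}. \<Sum>i<d1. \<Sum>j<d2. (cmod (R \<alpha> \<beta> k i j))\<^sup>2)"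
    unfolding sum_lessThan_mult R_def by (intro sum.cong refl) auto
  also have "\<dots> = (\<Sum>\<alpha>\<in>I x. \<Sum>\<beta>\<in>J y. \<Sum>k<N. \<Sum>i<d1. \<Sum>j<d2. (cmod (R \<alpha> \<beta> k i j))\<^sup>2)"
    by (simp only: sum.cartesian_product[symmetric])
  also have "\<dots> = (\<Sum>k<N. \<Sum>\<beta>\<in>J y. \<Sum>j<d2. \<Sum>\<alpha>\<in>I x. \<Sum>i<d1. (cmod (R \<alpha> \<beta> k i j))\<^sup>2)"
    unfolding sum.cartesian_product
    by (rule sum.reindex_bij_witness[where i = "\<lambda>(k, \<beta>, j, \<alpha>, i). (\<alpha>, \<beta>, k, i, j)"
          and j = "\<lambda>(\<alpha>, \<beta>, k, i, j). (k, \<beta>, j, \<alpha>, i)"]) auto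
  also have "\<dots> = (\<Sum>k<N. \<Sum>\<beta>\<in>J y. \<Sum>j<d2. \<Sum>a<D1. (cmod (h \<beta> k j a))\<^sup>2)"
    unfolding R1 krausD[OF kF] ..
  also have "\<dots> = (\<Sum>k<N. \<Sum>a<D1. \<Sum>\<beta>\<in>J y. \<Sum>j<d2. (cmod (h \<beta> k j a))\<^sup>2)"
    unfolding sum.cartesian_product
    by (rule sum.reindex_bij_witness[where i = "\<lambda>(k, a, \<beta>, j). (k, \<beta>, j, a)"
          and j = "\<lambda>(k, \<beta>, j, a). (k, a, \<beta>, j)"]) auto
  also have "\<dots> = 1" unfolding h_def krausD[OF kG] by (rule s1)
  finally show ?thesis using tr_gram[OF storage_gram_form[OF sm x y]] by simp
qed

lemma contraction2_mat:
  assumes T: "contraction (d1 * d2) T"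
  shows "contraction2 d1 d2 (\<lambda>i' j' i j. T $$ (i' * d2 + j', i * d2 + j))"
  unfolding contraction2_def
proof
  fix v :: "nat \<Rightarrow> nat \<Rightarrow> complex"
  have "(\<Sum>j<d1 * d2. (cmod (\<Sum>i<d1 * d2. T $$ (i, j) * v (i div d2) (i mod d2)))\<^sup>2)
      \<le> (\<Sum>i<d1 * d2. (cmod (v (i div d2) (i mod d2)))\<^sup>2)"
    by (rule contraction_le[OF T])
  then show "(\<Sum>i<d1. \<Sum>j<d2. (cmod (\<Sum>i'<d1. \<Sum>j'<d2. T $$ (i' * d2 + j', i * d2 + j) * v i' j'))\<^sup>2)
     \<le> (\<Sum>i<d1. \<Sum>j<d2. (cmod (v i j))\<^sup>2)"
    unfolding sum_lessThan_mult by simp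
qed

text \<open>Min-entropy bounds the collision probability, and in this form the sources enter the
  bias.\<close>

lemma sum_source_sq_le:
  assumes "source n k p" "finite (bitstr n)"
  shows "(\<Sum>x\<in>bitstr n. (pmf p x)\<^sup>2) \<le> 2 powr (- k)"
proof -
  have "(\<Sum>x\<in>bitstr n. (pmf p x)\<^sup>2) \<le> (\<Sum>x\<in>bitstr n. 2 powr (- k) * pmf p x)"
    using assms(1) unfolding source_def power2_eq_square by (intro sum_mono mult_right_mono) auto
  also have "\<dots> = 2 powr (- k)"
    using assms unfolding source_def by (simp add: sum_distrib_left[symmetric] sum_pmf_eq_1)
  finally show ?thesis .
qed

text \<open>The estimates for the single vectors \<open>s k\<close> are added up; their squared
  lengths sum to 1.\<close>

lemma storage_bias:
  fixes sg :: "bits \<Rightarrow> bits \<Rightarrow> complex"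
  assumes sm: "storage_model d1 d2 X \<rho> D1 D2 N s I F J G" and fX: "finite X" and M: "M \<ge> 0"
    and orth: "\<And>x x'. x \<in> X \<Longrightarrow> x' \<in> X \<Longrightarrow> (\<Sum>y\<in>X. sg x y * cnj (sg x' y)) = (if x = x' then of_real M else 0)"
    and p: "(\<Sum>x\<in>X. (p x)\<^sup>2) \<le> A" and q: "(\<Sum>y\<in>X. (q y)\<^sup>2) \<le> B"
    and T: "\<And>x. x \<in> X \<Longrightarrow> contraction (d1 * d2) (T x)"
  shows "cmod (\<Sum>x\<in>X. \<Sum>y\<in>X. sg x y * of_real (p x * q y) * tr (T x * \<rho> x y)) \<le> sqrt (M * A * B) * real d2"
    and "cmod (\<Sum>x\<in>X. \<Sum>y\<in>X. sg x y * of_real (p x * q y) * tr (T y * \<rho> x y)) \<le> sqrt (M * A * B) * real d1"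
proof -
  define t where "t = (\<lambda>x i' j' i j. T x $$ (i' * d2 + j', i * d2 + j))"
  have s1: "(\<Sum>k<N. \<Sum>a<D1. \<Sum>b<D2. (cmod (s k a b))\<^sup>2) = 1"
    and kF: "\<And>x. x \<in> X \<Longrightarrow> kraus D1 d1 (I x) (F x)" and kG: "\<And>y. y \<in> X \<Longrightarrow> kraus D2 d2 (J y) (G y)"
    using storage_modelD[OF sm] by blast+
  have t: "contraction2 d1 d2 (t x)" if "x \<in> X" for x unfolding t_def by (rule contraction2_mat[OF T[OF that]])
  have Tc: "T x \<in> carrier_mat (d1 * d2) (d1 * d2)" if "x \<in> X" for x using T[OF that] by (rule contraction_carrier)
  have dist: "(\<Sum>k<N. c * (e * g k)) = c * (e * (\<Sum>k<N. g k))" for c e :: real and g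
    by (simp add: sum_distrib_left)
  have b_left: "cmod (\<Sum>x\<in>X. \<Sum>y\<in>X. sg x y * of_real (p x * q y) * expectation d1 d2 D1 D2 (I x) (F x) (J y) (G y) (s k) (t x))
      \<le> sqrt (M * A * B) * (real d2 * (\<Sum>a<D1. \<Sum>b<D2. (cmod (s k a b))\<^sup>2))" for k
    by (rule expectation_bias_left[where sg = sg and p = p and q = q and N = M and A = A and B = B])
      (rule fX M orth p q kF kG t; assumption)+
  have b_right: "cmod (\<Sum>x\<in>X. \<Sum>y\<in>X. sg x y * of_real (p x * q y) * expectation d1 d2 D1 D2 (I x) (F x) (J y) (G y) (s k) (t y))
      \<le> sqrt (M * A * B) * (real d1 * (\<Sum>a<D1. \<Sum>b<D2. (cmod (s k a b))\<^sup>2))" for k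
    by (rule expectation_bias_right[where sg = sg and p = p and q = q and N = M and A = A and B = B])
      (rule fX M orth p q kF kG t; assumption)+
  have "(\<Sum>x\<in>X. \<Sum>y\<in>X. sg x y * of_real (p x * q y) * tr (T x * \<rho> x y))
      = (\<Sum>x\<in>X. \<Sum>y\<in>X. \<Sum>k<N. sg x y * of_real (p x * q y) * expectation d1 d2 D1 D2 (I x) (F x) (J y) (G y) (s k) (t x))"
  proof (intro sum.cong[OF refl])
    fix x y assume x: "x \<in> X" and y: "y \<in> X"
    show "sg x y * of_real (p x * q y) * tr (T x * \<rho> x y)
        = (\<Sum>k<N. sg x y * of_real (p x * q y) * expectation d1 d2 D1 D2 (I x) (F x) (J y) (G y) (s k) (t x))"
      unfolding tr_storage[OF sm x y Tc[OF x]] t_def by (rule sum_distrib_left)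
  qed
  also have "\<dots> = (\<Sum>k<N. \<Sum>x\<in>X. \<Sum>y\<in>X. sg x y * of_real (p x * q y) * expectation d1 d2 D1 D2 (I x) (F x) (J y) (G y) (s k) (t x))"
    unfolding sum.cartesian_product
    by (rule sum.reindex_bij_witness[where i = "\<lambda>(k, x, y). (x, y, k)" and j = "\<lambda>(x, y, k). (k, x, y)"]) auto
  finally have e_left: "(\<Sum>x\<in>X. \<Sum>y\<in>X. sg x y * of_real (p x * q y) * tr (T x * \<rho> x y))
      = (\<Sum>k<N. \<Sum>x\<in>X. \<Sum>y\<in>X. sg x y * of_real (p x * q y) * expectation d1 d2 D1 D2 (I x) (F x) (J y) (G y) (s k) (t x))" .
  have "cmod (\<Sum>x\<in>X. \<Sum>y\<in>X. sg x y * of_real (p x * q y) * tr (T x * \<rho> x y))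
      \<le> (\<Sum>k<N. sqrt (M * A * B) * (real d2 * (\<Sum>a<D1. \<Sum>b<D2. (cmod (s k a b))\<^sup>2)))"
    unfolding e_left by (rule order.trans[OF norm_sum sum_mono]) (rule b_left)
  also have "\<dots> = sqrt (M * A * B) * (real d2 * (\<Sum>k<N. \<Sum>a<D1. \<Sum>b<D2. (cmod (s k a b))\<^sup>2))"
    by (rule dist)
  finally show "cmod (\<Sum>x\<in>X. \<Sum>y\<in>X. sg x y * of_real (p x * q y) * tr (T x * \<rho> x y)) \<le> sqrt (M * A * B) * real d2"
    by (simp only: s1 mult_1_right)
  have "(\<Sum>x\<in>X. \<Sum>y\<in>X. sg x y * of_real (p x * q y) * tr (T y * \<rho> x y))
      = (\<Sum>x\<in>X. \<Sum>y\<in>X. \<Sum>k<N. sg x y * of_real (p x * q y) * expectation d1 d2 D1 D2 (I x) (F x) (J y) (G y) (s k) (t y))"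
  proof (intro sum.cong[OF refl])
    fix x y assume x: "x \<in> X" and y: "y \<in> X"
    show "sg x y * of_real (p x * q y) * tr (T y * \<rho> x y)
        = (\<Sum>k<N. sg x y * of_real (p x * q y) * expectation d1 d2 D1 D2 (I x) (F x) (J y) (G y) (s k) (t y))"
      unfolding tr_storage[OF sm x y Tc[OF y]] t_def by (rule sum_distrib_left)
  qed
  also have "\<dots> = (\<Sum>k<N. \<Sum>x\<in>X. \<Sum>y\<in>X. sg x y * of_real (p x * q y) * expectation d1 d2 D1 D2 (I x) (F x) (J y) (G y) (s k) (t y))"
    unfolding sum.cartesian_product
    by (rule sum.reindex_bij_witness[where i = "\<lambda>(k, x, y). (x, y, k)" and j = "\<lambda>(x, y, k). (k, x, y)"]) auto
  finally have e_right: "(\<Sum>x\<in>X. \<Sum>y\<in>X. sg x y * of_real (p x * q y) * tr (T y * \<rho> x y))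
      = (\<Sum>k<N. \<Sum>x\<in>X. \<Sum>y\<in>X. sg x y * of_real (p x * q y) * expectation d1 d2 D1 D2 (I x) (F x) (J y) (G y) (s k) (t y))" .
  have "cmod (\<Sum>x\<in>X. \<Sum>y\<in>X. sg x y * of_real (p x * q y) * tr (T y * \<rho> x y))
      \<le> (\<Sum>k<N. sqrt (M * A * B) * (real d1 * (\<Sum>a<D1. \<Sum>b<D2. (cmod (s k a b))\<^sup>2)))"
    unfolding e_right by (rule order.trans[OF norm_sum sum_mono]) (rule b_right)
  also have "\<dots> = sqrt (M * A * B) * (real d1 * (\<Sum>k<N. \<Sum>a<D1. \<Sum>b<D2. (cmod (s k a b))\<^sup>2))"
    by (rule dist)
  finally show "cmod (\<Sum>x\<in>X. \<Sum>y\<in>X. sg x y * of_real (p x * q y) * tr (T y * \<rho> x y)) \<le> sqrt (M * A * B) * real d1"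
    by (simp only: s1 mult_1_right)
qed

subsection \<open>From parities to extractors\<close>

lemma bit_UNIV: "(UNIV :: bit set) = {0, 1}"
  by (auto intro: bit.exhaust)

lemma finite_bitstr [simp]: "finite (bitstr n)" and card_bitstr: "card (bitstr n) = 2 ^ n"
proof -
  have *: "bitstr n = {xs. set xs \<subseteq> (UNIV :: bit set) \<and> length xs = n}" unfolding bitstr_def by auto
  have "finite (UNIV :: bit set)" "card (UNIV :: bit set) = 2" unfolding bit_UNIV by auto
  then show "finite (bitstr n)" "card (bitstr n) = 2 ^ n"
    using finite_lists_length_eq[of "UNIV :: bit set" n] card_lists_length_eq[of "UNIV :: bit set" n]
    unfolding * by simp_all
qed

lemma bits_val_snoc: "bits_val (w @ [a]) = 2 * bits_val w + (if a = 1 then 1 else 0)"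
  unfolding bits_val_def by simp

lemma bits_val_less: "bits_val w < 2 ^ length w"
  by (induction w rule: rev_induct) (auto simp: bits_val_snoc, simp add: bits_val_def)

lemma bits_val_inj:
  "length w = length w' \<Longrightarrow> bits_val w = bits_val w' \<Longrightarrow> w = w'"
proof (induction w arbitrary: w' rule: rev_induct)
  case (snoc a w)
  then obtain a' v where w': "w' = v @ [a']" by (metis length_append_singleton length_0_conv nat.distinct(1) rev_exhaust)
  have e: "2 * bits_val w + (if a = 1 then 1 else 0) = 2 * bits_val v + (if a' = 1 then 1 else 0)"
    using snoc.prems(2) unfolding w' bits_val_snoc .
  have "(a = 1) = (a' = 1)"
    using arg_cong[OF e, of even] by (cases "a = 1"; cases "a' = 1") simp_all
  then have *: "bits_val w = bits_val v \<and> (a = 1 \<longleftrightarrow> a' = 1)"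
    using e by (auto split: if_splits)
  have "w = v" using * snoc.IH[of v] snoc.prems(1) w' by simp
  moreover have "a = a'" using * by (cases a; cases a') auto
  ultimately show ?case using w' by simp
qed simp

lemma bij_betw_bits_val: "bij_betw bits_val (bitstr m) {..<2 ^ m}"
proof -
  have inj: "inj_on bits_val (bitstr m)" unfolding bitstr_def inj_on_def using bits_val_inj by auto
  have "bits_val ` bitstr m \<subseteq> {..<2 ^ m}" using bits_val_less unfolding bitstr_def by auto
  then have "bits_val ` bitstr m = {..<2 ^ m}"
    using card_image[OF inj] by (intro card_subset_eq) (auto simp: card_bitstr)
  then show ?thesis using inj unfolding bij_betw_def by blast
qed

lemma sum_take_bitstr:
  fixes h :: "bits \<Rightarrow> complex"
  assumes "m \<le> m'"
  shows "(\<Sum>z\<in>bitstr m'. h (take m z)) = 2 ^ (m' - m) * (\<Sum>z\<in>bitstr m. h z)"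
proof -
  have "(\<Sum>z\<in>bitstr m'. h (take m z)) = (\<Sum>(u, v)\<in>bitstr m \<times> bitstr (m' - m). h u)"
    by (rule sum.reindex_bij_witness[where i = "\<lambda>(u, v). u @ v" and j = "\<lambda>z. (take m z, drop m z)"])
      (use assms in \<open>auto simp: bitstr_def\<close>)
  also have "\<dots> = (\<Sum>u\<in>bitstr m. \<Sum>v\<in>bitstr (m' - m). h u)" by (rule sum.cartesian_product[symmetric])
  finally show ?thesis by (simp add: card_bitstr sum_distrib_left)
qed

section \<open>Characters of bit strings and the XOR lemma\<close>

definition sgnb :: "bit \<Rightarrow> complex" where
  "sgnb a = (if a = 1 then - 1 else 1)"

lemma sgnb_add: "sgnb (a + b) = sgnb a * sgnb b"
  unfolding sgnb_def by (cases a; cases b) auto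

lemma sgnb_simps [simp]: "sgnb 0 = 1" "cnj (sgnb a) = sgnb a" "sgnb a * sgnb a = 1" "cmod (sgnb a) = 1"
  unfolding sgnb_def by auto

lemma sgnb_sum: "sgnb (\<Sum>i\<in>I. f i) = (\<Prod>i\<in>I. sgnb (f i))"
proof (induction I rule: infinite_finite_induct)
  case (insert x F)
  show ?case
    by (simp only: sum.insert[OF insert.hyps] prod.insert[OF insert.hyps] sgnb_add insert.IH)
qed simp_all

text \<open>Flipping bit \<open>c\<close> is an involution of the strings that reverses every
  sign.\<close>

lemma sum_sgnb_eq_0:
  assumes c: "c < n" "w c = 1"
  shows "(\<Sum>y\<in>bitstr n. sgnb (\<Sum>i<n. w i * y ! i)) = 0"
proof -
  define fl :: "bits \<Rightarrow> bits" where "fl = (\<lambda>y. y[c := y ! c + 1])"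
  have flfl: "fl (fl y) = y" if "y \<in> bitstr n" for y
  proof -
    have "c < length y" using that c unfolding bitstr_def by simp
    then have "fl (fl y) = y[c := y ! c + 1 + 1]" unfolding fl_def by simp
    also have "y ! c + 1 + 1 = y ! c" by (cases "y ! c") simp_all
    finally show ?thesis by simp
  qed
  have flc: "fl y \<in> bitstr n" if "y \<in> bitstr n" for y using that unfolding fl_def bitstr_def by simp
  have flip: "sgnb (\<Sum>i<n. w i * fl y ! i) = - sgnb (\<Sum>i<n. w i * y ! i)" if "y \<in> bitstr n" for y
  proof -
    have y: "length y = n" using that unfolding bitstr_def by simp
    have "(\<Sum>i<n. w i * fl y ! i) = w c * fl y ! c + (\<Sum>i\<in>{..<n} - {c}. w i * fl y ! i)"
      using c by (intro sum.remove) auto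
    also have "(\<Sum>i\<in>{..<n} - {c}. w i * fl y ! i) = (\<Sum>i\<in>{..<n} - {c}. w i * y ! i)"
      unfolding fl_def by (intro sum.cong) auto
    also have "w c * fl y ! c = 1 + w c * y ! c" using c y unfolding fl_def by simp
    also have "1 + w c * y ! c + (\<Sum>i\<in>{..<n} - {c}. w i * y ! i) = 1 + (\<Sum>i<n. w i * y ! i)"
      using c by (subst (2) sum.remove[of _ c]) (auto simp: add.assoc)
    finally show ?thesis by (simp add: sgnb_add) (simp add: sgnb_def)
  qed
  have "(\<Sum>y\<in>bitstr n. sgnb (\<Sum>i<n. w i * y ! i)) = (\<Sum>y\<in>bitstr n. sgnb (\<Sum>i<n. w i * fl y ! i))"
    by (rule sum.reindex_bij_witness[where i = fl and j = fl]) (auto simp only: flfl flc)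
  also have "\<dots> = - (\<Sum>y\<in>bitstr n. sgnb (\<Sum>i<n. w i * y ! i))"
    unfolding sum_negf[symmetric] by (intro sum.cong refl flip)
  finally have *: "(\<Sum>y\<in>bitstr n. sgnb (\<Sum>i<n. w i * y ! i)) = - (\<Sum>y\<in>bitstr n. sgnb (\<Sum>i<n. w i * y ! i))" .
  have "z = 0" if "z = - z" for z :: complex using that by simp
  from this[OF *] show ?thesis .
qed

text \<open>The sum over all subsets factors into a product over positions, in which one
  disagreement produces a factor 0. Parities are numbered from 1 and list positions from 0, hence
  \<open>i - 1\<close>.\<close>

lemma character_expansion:
  assumes "z \<in> bitstr l" "u \<in> bitstr l"
  shows "(\<Sum>S\<in>Pow {1..l}. (\<Prod>i\<in>S. sgnb (z ! (i - 1))) * (\<Prod>i\<in>S. sgnb (u ! (i - 1)))) = (if z = u then 2 ^ l else 0)"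
proof -
  have "(\<Sum>S\<in>Pow {1..l}. (\<Prod>i\<in>S. sgnb (z ! (i - 1))) * (\<Prod>i\<in>S. sgnb (u ! (i - 1))))
      = (\<Prod>i\<in>{1..l}. sgnb (z ! (i - 1)) * sgnb (u ! (i - 1)) + 1)"
    by (subst prod_add) (auto simp: prod.distrib)
  also have "\<dots> = (if z = u then 2 ^ l else 0)"
  proof (cases "z = u")
    case True
    then show ?thesis by simp
  next
    case False
    then obtain i where i: "i < l" "z ! i \<noteq> u ! i"
      using assms unfolding bitstr_def by (auto simp: list_eq_iff_nth_eq)
    have "sgnb (z ! (Suc i - 1)) * sgnb (u ! (Suc i - 1)) + 1 = 0"
      using i(2) unfolding sgnb_def by (cases "z ! i"; cases "u ! i") auto
    then have "(\<Prod>i\<in>{1..l}. sgnb (z ! (i - 1)) * sgnb (u ! (i - 1)) + 1) = 0"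
      using i(1) by (intro prod_zero) (auto intro!: bexI[of _ "Suc i"])
    then show ?thesis using False by simp
  qed
  finally show ?thesis .
qed

text \<open>The indicator of \<open>E s = u\<close> is an average of characters. The empty set gives
  the uniform term; each of the other \<open>2 ^ l - 1\<close> sets costs at most \<open>B\<close>
  for each of the \<open>2 ^ l\<close> values \<open>u\<close>, and one factor \<open>2 ^ l\<close>
  is divided out.\<close>

lemma xor_lemma:
  fixes g :: "'a \<Rightarrow> bits \<Rightarrow> complex"
  assumes B: "B \<ge> 0" and E: "\<And>s. s \<in> Q \<Longrightarrow> E s \<in> bitstr l"
    and bias: "\<And>u S. u \<in> bitstr l \<Longrightarrow> S \<subseteq> {1..l} \<Longrightarrow> S \<noteq> {} \<Longrightarrow>
        cmod (\<Sum>s\<in>Q. (\<Prod>i\<in>S. sgnb (E s ! (i - 1))) * g s u) \<le> B"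
  shows "cmod ((\<Sum>s\<in>Q. g s (E s)) - (\<Sum>s\<in>Q. \<Sum>u\<in>bitstr l. g s u) / 2 ^ l) \<le> 2 ^ l * B"
proof -
  define ch where "ch = (\<lambda>S z. \<Prod>i\<in>S. sgnb (z ! (i - 1 :: nat)))"
  have ch1: "cmod (ch S z) = 1" for S z unfolding ch_def by (simp add: prod_norm[symmetric])
  have g: "2 ^ l * g s (E s) - (\<Sum>u\<in>bitstr l. g s u)
      = (\<Sum>u\<in>bitstr l. \<Sum>S\<in>Pow {1..l} - {{}}. ch S u * (ch S (E s) * g s u))" if s: "s \<in> Q" for s
  proof -
    have "2 ^ l * g s (E s) = (\<Sum>u\<in>bitstr l. if E s = u then 2 ^ l * g s u else 0)"
      using E[OF s] by simp
    also have "\<dots> = (\<Sum>u\<in>bitstr l. (\<Sum>S\<in>Pow {1..l}. ch S (E s) * ch S u) * g s u)"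
    proof (intro sum.cong refl)
      fix u assume u: "u \<in> bitstr l"
      show "(if E s = u then 2 ^ l * g s u else 0) = (\<Sum>S\<in>Pow {1..l}. ch S (E s) * ch S u) * g s u"
        unfolding ch_def character_expansion[OF E[OF s] u] by simp
    qed
    \<comment> \<open>The empty set contributes \<open>g s u\<close>.\<close>
    also have "\<dots> = (\<Sum>u\<in>bitstr l. g s u + (\<Sum>S\<in>Pow {1..l} - {{}}. ch S (E s) * ch S u) * g s u)"
      by (intro sum.cong refl) (subst sum.remove[of _ "{}"], auto simp: ch_def distrib_right)
    also have "\<dots> = (\<Sum>u\<in>bitstr l. g s u) + (\<Sum>u\<in>bitstr l. \<Sum>S\<in>Pow {1..l} - {{}}. ch S u * (ch S (E s) * g s u))"
      unfolding sum.distrib sum_distrib_right by (simp only: mult_ac)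
    finally show ?thesis by simp
  qed
  have "2 ^ l * (\<Sum>s\<in>Q. g s (E s)) - (\<Sum>s\<in>Q. \<Sum>u\<in>bitstr l. g s u)
      = (\<Sum>s\<in>Q. 2 ^ l * g s (E s) - (\<Sum>u\<in>bitstr l. g s u))"
    by (simp add: sum_subtractf sum_distrib_left)
  also have "\<dots> = (\<Sum>s\<in>Q. \<Sum>u\<in>bitstr l. \<Sum>S\<in>Pow {1..l} - {{}}. ch S u * (ch S (E s) * g s u))"
    by (intro sum.cong refl g)
  also have "\<dots> = (\<Sum>u\<in>bitstr l. \<Sum>s\<in>Q. \<Sum>S\<in>Pow {1..l} - {{}}. ch S u * (ch S (E s) * g s u))"
    by (rule sum.swap)
  also have "\<dots> = (\<Sum>u\<in>bitstr l. \<Sum>S\<in>Pow {1..l} - {{}}. ch S u * (\<Sum>s\<in>Q. ch S (E s) * g s u))"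
    unfolding sum_distrib_left by (intro sum.cong refl sum.swap)
  also have "cmod \<dots> \<le> (\<Sum>u\<in>bitstr l. \<Sum>S\<in>Pow {1..l} - {{}}. B)"
  proof (intro order.trans[OF norm_sum] sum_mono)
    fix u S assume u: "u \<in> bitstr l" and S: "S \<in> Pow {1..l} - {{}}"
    have "cmod (\<Sum>s\<in>Q. ch S (E s) * g s u) \<le> B"
      unfolding ch_def using S by (intro bias u) auto
    then show "cmod (ch S u * (\<Sum>s\<in>Q. ch S (E s) * g s u)) \<le> B" by (simp add: norm_mult ch1)
  qed
  also have "\<dots> = 2 ^ l * ((2 ^ l - 1) * B)"
    by (simp add: card_bitstr card_Pow card_Diff_singleton of_nat_diff)
  finally have *: "cmod (2 ^ l * (\<Sum>s\<in>Q. g s (E s)) - (\<Sum>s\<in>Q. \<Sum>u\<in>bitstr l. g s u)) \<le> 2 ^ l * ((2 ^ l - 1) * B)" .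
    have "cmod ((\<Sum>s\<in>Q. g s (E s)) - (\<Sum>s\<in>Q. \<Sum>u\<in>bitstr l. g s u) / 2 ^ l)
        = cmod ((2 ^ l * (\<Sum>s\<in>Q. g s (E s)) - (\<Sum>s\<in>Q. \<Sum>u\<in>bitstr l. g s u)) / 2 ^ l)"
      by (simp add: diff_divide_distrib)
    also have "\<dots> \<le> (2 ^ l - 1) * B"
      using * by (simp add: norm_divide norm_power field_simps)
    also have "\<dots> \<le> 2 ^ l * B" using B by (intro mult_right_mono) auto
    finally show ?thesis .
qed

section \<open>Classical-quantum states and block tests\<close>

lemma tr_mult_minus:
  assumes "T \<in> carrier_mat n n" "A \<in> carrier_mat n n" "B \<in> carrier_mat n n"
  shows "tr (T * (A - B)) = tr (T * A) - tr (T * B)"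
proof -
  have "(A - B) $$ (j, i) = A $$ (j, i) - B $$ (j, i)" if "i < n" "j < n" for i j
    using assms that by auto
  then show ?thesis
    unfolding tr_mult[OF assms(1) minus_carrier_mat[OF assms(3)]] tr_mult[OF assms(1,2)] tr_mult[OF assms(1,3)]
    by (simp add: right_diff_distrib sum_subtractf)
qed

lemma smult_mat_index:
  "A \<in> carrier_mat n m \<Longrightarrow> i < n \<Longrightarrow> j < m \<Longrightarrow> (c \<cdot>\<^sub>m A) $$ (i, j) = c * A $$ (i, j)"
  by auto

lemma matsum_smult_index:
  assumes "\<And>s. s \<in> S \<Longrightarrow> f s \<in> carrier_mat n n" "i < n" "j < n"
  shows "matsum n (\<lambda>s. c s \<cdot>\<^sub>m f s) S $$ (i, j) = (\<Sum>s\<in>S. c s * f s $$ (i, j))"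
  unfolding matsum_index[OF assms(2,3)] by (intro sum.cong refl smult_mat_index[OF assms(1)] assms(2,3))

lemma tr_mult_smult:
  "T \<in> carrier_mat n n \<Longrightarrow> A \<in> carrier_mat n n \<Longrightarrow> tr (T * (c \<cdot>\<^sub>m A)) = c * tr (T * A)"
  by (simp add: tr_mult[of _ n] sum_distrib_left mult_ac)

lemma tr_mult_matsum:
  assumes T: "T \<in> carrier_mat n n" and f: "\<And>s. s \<in> S \<Longrightarrow> f s \<in> carrier_mat n n"
  shows "tr (T * matsum n f S) = (\<Sum>s\<in>S. tr (T * f s))"
proof -
  have "tr (T * matsum n f S) = (\<Sum>i<n. \<Sum>j<n. \<Sum>s\<in>S. T $$ (i, j) * f s $$ (j, i))"
    unfolding tr_mult[OF T matsum_carrier] by (simp add: sum_distrib_left)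
  also have "\<dots> = (\<Sum>s\<in>S. \<Sum>i<n. \<Sum>j<n. T $$ (i, j) * f s $$ (j, i))"
    unfolding sum.cartesian_product
    by (rule sum.reindex_bij_witness[where i = "\<lambda>(s, i, j). (i, j, s)" and j = "\<lambda>(i, j, s). (s, i, j)"]) auto
  also have "\<dots> = (\<Sum>s\<in>S. tr (T * f s))" using f by (simp add: tr_mult[OF T])
  finally show ?thesis .
qed

text \<open>The part of a test that applies when the classical register holds the value
  \<open>v\<close>; against block diagonal states only these parts of a test matter.\<close>

definition block :: "nat \<Rightarrow> complex mat \<Rightarrow> nat \<Rightarrow> complex mat" where
  "block d T v = mat d d (\<lambda>(i, j). T $$ (v * d + i, v * d + j))"

lemma block_carrier [simp]: "block d T v \<in> carrier_mat d d"
  unfolding block_def by simp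

lemma block_dim [simp]: "dim_row (block d T v) = d" "dim_col (block d T v) = d"
  unfolding block_def by simp_all

lemma block_index [simp]: "i < d \<Longrightarrow> j < d \<Longrightarrow> block d T v $$ (i, j) = T $$ (v * d + i, v * d + j)"
  unfolding block_def by simp

lemma sum_single_block:
  fixes f :: "nat \<Rightarrow> complex \<Rightarrow> 'z::comm_monoid_add"
  assumes v: "v < m" and f0: "\<And>e. f e 0 = 0"
  shows "(\<Sum>e<m * d. f e (if e div d = v then w (e mod d) else 0)) = (\<Sum>b<d. f (v * d + b) (w b))"
proof -
  have "(\<Sum>e<m * d. f e (if e div d = v then w (e mod d) else 0))
      = (\<Sum>a<m. if a = v then \<Sum>b<d. f (v * d + b) (w b) else 0)"
    unfolding sum_lessThan_mult by (rule sum.cong[OF refl]) (auto simp: f0 intro!: sum.cong sum.neutral)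
  then show ?thesis using v by simp
qed

text \<open>A vector on the block is padded by zeros, and the sum over all columns dominates the sum
  over the columns of the block.\<close>

lemma contraction_block:
  assumes T: "contraction (m * d) T" and v: "v < m"
  shows "contraction d (block d T v)"
  unfolding contraction_def
proof (intro conjI allI block_carrier)
  fix w :: "nat \<Rightarrow> complex"
  define W where "W = (\<lambda>e. if e div d = v then w (e mod d) else 0)"
  have "(\<Sum>i<m * d. T $$ (i, v * d + j) * W i) = (\<Sum>i<d. block d T v $$ (i, j) * w i)" if "j < d" for j
    unfolding W_def using that by (subst sum_single_block[OF v, where f = "\<lambda>e x. T $$ (e, v * d + j) * x"]) auto
  then have "(\<Sum>j<d. (cmod (\<Sum>i<d. block d T v $$ (i, j) * w i))\<^sup>2)
      = (\<Sum>j<d. (cmod (\<Sum>i<m * d. T $$ (i, v * d + j) * W i))\<^sup>2)"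
    by (simp del: block_index)
  also have "\<dots> \<le> (\<Sum>a<m. \<Sum>j<d. (cmod (\<Sum>i<m * d. T $$ (i, a * d + j) * W i))\<^sup>2)"
    using v by (intro member_le_sum[where f = "\<lambda>a. \<Sum>j<d. (cmod (\<Sum>i<m * d. T $$ (i, a * d + j) * W i))\<^sup>2"]) (auto intro!: sum_nonneg)
  also have "\<dots> = (\<Sum>j<m * d. (cmod (\<Sum>i<m * d. T $$ (i, j) * W i))\<^sup>2)"
    unfolding sum_lessThan_mult[of "\<lambda>j. (cmod (\<Sum>i<m * d. T $$ (i, j) * W i))\<^sup>2"] ..
  also have "\<dots> \<le> (\<Sum>i<m * d. (cmod (W i))\<^sup>2)" by (rule contraction_le[OF T])
  also have "\<dots> = (\<Sum>i<d. (cmod (w i))\<^sup>2)"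
    unfolding W_def by (rule sum_single_block[OF v, where f = "\<lambda>e x. (cmod x)\<^sup>2"]) simp
  finally show "(\<Sum>j<d. (cmod (\<Sum>i<d. block d T v $$ (i, j) * w i))\<^sup>2) \<le> (\<Sum>i<d. (cmod (w i))\<^sup>2)" .
qed

text \<open>It combines tests chosen separately for each classical value into one, so that a test of
  a truncated output can be pulled back to the full output.\<close>

definition block_diag :: "nat \<Rightarrow> nat \<Rightarrow> (nat \<Rightarrow> complex mat) \<Rightarrow> complex mat" where
  "block_diag m d B = mat (m * d) (m * d)
     (\<lambda>(i, j). if i div d = j div d then B (i div d) $$ (i mod d, j mod d) else 0)"

lemma block_diag_index:
  assumes "a < m" "a' < m" "i < d" "j < d"
  shows "block_diag m d B $$ (a * d + i, a' * d + j) = (if a = a' then B a $$ (i, j) else 0)"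
  using assms mult_add_less[of a m i d] mult_add_less[of a' m j d] unfolding block_diag_def by simp

lemma block_block_diag:
  assumes "v < m" "B v \<in> carrier_mat d d"
  shows "block d (block_diag m d B) v = B v"
  using assms by (intro eq_matI) (auto simp: block_diag_index)

lemma contraction_block_diag:
  assumes B: "\<And>v. v < m \<Longrightarrow> contraction d (B v)"
  shows "contraction (m * d) (block_diag m d B)"
  unfolding contraction_def
proof (intro conjI allI)
  show "block_diag m d B \<in> carrier_mat (m * d) (m * d)" unfolding block_diag_def by simp
  fix v :: "nat \<Rightarrow> complex"
  have "(\<Sum>a'<m. \<Sum>j<d. (cmod (\<Sum>a<m. \<Sum>i<d. block_diag m d B $$ (a * d + i, a' * d + j) * v (a * d + i)))\<^sup>2)
     = (\<Sum>a'<m. \<Sum>j<d. (cmod (\<Sum>i<d. B a' $$ (i, j) * v (a' * d + i)))\<^sup>2)"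
  proof (rule sum.cong[OF refl], rule sum.cong[OF refl], rule arg_cong[where f = "\<lambda>z. (cmod z)\<^sup>2"])
    fix a' j assume a': "a' \<in> {..<m}" and j: "j \<in> {..<d}"
    have "(\<Sum>a<m. \<Sum>i<d. block_diag m d B $$ (a * d + i, a' * d + j) * v (a * d + i))
       = (\<Sum>a<m. if a = a' then \<Sum>i<d. B a' $$ (i, j) * v (a' * d + i) else 0)"
      using a' j by (intro sum.cong refl) (auto simp: block_diag_index)
    then show "(\<Sum>a<m. \<Sum>i<d. block_diag m d B $$ (a * d + i, a' * d + j) * v (a * d + i))
       = (\<Sum>i<d. B a' $$ (i, j) * v (a' * d + i))" using a' by simp
  qed
  also have "\<dots> \<le> (\<Sum>a'<m. \<Sum>i<d. (cmod (v (a' * d + i)))\<^sup>2)"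
  proof (rule sum_mono)
    fix a' assume "a' \<in> {..<m}"
    then have "contraction d (B a')" using B by simp
    then show "(\<Sum>j<d. (cmod (\<Sum>i<d. B a' $$ (i, j) * v (a' * d + i)))\<^sup>2) \<le> (\<Sum>i<d. (cmod (v (a' * d + i)))\<^sup>2)"
      by (rule contraction_le)
  qed
  finally show "(\<Sum>j<m * d. (cmod (\<Sum>i<m * d. block_diag m d B $$ (i, j) * v i))\<^sup>2) \<le> (\<Sum>i<m * d. (cmod (v i))\<^sup>2)"
    unfolding sum_lessThan_mult .
qed

lemma ketbra_carrier [simp]: "ketbra m z \<in> carrier_mat (2 ^ m) (2 ^ m)"
  unfolding ketbra_def by simp

lemma unif_carrier [simp]: "unif m \<in> carrier_mat (2 ^ m) (2 ^ m)"
  unfolding unif_def by simp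

lemma tr_kron:
  assumes T: "T \<in> carrier_mat (m * d) (m * d)" and A: "A \<in> carrier_mat m m" and M: "M \<in> carrier_mat d d"
    and diag: "\<And>i j. i < m \<Longrightarrow> j < m \<Longrightarrow> i \<noteq> j \<Longrightarrow> A $$ (i, j) = 0"
  shows "tr (T * kron A M) = (\<Sum>v<m. A $$ (v, v) * tr (block d T v * M))"
proof -
  have "tr (T * kron A M) = (\<Sum>v<m. \<Sum>i<d. \<Sum>v'<m. \<Sum>j<d. T $$ (v * d + i, v' * d + j) * (A $$ (v', v) * M $$ (j, i)))"
    unfolding tr_mult[OF T kron_carrier[OF A M]] sum_lessThan_mult
    by (intro sum.cong refl) (auto simp: kron_index[OF A M])
  also have "\<dots> = (\<Sum>v<m. \<Sum>i<d. \<Sum>v'<m. if v' = v then \<Sum>j<d. T $$ (v * d + i, v * d + j) * (A $$ (v, v) * M $$ (j, i)) else 0)"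
    using diag by (intro sum.cong refl) auto
  also have "\<dots> = (\<Sum>v<m. A $$ (v, v) * tr (block d T v * M))"
    by (simp add: tr_mult[OF block_carrier M] sum_distrib_left mult_ac)
  finally show ?thesis .
qed

lemma tr_ketbra:
  assumes T: "T \<in> carrier_mat (2 ^ m * d) (2 ^ m * d)" and M: "M \<in> carrier_mat d d" and z: "z \<in> bitstr m"
  shows "tr (T * kron (ketbra m z) M) = tr (block d T (bits_val z) * M)"
proof -
  have b: "bits_val z < 2 ^ m" using bits_val_less[of z] z unfolding bitstr_def by simp
  have "tr (T * kron (ketbra m z) M) = (\<Sum>v<2 ^ m. ketbra m z $$ (v, v) * tr (block d T v * M))"
    by (rule tr_kron[OF T ketbra_carrier M]) (auto simp: ketbra_def)
  also have "\<dots> = (\<Sum>v<2 ^ m. if v = bits_val z then tr (block d T v * M) else 0)"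
    by (intro sum.cong refl) (auto simp: ketbra_def)
  finally show ?thesis using b by simp
qed

lemma tr_unif:
  assumes T: "T \<in> carrier_mat (2 ^ m * d) (2 ^ m * d)" and M: "M \<in> carrier_mat d d"
  shows "tr (T * kron (unif m) M) = (\<Sum>z\<in>bitstr m. tr (block d T (bits_val z) * M)) / 2 ^ m"
proof -
  have "tr (T * kron (unif m) M) = (\<Sum>v<2 ^ m. unif m $$ (v, v) * tr (block d T v * M))"
    by (rule tr_kron[OF T unif_carrier M]) (auto simp: unif_def)
  also have "\<dots> = (\<Sum>v<2 ^ m. tr (block d T v * M)) / 2 ^ m"
    unfolding sum_divide_distrib by (intro sum.cong refl) (auto simp: unif_def)
  also have "(\<Sum>v<2 ^ m. tr (block d T v * M)) = (\<Sum>z\<in>bitstr m. tr (block d T (bits_val z) * M))"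
    by (rule sum.reindex_bij_betw[OF bij_betw_bits_val, symmetric])
  finally show ?thesis .
qed

lemma hermitian_kron:
  assumes A: "A \<in> carrier_mat m m" "hermitian m (\<lambda>i j. A $$ (i, j))" and M: "M \<in> carrier_mat d d" "hermitian d (\<lambda>i j. M $$ (i, j))"
  shows "hermitian (m * d) (\<lambda>i j. kron A M $$ (i, j))"
  unfolding hermitian_def
proof (intro allI impI)
  fix i j assume i: "i < m * d" and j: "j < m * d"
  then have d: "d > 0" by (cases d) auto
  have *: "i div d < m" "i mod d < d" "j div d < m" "j mod d < d" using i j d by (auto simp: less_mult_imp_div_less)
  have "A $$ (j div d, i div d) = cnj (A $$ (i div d, j div d))" "M $$ (j mod d, i mod d) = cnj (M $$ (i mod d, j mod d))"
    using A(2) M(2) * unfolding hermitian_def by blast+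
  then show "kron A M $$ (j, i) = cnj (kron A M $$ (i, j))"
    using kron_index[OF A(1) M(1), of "j div d" "j mod d" "i div d" "i mod d"]
      kron_index[OF A(1) M(1), of "i div d" "i mod d" "j div d" "j mod d"] * by simp
qed

lemma hermitian_matsum:
  assumes "\<And>s. s \<in> S \<Longrightarrow> hermitian n (\<lambda>i j. f s $$ (i, j))"
  shows "hermitian n (\<lambda>i j. matsum n f S $$ (i, j))"
  unfolding hermitian_def
proof (intro allI impI)
  fix i j assume ij: "i < n" "j < n"
  have "f s $$ (j, i) = cnj (f s $$ (i, j))" if "s \<in> S" for s
    using assms[OF that] ij unfolding hermitian_def by blast
  then show "matsum n f S $$ (j, i) = cnj (matsum n f S $$ (i, j))" using ij by simp
qed

lemma hermitian_smult:
  assumes "A \<in> carrier_mat n n" "hermitian n (\<lambda>i j. A $$ (i, j))"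
  shows "hermitian n (\<lambda>i j. (of_real c \<cdot>\<^sub>m A) $$ (i, j))"
  unfolding hermitian_def
proof (intro allI impI)
  fix i j assume ij: "i < n" "j < n"
  then have "A $$ (j, i) = cnj (A $$ (i, j))" using assms unfolding hermitian_def by blast
  then show "(of_real c \<cdot>\<^sub>m A) $$ (j, i) = cnj ((of_real c \<cdot>\<^sub>m A) $$ (i, j))" using ij assms(1) by simp
qed

lemma hermitian_minus:
  assumes "A \<in> carrier_mat n n" "hermitian n (\<lambda>i j. A $$ (i, j))" "B \<in> carrier_mat n n" "hermitian n (\<lambda>i j. B $$ (i, j))"
  shows "hermitian n (\<lambda>i j. (A - B) $$ (i, j))"
  unfolding hermitian_def
proof (intro allI impI)
  fix i j assume ij: "i < n" "j < n"
  then have "A $$ (j, i) = cnj (A $$ (i, j))" "B $$ (j, i) = cnj (B $$ (i, j))" using assms unfolding hermitian_def by blast+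
  then show "(A - B) $$ (j, i) = cnj ((A - B) $$ (i, j))" using ij assms(1,3) by simp
qed

text \<open>The common shape of the differences in both extractor definitions: \<open>s\<close> runs
  over pairs of source values or over pairs of a source value and a seed.\<close>

definition ext_diff where
  "ext_diff m d S w F \<rho> \<tau> = matsum (2 ^ m * d) (\<lambda>s. complex_of_real (w s) \<cdot>\<^sub>m kron (ketbra m (F s)) (\<rho> s)) S
      - kron (unif m) \<tau>"

lemma ext_diff_prod:
  "ext_diff m d S (\<lambda>(x, y). w x y) (\<lambda>(x, y). F x y) (\<lambda>(x, y). \<rho> x y) \<tau>
     = matsum (2 ^ m * d) (\<lambda>(x, y). complex_of_real (w x y) \<cdot>\<^sub>m kron (ketbra m (F x y)) (\<rho> x y)) S
         - kron (unif m) \<tau>"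
proof -
  have "(\<lambda>s. complex_of_real (case s of (x, y) \<Rightarrow> w x y) \<cdot>\<^sub>m
        kron (ketbra m (case s of (x, y) \<Rightarrow> F x y)) (case s of (x, y) \<Rightarrow> \<rho> x y))
      = (\<lambda>(x, y). complex_of_real (w x y) \<cdot>\<^sub>m kron (ketbra m (F x y)) (\<rho> x y))"
    by (auto simp: fun_eq_iff)
  then show ?thesis unfolding ext_diff_def by simp
qed

lemma ext_diff_hermitian:
  assumes \<rho>: "\<And>s. s \<in> S \<Longrightarrow> \<rho> s \<in> carrier_mat d d" "\<And>s. s \<in> S \<Longrightarrow> hermitian d (\<lambda>i j. \<rho> s $$ (i, j))"
    and \<tau>: "\<tau> \<in> carrier_mat d d" "hermitian d (\<lambda>i j. \<tau> $$ (i, j))"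
  shows "ext_diff m d S w F \<rho> \<tau> \<in> carrier_mat (2 ^ m * d) (2 ^ m * d)"
    and "hermitian (2 ^ m * d) (\<lambda>i j. ext_diff m d S w F \<rho> \<tau> $$ (i, j))"
proof -
  have u: "hermitian (2 ^ m) (\<lambda>i j. unif m $$ (i, j))" unfolding hermitian_def unif_def by auto
  have k: "hermitian (2 ^ m) (\<lambda>i j. ketbra m z $$ (i, j))" for z unfolding hermitian_def ketbra_def by auto
  have ku: "kron (unif m) \<tau> \<in> carrier_mat (2 ^ m * d) (2 ^ m * d)" by (rule kron_carrier[OF unif_carrier \<tau>(1)])
  then show "ext_diff m d S w F \<rho> \<tau> \<in> carrier_mat (2 ^ m * d) (2 ^ m * d)"
    unfolding ext_diff_def by (rule minus_carrier_mat)
  show "hermitian (2 ^ m * d) (\<lambda>i j. ext_diff m d S w F \<rho> \<tau> $$ (i, j))"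
    unfolding ext_diff_def
    by (intro hermitian_minus hermitian_matsum hermitian_smult hermitian_kron ku matsum_carrier kron_carrier u k \<rho> \<tau>
        unif_carrier ketbra_carrier)
qed

lemma tr_ext_diff:
  assumes T: "T \<in> carrier_mat (2 ^ m * d) (2 ^ m * d)"
    and \<rho>: "\<And>s. s \<in> S \<Longrightarrow> \<rho> s \<in> carrier_mat d d" and \<tau>: "\<tau> \<in> carrier_mat d d" and F: "\<And>s. s \<in> S \<Longrightarrow> F s \<in> bitstr m"
  shows "tr (T * ext_diff m d S w F \<rho> \<tau>) = (\<Sum>s\<in>S. of_real (w s) * tr (block d T (bits_val (F s)) * \<rho> s))
     - (\<Sum>z\<in>bitstr m. tr (block d T (bits_val z) * \<tau>)) / 2 ^ m"
proof -
  have k: "kron (ketbra m (F s)) (\<rho> s) \<in> carrier_mat (2 ^ m * d) (2 ^ m * d)" if "s \<in> S" for s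
    by (intro kron_carrier ketbra_carrier \<rho> that)
  have ku: "kron (unif m) \<tau> \<in> carrier_mat (2 ^ m * d) (2 ^ m * d)" by (rule kron_carrier[OF unif_carrier \<tau>])
  have "tr (T * ext_diff m d S w F \<rho> \<tau>)
     = tr (T * matsum (2 ^ m * d) (\<lambda>s. complex_of_real (w s) \<cdot>\<^sub>m kron (ketbra m (F s)) (\<rho> s)) S) - tr (T * kron (unif m) \<tau>)"
    unfolding ext_diff_def by (rule tr_mult_minus[OF T matsum_carrier ku])
  also have "tr (T * matsum (2 ^ m * d) (\<lambda>s. complex_of_real (w s) \<cdot>\<^sub>m kron (ketbra m (F s)) (\<rho> s)) S)
     = (\<Sum>s\<in>S. tr (T * (complex_of_real (w s) \<cdot>\<^sub>m kron (ketbra m (F s)) (\<rho> s))))"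
    by (intro tr_mult_matsum[OF T] smult_carrier_mat k)
  also have "\<dots> = (\<Sum>s\<in>S. of_real (w s) * tr (block d T (bits_val (F s)) * \<rho> s))"
    by (intro sum.cong refl) (simp only: tr_mult_smult[OF T k] tr_ketbra[OF T \<rho> F])
  finally show ?thesis unfolding tr_unif[OF T \<tau>] .
qed

lemma psd_hermitian: "psd n M \<Longrightarrow> M \<in> carrier_mat n n \<and> hermitian n (\<lambda>i j. M $$ (i, j))"
  unfolding psd_iff by blast

lemma psd_matsum_smult:
  assumes "finite S" "\<And>s. s \<in> S \<Longrightarrow> psd n (f s)" "\<And>s. s \<in> S \<Longrightarrow> 0 \<le> c s"
  shows "psd n (matsum n (\<lambda>s. complex_of_real (c s) \<cdot>\<^sub>m f s) S)"
proof -
  have "\<exists>K v. gram n {..<K::nat} v (f s)" if "s \<in> S" for s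
    using psd_gramE[OF assms(2)[OF that]] by metis
  then obtain K v where "\<And>s. s \<in> S \<Longrightarrow> gram n {..<K s::nat} (v s) (f s)" by metis
  then show ?thesis by (intro gram_psd[OF gram_matsum[OF assms(1) gram_smult]] assms(3)) auto
qed

lemma tr_matsum_smult:
  assumes "\<And>s. s \<in> S \<Longrightarrow> f s \<in> carrier_mat n n"
  shows "tr (matsum n (\<lambda>s. c s \<cdot>\<^sub>m f s) S) = (\<Sum>s\<in>S. c s * tr (f s))"
proof -
  have "tr (matsum n (\<lambda>s. c s \<cdot>\<^sub>m f s) S) = (\<Sum>i<n. \<Sum>s\<in>S. c s * f s $$ (i, i))"
    unfolding tr_def matsum_dim by (intro sum.cong[OF refl] matsum_smult_index assms) auto
  also have "\<dots> = (\<Sum>s\<in>S. \<Sum>i<n. c s * f s $$ (i, i))" by (rule sum.swap)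
  also have "\<dots> = (\<Sum>s\<in>S. c s * tr (f s))"
    unfolding tr_def sum_distrib_left using assms by (intro sum.cong) auto
  finally show ?thesis .
qed

text \<open>One test is evaluated on two differences: \<open>D\<close>, where the seed is
  \<open>g x y\<close>, and \<open>D'\<close>, where it is uniform and independent. The seeded
  extractor bounds the second value, and the two values differ only in how the seed is chosen. Given
  a seed value \<open>u\<close>, the test of the stored state is \<open>bl (take m (f x u))\<close>,
  which is determined by \<open>x\<close>; so \<open>bias\<close> applies to every parity, and
  \<open>xor_lemma\<close> collects them. The division by 2 comes from
  \<open>trnorm\<close>.\<close>

lemma composed_extractor_bound:
  fixes p q :: "bits pmf" and \<rho> :: "bits \<Rightarrow> bits \<Rightarrow> complex mat"
  assumes ext: "seeded_extractor n l m' k \<epsilon>' b f" and p: "source n k p" and q: "set_pmf q \<subseteq> bitstr n"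
    and \<rho>: "\<And>x y. x \<in> bitstr n \<Longrightarrow> y \<in> bitstr n \<Longrightarrow> density (2 ^ b) (\<rho> x y)"
    and g: "\<And>x y. x \<in> bitstr n \<Longrightarrow> y \<in> bitstr n \<Longrightarrow> g x y \<in> bitstr l"
    and mm: "m \<le> m'" and B: "B \<ge> 0"
    and bias: "\<And>T S. S \<subseteq> {1..l} \<Longrightarrow> S \<noteq> {} \<Longrightarrow> (\<And>x. x \<in> bitstr n \<Longrightarrow> contraction (2 ^ b) (T x)) \<Longrightarrow>
       cmod (\<Sum>x\<in>bitstr n. \<Sum>y\<in>bitstr n. (\<Prod>i\<in>S. sgnb (g x y ! (i - 1))) * of_real (pmf p x * pmf q y) * tr (T x * \<rho> x y)) \<le> B"
  shows "trnorm (ext_diff m (2 ^ b) (bitstr n \<times> bitstr n) (\<lambda>(x, y). pmf p x * pmf q y) (\<lambda>(x, y). take m (f x (g x y)))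
      (\<lambda>(x, y). \<rho> x y) (matsum (2 ^ b) (\<lambda>(x, y). complex_of_real (pmf p x * pmf q y) \<cdot>\<^sub>m \<rho> x y) (bitstr n \<times> bitstr n)))
    \<le> \<epsilon>' + 2 ^ l * B / 2"
proof -
  let ?X = "bitstr n" and ?d = "2 ^ b :: nat"
  define \<tau> where "\<tau> = matsum ?d (\<lambda>(x, y). complex_of_real (pmf p x * pmf q y) \<cdot>\<^sub>m \<rho> x y) (?X \<times> ?X)"
  \<comment> \<open>The state averaged over \<open>y\<close> depends on \<open>x\<close> alone, as
    the definition of a seeded extractor requires.\<close>
  define \<rho>' where "\<rho>' = (\<lambda>x. matsum ?d (\<lambda>y. complex_of_real (pmf q y) \<cdot>\<^sub>m \<rho> x y) ?X)"
  define D where "D = ext_diff m ?d (?X \<times> ?X) (\<lambda>(x, y). pmf p x * pmf q y) (\<lambda>(x, y). take m (f x (g x y))) (\<lambda>(x, y). \<rho> x y) \<tau>"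
  have f: "f x u \<in> bitstr m'" if "x \<in> ?X" "u \<in> bitstr l" for x u
    using ext that unfolding seeded_extractor_def by blast
  have tk: "take m z \<in> bitstr m" if "z \<in> bitstr m'" for z using that mm unfolding bitstr_def by simp
  have psd\<rho>: "psd ?d (\<rho> x y)" and tr\<rho>: "tr (\<rho> x y) = 1" if "x \<in> ?X" "y \<in> ?X" for x y
    using \<rho>[OF that] unfolding density_def by auto
  note \<rho>c = psd_hermitian[OF psd\<rho>, THEN conjunct1]
  have psd\<rho>': "psd ?d (\<rho>' x)" if "x \<in> ?X" for x
    unfolding \<rho>'_def by (intro psd_matsum_smult) (use psd\<rho> that in auto)
  note \<rho>'c = psd_hermitian[OF psd\<rho>', THEN conjunct1]
  have \<rho>': "density ?d (\<rho>' x)" if x: "x \<in> ?X" for x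
  proof -
    have "tr (\<rho>' x) = (\<Sum>y\<in>?X. of_real (pmf q y) * 1)"
      unfolding \<rho>'_def using tr\<rho>[OF x] \<rho>c[OF x] by (subst tr_matsum_smult) auto
    also have "\<dots> = of_real (\<Sum>y\<in>?X. pmf q y)" by simp
    also have "\<dots> = 1" using q by (simp add: sum_pmf_eq_1)
    finally show ?thesis unfolding density_def using psd\<rho>'[OF x] by simp
  qed
  \<comment> \<open>Both differences refer to the same average state.\<close>
  have \<tau>_eq: "\<tau> = matsum ?d (\<lambda>x. complex_of_real (pmf p x) \<cdot>\<^sub>m \<rho>' x) ?X"
  proof (intro eq_matI)
    fix i j assume "i < dim_row (matsum ?d (\<lambda>x. complex_of_real (pmf p x) \<cdot>\<^sub>m \<rho>' x) ?X)"
      "j < dim_col (matsum ?d (\<lambda>x. complex_of_real (pmf p x) \<cdot>\<^sub>m \<rho>' x) ?X)"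
    then have ij: "i < ?d" "j < ?d" by simp_all
    have "\<tau> $$ (i, j) = (\<Sum>x\<in>?X. \<Sum>y\<in>?X. of_real (pmf p x * pmf q y) * \<rho> x y $$ (i, j))"
    proof -
      have "\<tau> $$ (i, j) = (\<Sum>(x, y)\<in>?X \<times> ?X. of_real (pmf p x * pmf q y) * \<rho> x y $$ (i, j))"
        unfolding \<tau>_def matsum_index[OF ij]
        by (rule sum.cong[OF refl]) (auto simp del: of_real_mult simp: smult_mat_index[OF \<rho>c ij])
      then show ?thesis by (simp only: sum.cartesian_product)
    qed
    also have "\<dots> = (\<Sum>x\<in>?X. of_real (pmf p x) * \<rho>' x $$ (i, j))"
    proof (intro sum.cong refl)
      fix x assume x: "x \<in> ?X"
      have "\<rho>' x $$ (i, j) = (\<Sum>y\<in>?X. of_real (pmf q y) * \<rho> x y $$ (i, j))"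
        unfolding \<rho>'_def by (rule matsum_smult_index[OF \<rho>c[OF x] ij])
      then show "(\<Sum>y\<in>?X. of_real (pmf p x * pmf q y) * \<rho> x y $$ (i, j)) = of_real (pmf p x) * \<rho>' x $$ (i, j)"
        by (simp add: sum_distrib_left mult.assoc)
    qed
    also have "\<dots> = matsum ?d (\<lambda>x. complex_of_real (pmf p x) \<cdot>\<^sub>m \<rho>' x) ?X $$ (i, j)"
      by (rule matsum_smult_index[OF \<rho>'c ij, symmetric])
    finally show "\<tau> $$ (i, j) = matsum ?d (\<lambda>x. complex_of_real (pmf p x) \<cdot>\<^sub>m \<rho>' x) ?X $$ (i, j)" .
  qed (auto simp: \<tau>_def)
  have \<tau>psd: "psd ?d \<tau>" unfolding \<tau>_eq by (intro psd_matsum_smult) (use psd\<rho>' in auto)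
  note \<tau>h = psd_hermitian[OF \<tau>psd]
  have Dh: "D \<in> carrier_mat (2 ^ m * ?d) (2 ^ m * ?d)" "hermitian (2 ^ m * ?d) (\<lambda>i j. D $$ (i, j))"
    unfolding D_def by (intro ext_diff_hermitian; use \<tau>h psd_hermitian[OF psd\<rho>] in force)+
  \<comment> \<open>The optimal test for the composed extractor; it enters below through its
    diagonal blocks \<open>bl\<close>.\<close>
  obtain T where T: "contraction (2 ^ m * ?d) T" and TD: "tr (T * D) = of_real (2 * trnorm D)"
    using trnorm_attained[OF Dh] by blast
  have Tc: "T \<in> carrier_mat (2 ^ m * ?d) (2 ^ m * ?d)" using T by (rule contraction_carrier)
  define bl where "bl = (\<lambda>z. block ?d T (bits_val z))"
  have bl: "contraction ?d (bl z)" if "z \<in> bitstr m" for z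
    unfolding bl_def by (rule contraction_block[OF T]) (use bits_val_less[of z] that in \<open>simp add: bitstr_def\<close>)
  have blc: "bl z \<in> carrier_mat ?d ?d" for z unfolding bl_def by simp
  have 1: "tr (T * D) = (\<Sum>s\<in>?X \<times> ?X. of_real (pmf p (fst s) * pmf q (snd s)) * tr (bl (take m (f (fst s) (g (fst s) (snd s)))) * \<rho> (fst s) (snd s)))
      - (\<Sum>z\<in>bitstr m. tr (bl z * \<tau>)) / 2 ^ m"
    unfolding D_def bl_def
    by (subst tr_ext_diff[OF Tc]) (use \<rho>c \<tau>h f g tk in \<open>auto simp: case_prod_beta\<close>)
  \<comment> \<open>The test for the truncated output is also a test for the full output of the seeded extractor.\<close>
  define T' where "T' = block_diag (2 ^ m') ?d (\<lambda>v. bl (take m (inv_into (bitstr m') bits_val v)))"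
  have inv: "inv_into (bitstr m') bits_val (bits_val z) = z" if "z \<in> bitstr m'" for z
    using bij_betw_bits_val[of m'] that by (simp add: bij_betw_def inv_into_f_f)
  have inv': "inv_into (bitstr m') bits_val v \<in> bitstr m'" if "v < 2 ^ m'" for v
    using bij_betw_bits_val[of m'] that by (intro inv_into_into) (auto simp: bij_betw_def)
  have T': "contraction (2 ^ m' * ?d) T'"
    unfolding T'_def by (intro contraction_block_diag bl tk inv')
  then have T'c: "T' \<in> carrier_mat (2 ^ m' * ?d) (2 ^ m' * ?d)" by (rule contraction_carrier)
  have blT': "block ?d T' (bits_val z) = bl (take m z)" if "z \<in> bitstr m'" for z
  proof -
    have "bits_val z < 2 ^ m'" using bits_val_less[of z] that unfolding bitstr_def by simp
    then have "block ?d T' (bits_val z) = bl (take m (inv_into (bitstr m') bits_val (bits_val z)))"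
      unfolding T'_def by (rule block_block_diag) (rule blc)
    then show ?thesis unfolding inv[OF that] .
  qed
  define D' where "D' = ext_diff m' ?d (?X \<times> bitstr l) (\<lambda>(x, u). pmf p x / 2 ^ l) (\<lambda>(x, u). f x u) (\<lambda>(x, u). \<rho>' x) \<tau>"
  have D'h: "D' \<in> carrier_mat (2 ^ m' * ?d) (2 ^ m' * ?d)" "hermitian (2 ^ m' * ?d) (\<lambda>i j. D' $$ (i, j))"
    unfolding D'_def by (intro ext_diff_hermitian; use \<tau>h psd_hermitian[OF psd\<rho>'] in force)+
  have "trnorm D' \<le> \<epsilon>'"
    using ext p \<rho>' unfolding seeded_extractor_def D'_def ext_diff_prod \<tau>_eq by blast
  then have 2: "cmod (tr (T' * D')) \<le> 2 * \<epsilon>'" using contraction_tr_le_trnorm[OF D'h T'] by linarith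
  have 3: "tr (T' * D') = (\<Sum>s\<in>?X \<times> bitstr l. of_real (pmf p (fst s) / 2 ^ l) * tr (bl (take m (f (fst s) (snd s))) * \<rho>' (fst s)))
      - (\<Sum>z\<in>bitstr m'. tr (bl (take m z) * \<tau>)) / 2 ^ m'"
  proof -
    have "tr (T' * D') = (\<Sum>s\<in>?X \<times> bitstr l. of_real (pmf p (fst s) / 2 ^ l) * tr (block ?d T' (bits_val (f (fst s) (snd s))) * \<rho>' (fst s)))
      - (\<Sum>z\<in>bitstr m'. tr (block ?d T' (bits_val z) * \<tau>)) / 2 ^ m'"
      unfolding D'_def by (subst tr_ext_diff[OF T'c]) (use \<rho>'c \<tau>h f in \<open>auto simp: case_prod_beta\<close>)
    also have "(\<Sum>z\<in>bitstr m'. tr (block ?d T' (bits_val z) * \<tau>)) = (\<Sum>z\<in>bitstr m'. tr (bl (take m z) * \<tau>))"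
      by (intro sum.cong refl) (simp add: blT')
    also have "(\<Sum>s\<in>?X \<times> bitstr l. of_real (pmf p (fst s) / 2 ^ l) * tr (block ?d T' (bits_val (f (fst s) (snd s))) * \<rho>' (fst s)))
      = (\<Sum>s\<in>?X \<times> bitstr l. of_real (pmf p (fst s) / 2 ^ l) * tr (bl (take m (f (fst s) (snd s))) * \<rho>' (fst s)))"
      using f by (intro sum.cong refl) (auto simp: blT')
    finally show ?thesis .
  qed
  \<comment> \<open>Truncation maps uniform strings to uniform strings, so the ideal terms of the
    two differences agree and cancel.\<close>
  have 4: "(\<Sum>z\<in>bitstr m'. tr (bl (take m z) * \<tau>)) / 2 ^ m' = (\<Sum>z\<in>bitstr m. tr (bl z * \<tau>)) / 2 ^ m"
  proof -
    have "(2::complex) ^ m' = 2 ^ (m' - m) * 2 ^ m" using mm by (simp flip: power_add)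
    then show ?thesis by (simp add: sum_take_bitstr[OF mm, of "\<lambda>z. tr (bl z * \<tau>)"])
  qed
  \<comment> \<open>The contribution of the pair \<open>s\<close> if the seed is set to
    \<open>u\<close>: the value \<open>u = g x y\<close> gives the actual output, and the average
    over \<open>u\<close> gives the independent seed.\<close>
  define G where "G = (\<lambda>s u. of_real (pmf p (fst s) * pmf q (snd s)) * tr (bl (take m (f (fst s) u)) * \<rho> (fst s) (snd s)))"
  have 5: "(\<Sum>s\<in>?X \<times> bitstr l. of_real (pmf p (fst s) / 2 ^ l) * tr (bl (take m (f (fst s) (snd s))) * \<rho>' (fst s)))
      = (\<Sum>s\<in>?X \<times> ?X. \<Sum>u\<in>bitstr l. G s u) / 2 ^ l"
  proof -
    have "(\<Sum>s\<in>?X \<times> bitstr l. of_real (pmf p (fst s) / 2 ^ l) * tr (bl (take m (f (fst s) (snd s))) * \<rho>' (fst s)))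
        = (\<Sum>x\<in>?X. \<Sum>u\<in>bitstr l. of_real (pmf p x / 2 ^ l) * tr (bl (take m (f x u)) * \<rho>' x))"
      by (simp add: sum.cartesian_product case_prod_beta)
    also have "\<dots> = (\<Sum>x\<in>?X. \<Sum>u\<in>bitstr l. \<Sum>y\<in>?X. G (x, y) u / 2 ^ l)"
    proof (intro sum.cong refl)
      fix x u assume x: "x \<in> ?X"
      have "tr (bl (take m (f x u)) * \<rho>' x) = (\<Sum>y\<in>?X. tr (bl (take m (f x u)) * (complex_of_real (pmf q y) \<cdot>\<^sub>m \<rho> x y)))"
        unfolding \<rho>'_def by (intro tr_mult_matsum blc smult_carrier_mat \<rho>c x)
      also have "\<dots> = (\<Sum>y\<in>?X. of_real (pmf q y) * tr (bl (take m (f x u)) * \<rho> x y))"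
        by (intro sum.cong refl tr_mult_smult[OF blc \<rho>c[OF x]])
      finally show "of_real (pmf p x / 2 ^ l) * tr (bl (take m (f x u)) * \<rho>' x) = (\<Sum>y\<in>?X. G (x, y) u / 2 ^ l)"
        unfolding G_def by (simp add: sum_distrib_left mult_ac)
    qed
    also have "\<dots> = (\<Sum>x\<in>?X. \<Sum>y\<in>?X. \<Sum>u\<in>bitstr l. G (x, y) u / 2 ^ l)"
      by (intro sum.cong refl sum.swap)
    also have "\<dots> = (\<Sum>(x, y)\<in>?X \<times> ?X. \<Sum>u\<in>bitstr l. G (x, y) u / 2 ^ l)"
      by (rule sum.cartesian_product)
    also have "\<dots> = (\<Sum>s\<in>?X \<times> ?X. \<Sum>u\<in>bitstr l. G s u / 2 ^ l)"
      by (rule sum.cong[OF refl]) auto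
    also have "\<dots> = (\<Sum>s\<in>?X \<times> ?X. \<Sum>u\<in>bitstr l. G s u) / 2 ^ l"
      by (simp only: sum_divide_distrib)
    finally show ?thesis .
  qed
  have "tr (T * D) - tr (T' * D') = (\<Sum>s\<in>?X \<times> ?X. G s (g (fst s) (snd s))) - (\<Sum>s\<in>?X \<times> ?X. \<Sum>u\<in>bitstr l. G s u) / 2 ^ l"
    unfolding 1 3 4 5 unfolding G_def by simp
  also have "cmod \<dots> \<le> 2 ^ l * B"
  proof (rule xor_lemma[OF B])
    show "g (fst s) (snd s) \<in> bitstr l" if "s \<in> ?X \<times> ?X" for s using g that by auto
    fix u S assume u: "u \<in> bitstr l" and S: "S \<subseteq> {1..l}" "S \<noteq> {}"
    have "(\<Sum>s\<in>?X \<times> ?X. (\<Prod>i\<in>S. sgnb (g (fst s) (snd s) ! (i - 1))) * G s u)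
       = (\<Sum>x\<in>?X. \<Sum>y\<in>?X. (\<Prod>i\<in>S. sgnb (g x y ! (i - 1))) * of_real (pmf p x * pmf q y) * tr (bl (take m (f x u)) * \<rho> x y))"
      unfolding G_def by (simp add: sum.cartesian_product case_prod_beta mult.assoc)
    also have "cmod \<dots> \<le> B" by (intro bias S bl tk f u)
    finally show "cmod (\<Sum>s\<in>?X \<times> ?X. (\<Prod>i\<in>S. sgnb (g (fst s) (snd s) ! (i - 1))) * G s u) \<le> B" .
  qed
  finally have "cmod (tr (T * D) - tr (T' * D')) \<le> 2 ^ l * B" .
  then have "cmod (tr (T * D)) \<le> 2 * \<epsilon>' + 2 ^ l * B"
    using 2 norm_triangle_sub[of "tr (T * D)" "tr (T' * D')"] by linarith
  then have "2 * trnorm D \<le> 2 * \<epsilon>' + 2 ^ l * B"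
    unfolding TD norm_of_real by linarith
  then show ?thesis unfolding D_def \<tau>_def by simp
qed

section \<open>The parities of the DEOR construction\<close>

lemma length_E_D [simp]: "length (E_D A n l x y) = l"
  unfolding E_D_def by simp

lemma E_D_nth:
  "i \<in> {1..l} \<Longrightarrow> E_D A n l x y ! (i - 1) = scalar_prod (A n i *\<^sub>v vec_of_list x) (vec_of_list y)"
  unfolding E_D_def by (auto simp: nth_append simp del: upt_Suc)

lemma vec_of_list_bitstr: "x \<in> bitstr n \<Longrightarrow> vec_of_list x \<in> carrier_vec n"
  by (rule carrier_vecI) (simp add: bitstr_def)

lemma mult_mat_vec_sum:
  fixes B :: "'a::comm_semiring_0 mat"
  assumes "B \<in> carrier_mat m n" "v \<in> carrier_vec n" "i < m"
  shows "(B *\<^sub>v v) $ i = (\<Sum>j<n. B $$ (i, j) * v $ j)"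
  using assms by (auto simp: scalar_prod_def atLeast0LessThan)

lemma scalar_prod_sum:
  fixes u v :: "'a::comm_semiring_0 vec"
  assumes "v \<in> carrier_vec n"
  shows "scalar_prod u v = (\<Sum>i<n. u $ i * v $ i)"
  using assms by (auto simp: scalar_prod_def atLeast0LessThan)

lemma E_D_sign:
  assumes A: "\<And>i. i \<in> {1..n} \<Longrightarrow> A n i \<in> carrier_mat n n" and l: "l \<le> n" and S: "S \<subseteq> {1..l}"
    and x: "x \<in> bitstr n" and y: "y \<in> bitstr n"
  shows "(\<Prod>i\<in>S. sgnb (E_D A n l x y ! (i - 1))) = sgnb (\<Sum>c<n. (matsum n (A n) S *\<^sub>v vec_of_list x) $ c * y ! c)"
proof -
  have Ac: "A n i \<in> carrier_mat n n" if "i \<in> S" for i using A S l that by (intro A) auto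
  note xc = vec_of_list_bitstr[OF x] and yc = vec_of_list_bitstr[OF y]
  have "(\<Prod>i\<in>S. sgnb (E_D A n l x y ! (i - 1))) = sgnb (\<Sum>i\<in>S. \<Sum>c<n. (A n i *\<^sub>v vec_of_list x) $ c * y ! c)"
    unfolding sgnb_sum[of _ S]
  proof (rule prod.cong[OF refl], rule arg_cong[where f = sgnb])
    fix i assume "i \<in> S"
    then have "i \<in> {1..l}" using S by blast
    then show "E_D A n l x y ! (i - 1) = (\<Sum>c<n. (A n i *\<^sub>v vec_of_list x) $ c * y ! c)"
      by (simp only: E_D_nth scalar_prod_sum[OF yc] vec_of_list_index)
  qed
  also have "(\<Sum>i\<in>S. \<Sum>c<n. (A n i *\<^sub>v vec_of_list x) $ c * y ! c) = (\<Sum>c<n. \<Sum>i\<in>S. (A n i *\<^sub>v vec_of_list x) $ c * y ! c)"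
    by (rule sum.swap)
  also have "\<dots> = (\<Sum>c<n. (matsum n (A n) S *\<^sub>v vec_of_list x) $ c * y ! c)"
  proof (rule sum.cong[OF refl])
    fix c assume "c \<in> {..<n}"
    then have c: "c < n" by simp
    have "(matsum n (A n) S *\<^sub>v vec_of_list x) $ c = (\<Sum>j<n. \<Sum>i\<in>S. A n i $$ (c, j) * vec_of_list x $ j)"
      unfolding mult_mat_vec_sum[OF matsum_carrier xc c] sum_distrib_right[symmetric]
      by (rule sum.cong[OF refl], rule arg_cong2[where f = times, OF matsum_index refl]) (use c in simp_all)
    also have "\<dots> = (\<Sum>i\<in>S. \<Sum>j<n. A n i $$ (c, j) * vec_of_list x $ j)" by (rule sum.swap)
    also have "\<dots> = (\<Sum>i\<in>S. (A n i *\<^sub>v vec_of_list x) $ c)"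
      by (rule sum.cong[OF refl], rule mult_mat_vec_sum[OF Ac xc c, symmetric])
    finally show "(\<Sum>i\<in>S. (A n i *\<^sub>v vec_of_list x) $ c * y ! c) = (matsum n (A n) S *\<^sub>v vec_of_list x) $ c * y ! c"
      by (simp only: sum_distrib_right)
  qed
  finally show ?thesis .
qed

text \<open>Over GF(2) the product of the two signs is the sign that belongs to
  \<open>x + x'\<close>. For \<open>x \<noteq> x'\<close> this vector is nonzero, full rank keeps
  its image nonzero, and the sum of a nontrivial character vanishes.\<close>

lemma sign_orthogonal:
  fixes M :: "bit mat"
  assumes M: "M \<in> carrier_mat n n" and rank: "vec_space.rank n M = n"
    and x: "x \<in> bitstr n" and x': "x' \<in> bitstr n"
  shows "(\<Sum>y\<in>bitstr n. sgnb (\<Sum>c<n. (M *\<^sub>v vec_of_list x) $ c * y ! c) * cnj (sgnb (\<Sum>c<n. (M *\<^sub>v vec_of_list x') $ c * y ! c)))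
     = (if x = x' then of_real (2 ^ n) else 0)"
proof (cases "x = x'")
  case True
  have "(\<Sum>y\<in>bitstr n. sgnb (\<Sum>c<n. (M *\<^sub>v vec_of_list x) $ c * y ! c) * cnj (sgnb (\<Sum>c<n. (M *\<^sub>v vec_of_list x') $ c * y ! c)))
     = (\<Sum>y\<in>bitstr n. 1)" by (simp only: True sgnb_simps)
  also have "\<dots> = of_real (2 ^ n)" by (simp add: card_bitstr)
  finally show ?thesis by (simp only: True if_True refl)
next
  case False
  let ?v = "vec_of_list x + vec_of_list x'"
  have xc: "vec_of_list x \<in> carrier_vec n" "vec_of_list x' \<in> carrier_vec n"
    using vec_of_list_bitstr[OF x] vec_of_list_bitstr[OF x'] by blast+
  have len: "length x = n" "length x' = n" using x x' unfolding bitstr_def by auto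
  obtain j where j: "j < n" "x ! j \<noteq> x' ! j" using False len by (auto simp: list_eq_iff_nth_eq)
  have "?v $ j = vec_of_list x $ j + vec_of_list x' $ j"
    by (rule index_add_vec(1)) (use j len in simp)
  also have "\<dots> = x ! j + x' ! j" by (simp only: vec_of_list_index)
  also have "\<dots> = 1" using j(2) by (cases "x ! j"; cases "x' ! j") auto
  finally have vj: "?v $ j = 1" .
  have v0: "?v \<noteq> 0\<^sub>v n"
  proof
    assume v0: "?v = 0\<^sub>v n"
    have "?v $ j = 0" unfolding v0 using j(1) by simp
    then show False using vj by simp
  qed
  have vc: "?v \<in> carrier_vec n" using xc by (rule add_carrier_vec)
  have "det M \<noteq> 0" using vec_space.det_rank_iff[OF M] rank by blast
  then have Mv: "M *\<^sub>v ?v \<noteq> 0\<^sub>v n" using det_0_iff_vec_prod_zero_field[OF M] v0 vc by blast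
  have "\<exists>c<n. (M *\<^sub>v ?v) $ c \<noteq> 0"
  proof (rule ccontr)
    assume *: "\<not> ?thesis"
    have "M *\<^sub>v ?v = 0\<^sub>v n"
    proof (intro eq_vecI)
      fix c assume "c < dim_vec (0\<^sub>v n :: bit vec)"
      then have "c < n" by simp
      then show "(M *\<^sub>v ?v) $ c = (0\<^sub>v n) $ c" using * by (metis index_zero_vec(1))
    qed (use M in simp)
    then show False using Mv by blast
  qed
  then obtain c where c: "c < n" "(M *\<^sub>v ?v) $ c \<noteq> 0" by blast
  have w: "(M *\<^sub>v ?v) $ i = (M *\<^sub>v vec_of_list x) $ i + (M *\<^sub>v vec_of_list x') $ i" if "i < n" for i
    unfolding mult_add_distrib_mat_vec[OF M xc] using M that by (intro index_add_vec(1)) simp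
  have wy: "(\<Sum>c<n. (M *\<^sub>v ?v) $ c * y ! c)
      = (\<Sum>c<n. (M *\<^sub>v vec_of_list x) $ c * y ! c) + (\<Sum>c<n. (M *\<^sub>v vec_of_list x') $ c * y ! c)" for y :: bits
    unfolding sum.distrib[symmetric] by (rule sum.cong[OF refl]) (simp only: w lessThan_iff distrib_right)
  have "(\<Sum>y\<in>bitstr n. sgnb (\<Sum>c<n. (M *\<^sub>v vec_of_list x) $ c * y ! c) * cnj (sgnb (\<Sum>c<n. (M *\<^sub>v vec_of_list x') $ c * y ! c)))
     = (\<Sum>y\<in>bitstr n. sgnb (\<Sum>c<n. (M *\<^sub>v ?v) $ c * y ! c))"
    by (simp only: wy sgnb_add sgnb_simps)
  also have "\<dots> = 0"
  proof (rule sum_sgnb_eq_0[OF c(1)])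
    show "(M *\<^sub>v ?v) $ c = 1" using c(2) by (cases "(M *\<^sub>v ?v) $ c") blast+
  qed
  finally show ?thesis by (simp only: False if_False)
qed

text \<open>The exponent collects half of \<open>n\<close> from the row norm of the sign matrix,
  minus half of each min-entropy from the collision probabilities, plus the stored qubits of the
  party whose source the test does not see.\<close>

lemma deor_bias:
  assumes A: "deor_matrices A" and l: "l \<le> n" and p: "source n k1 p" and q: "source n k2 q"
    and st: "entangled_storage n b1 b2 \<rho>"
    and S: "S \<subseteq> {1..l}" "S \<noteq> {}" and T: "\<And>x. x \<in> bitstr n \<Longrightarrow> contraction (2 ^ (b1 + b2)) (T x)"
  shows "cmod (\<Sum>x\<in>bitstr n. \<Sum>y\<in>bitstr n. (\<Prod>i\<in>S. sgnb (E_D A n l x y ! (i - 1))) * of_real (pmf p x * pmf q y) * tr (T x * \<rho> x y))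
      \<le> 2 powr ((real n - k1 - k2) / 2 + real b2)" (is ?left)
    and "cmod (\<Sum>x\<in>bitstr n. \<Sum>y\<in>bitstr n. (\<Prod>i\<in>S. sgnb (E_D A n l x y ! (i - 1))) * of_real (pmf p x * pmf q y) * tr (T y * \<rho> x y))
      \<le> 2 powr ((real n - k1 - k2) / 2 + real b1)" (is ?right)
proof -
  obtain D1 D2 N s I F J G where sm: "storage_model (2 ^ b1) (2 ^ b2) (bitstr n) \<rho> D1 D2 N s I F J G"
    using entangled_storage_model[OF st] by (elim exE)
  have Ac: "A n i \<in> carrier_mat n n" if "i \<in> {1..n}" for i using A that unfolding deor_matrices_def by blast
  have "S \<subseteq> {1..n}" using S(1) l by auto
  then have rank: "vec_space.rank n (matsum n (A n) S) = n" using A S(2) unfolding deor_matrices_def by blast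
  have orth: "(\<Sum>y\<in>bitstr n. (\<Prod>i\<in>S. sgnb (E_D A n l x y ! (i - 1))) * cnj (\<Prod>i\<in>S. sgnb (E_D A n l x' y ! (i - 1))))
     = (if x = x' then of_real (2 ^ n) else 0)" if xx: "x \<in> bitstr n" "x' \<in> bitstr n" for x x'
  proof -
    have "(\<Sum>y\<in>bitstr n. (\<Prod>i\<in>S. sgnb (E_D A n l x y ! (i - 1))) * cnj (\<Prod>i\<in>S. sgnb (E_D A n l x' y ! (i - 1))))
      = (\<Sum>y\<in>bitstr n. sgnb (\<Sum>c<n. (matsum n (A n) S *\<^sub>v vec_of_list x) $ c * y ! c)
          * cnj (sgnb (\<Sum>c<n. (matsum n (A n) S *\<^sub>v vec_of_list x') $ c * y ! c)))"
      using E_D_sign[where A = A, OF Ac l S(1) xx(1)] E_D_sign[where A = A, OF Ac l S(1) xx(2)]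
      by (intro sum.cong refl) (simp only:)
    also have "\<dots> = (if x = x' then of_real (2 ^ n) else 0)"
      by (rule sign_orthogonal[OF matsum_carrier rank xx])
    finally show ?thesis .
  qed
  have d: "(2::nat) ^ (b1 + b2) = 2 ^ b1 * 2 ^ b2" by (simp add: power_add)
  have T': "contraction (2 ^ b1 * 2 ^ b2) (T x)" if "x \<in> bitstr n" for x using T[OF that] unfolding d .
  have M: "(2::real) ^ n \<ge> 0" by simp
  have "(2::real) ^ n * 2 powr (- k1) * 2 powr (- k2) = (2 powr ((real n - k1 - k2) / 2))\<^sup>2"
    by (simp add: powr_realpow[symmetric] powr_add[symmetric] power2_eq_square)
  then have sq: "sqrt ((2::real) ^ n * 2 powr (- k1) * 2 powr (- k2)) * real (2 ^ b) = 2 powr ((real n - k1 - k2) / 2 + real b)" for b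
    by (simp add: powr_add powr_realpow)
  show ?left
    using storage_bias(1)[OF sm finite_bitstr M orth sum_source_sq_le[OF p finite_bitstr] sum_source_sq_le[OF q finite_bitstr] T']
    unfolding sq .
  show ?right
    using storage_bias(2)[OF sm finite_bitstr M orth sum_source_sq_le[OF p finite_bitstr] sum_source_sq_le[OF q finite_bitstr] T']
    unfolding sq .
qed

text \<open>It allows the min-entropy to be rounded down to the integral parameter of the seeded
  extractor.\<close>

lemma source_mono: "source n k p \<Longrightarrow> k' \<le> k \<Longrightarrow> source n k' p"
  unfolding source_def by (meson neg_le_iff_le one_le_numeral order.trans powr_mono)

lemma entangled_storage_density:
  assumes "entangled_storage n b1 b2 \<rho>" "x \<in> bitstr n" "y \<in> bitstr n"
  shows "density (2 ^ (b1 + b2)) (\<rho> x y)"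
proof -
  obtain D1 D2 N s I F J G where sm: "storage_model (2 ^ b1) (2 ^ b2) (bitstr n) \<rho> D1 D2 N s I F J G"
    using entangled_storage_model[OF assms(1)] by blast
  show ?thesis
    using gram_psd[OF storage_gram_form[OF sm assms(2,3)]] storage_tr[OF sm assms(2,3)]
    unfolding density_def by (simp add: power_add)
qed

lemma matsum_swap:
  "matsum d (\<lambda>(x, y). f x y) (X \<times> Y) = matsum d (\<lambda>(y, x). f x y) (Y \<times> X)"
  unfolding matsum_def
  by (rule cong_mat) (auto intro!: sum.reindex_bij_witness[where i = "\<lambda>(x, y). (y, x)" and j = "\<lambda>(x, y). (y, x)"])

lemma deor_left_extractor:
  assumes A: "deor_matrices A" and l: "l \<le> n" and k: "k \<le> k1" and mm: "m \<le> m'"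
    and ext: "seeded_extractor n l m' k \<epsilon>' (b1 + b2) f"
    and \<epsilon>: "\<epsilon>' + 2 ^ l * 2 powr ((real n - k1 - k2) / 2 + real b2) / 2 \<le> \<epsilon>"
  shows "two_source_extractor n m k1 k2 \<epsilon> b1 b2 (\<lambda>x y. take m (f x (E_D A n l x y)))"
  unfolding two_source_extractor_def
proof (intro conjI ballI allI impI)
  fix x y assume "x \<in> bitstr n" "y \<in> bitstr n"
  then have "f x (E_D A n l x y) \<in> bitstr m'" using ext unfolding seeded_extractor_def by (simp add: bitstr_def)
  then show "take m (f x (E_D A n l x y)) \<in> bitstr m" using mm unfolding bitstr_def by simp
next
  fix p q \<rho> assume "source n k1 p \<and> source n k2 q \<and> entangled_storage n b1 b2 \<rho>"
  then have p: "source n k1 p" and q: "source n k2 q" and st: "entangled_storage n b1 b2 \<rho>" by auto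
  have qs: "set_pmf q \<subseteq> bitstr n" using q unfolding source_def by blast
  have "trnorm (ext_diff m (2 ^ (b1 + b2)) (bitstr n \<times> bitstr n) (\<lambda>(x, y). pmf p x * pmf q y)
      (\<lambda>(x, y). take m (f x (E_D A n l x y))) (\<lambda>(x, y). \<rho> x y)
      (matsum (2 ^ (b1 + b2)) (\<lambda>(x, y). complex_of_real (pmf p x * pmf q y) \<cdot>\<^sub>m \<rho> x y) (bitstr n \<times> bitstr n)))
    \<le> \<epsilon>' + 2 ^ l * 2 powr ((real n - k1 - k2) / 2 + real b2) / 2"
  proof (rule composed_extractor_bound[OF ext source_mono[OF p k] qs entangled_storage_density[OF st] _ mm])
    fix T S assume S: "S \<subseteq> {1..l}" "S \<noteq> {}" and T: "\<And>x. x \<in> bitstr n \<Longrightarrow> contraction (2 ^ (b1 + b2)) (T x)"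
    show "cmod (\<Sum>x\<in>bitstr n. \<Sum>y\<in>bitstr n. (\<Prod>i\<in>S. sgnb (E_D A n l x y ! (i - 1))) * of_real (pmf p x * pmf q y) * tr (T x * \<rho> x y))
      \<le> 2 powr ((real n - k1 - k2) / 2 + real b2)"
      by (rule deor_bias(1)[OF A l p q st S T])
  qed (auto simp: bitstr_def)
  then show "trnorm (matsum (2 ^ m * 2 ^ (b1 + b2))
           (\<lambda>(x, y). complex_of_real (pmf p x * pmf q y) \<cdot>\<^sub>m kron (ketbra m (take m (f x (E_D A n l x y)))) (\<rho> x y))
           (bitstr n \<times> bitstr n)
         - kron (unif m)
           (matsum (2 ^ (b1 + b2)) (\<lambda>(x, y). complex_of_real (pmf p x * pmf q y) \<cdot>\<^sub>m \<rho> x y) (bitstr n \<times> bitstr n))) \<le> \<epsilon>"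
    using \<epsilon> unfolding ext_diff_prod by linarith
qed

text \<open>\<open>E_D\<close> stays as it is; only the source read by the seeded extractor and the
  test change sides. All sums are therefore reordered with \<open>y\<close> first, to fit
  \<open>composed_extractor_bound\<close>.\<close>

lemma deor_right_extractor:
  assumes A: "deor_matrices A" and l: "l \<le> n" and k: "k \<le> k2" and mm: "m \<le> m'"
    and ext: "seeded_extractor n l m' k \<epsilon>' (b1 + b2) f"
    and \<epsilon>: "\<epsilon>' + 2 ^ l * 2 powr ((real n - k1 - k2) / 2 + real b1) / 2 \<le> \<epsilon>"
  shows "two_source_extractor n m k1 k2 \<epsilon> b1 b2 (\<lambda>x y. take m (f y (E_D A n l x y)))"
  unfolding two_source_extractor_def
proof (intro conjI ballI allI impI)
  fix x y assume "x \<in> bitstr n" "y \<in> bitstr n"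
  then have "f y (E_D A n l x y) \<in> bitstr m'" using ext unfolding seeded_extractor_def by (simp add: bitstr_def)
  then show "take m (f y (E_D A n l x y)) \<in> bitstr m" using mm unfolding bitstr_def by simp
next
  fix p q \<rho> assume "source n k1 p \<and> source n k2 q \<and> entangled_storage n b1 b2 \<rho>"
  then have p: "source n k1 p" and q: "source n k2 q" and st: "entangled_storage n b1 b2 \<rho>" by auto
  have ps: "set_pmf p \<subseteq> bitstr n" using p unfolding source_def by blast
  have "trnorm (ext_diff m (2 ^ (b1 + b2)) (bitstr n \<times> bitstr n) (\<lambda>(y, x). pmf q y * pmf p x)
      (\<lambda>(y, x). take m (f y (E_D A n l x y))) (\<lambda>(y, x). \<rho> x y)
      (matsum (2 ^ (b1 + b2)) (\<lambda>(y, x). complex_of_real (pmf q y * pmf p x) \<cdot>\<^sub>m \<rho> x y) (bitstr n \<times> bitstr n)))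
    \<le> \<epsilon>' + 2 ^ l * 2 powr ((real n - k1 - k2) / 2 + real b1) / 2"
  proof (rule composed_extractor_bound[OF ext source_mono[OF q k] ps entangled_storage_density[OF st] _ mm])
    fix T S assume S: "S \<subseteq> {1..l}" "S \<noteq> {}" and T: "\<And>x. x \<in> bitstr n \<Longrightarrow> contraction (2 ^ (b1 + b2)) (T x)"
    have "(\<Sum>y\<in>bitstr n. \<Sum>x\<in>bitstr n. (\<Prod>i\<in>S. sgnb (E_D A n l x y ! (i - 1))) * of_real (pmf q y * pmf p x) * tr (T y * \<rho> x y))
      = (\<Sum>x\<in>bitstr n. \<Sum>y\<in>bitstr n. (\<Prod>i\<in>S. sgnb (E_D A n l x y ! (i - 1))) * of_real (pmf p x * pmf q y) * tr (T y * \<rho> x y))"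
      by (subst sum.swap) (simp add: mult.commute)
    then show "cmod (\<Sum>y\<in>bitstr n. \<Sum>x\<in>bitstr n. (\<Prod>i\<in>S. sgnb (E_D A n l x y ! (i - 1))) * of_real (pmf q y * pmf p x) * tr (T y * \<rho> x y))
      \<le> 2 powr ((real n - k1 - k2) / 2 + real b1)"
      using deor_bias(2)[OF A l p q st S T] by simp
  qed (auto simp: bitstr_def)
  moreover have "matsum d (\<lambda>(x, y). complex_of_real (pmf p x * pmf q y) \<cdot>\<^sub>m h x y) (bitstr n \<times> bitstr n)
      = matsum d (\<lambda>(y, x). complex_of_real (pmf q y * pmf p x) \<cdot>\<^sub>m h x y) (bitstr n \<times> bitstr n)" for d h
    by (subst matsum_swap) (simp only: mult.commute[of "pmf p _"])
  ultimately show "trnorm (matsum (2 ^ m * 2 ^ (b1 + b2))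
           (\<lambda>(x, y). complex_of_real (pmf p x * pmf q y) \<cdot>\<^sub>m kron (ketbra m (take m (f y (E_D A n l x y)))) (\<rho> x y))
           (bitstr n \<times> bitstr n)
         - kron (unif m)
           (matsum (2 ^ (b1 + b2)) (\<lambda>(x, y). complex_of_real (pmf p x * pmf q y) \<cdot>\<^sub>m \<rho> x y) (bitstr n \<times> bitstr n))) \<le> \<epsilon>"
    using \<epsilon> unfolding ext_diff_prod by (simp only:)
qed

subsection \<open>A polynomial-time program\<close>

text \<open>An upper bound on the time, unlike the exact time in \<open>exec\<close>, can be shared
  by branches of different cost.\<close>

definition runs :: "prog \<Rightarrow> state \<Rightarrow> state \<Rightarrow> nat \<Rightarrow> bool" where
  "runs p \<sigma> \<sigma>' T \<longleftrightarrow> (\<exists>t\<le>T. exec p \<sigma> t \<sigma>')"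

lemma runs_mono: "runs p \<sigma> \<sigma>' T \<Longrightarrow> T \<le> T' \<Longrightarrow> runs p \<sigma> \<sigma>' T'"
  unfolding runs_def by (meson order.trans)

lemma runs_Push: "\<sigma>' = \<sigma>(r := a # \<sigma> r) \<Longrightarrow> runs (Push r a) \<sigma> \<sigma>' 1"
  unfolding runs_def using exec_Push by blast

lemma runs_Pop: "\<sigma>' = \<sigma>(r := tl (\<sigma> r)) \<Longrightarrow> runs (Pop r) \<sigma> \<sigma>' 1"
  unfolding runs_def using exec_Pop by blast

lemma runs_Seq: "runs p \<sigma> \<sigma>' T \<Longrightarrow> runs q \<sigma>' \<sigma>'' T' \<Longrightarrow> runs (Seq p q) \<sigma> \<sigma>'' (T + T')"
  unfolding runs_def by (meson add_mono exec_Seq)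

lemma runs_IfOne:
  assumes "\<And>w. \<sigma> r = 1 # w \<Longrightarrow> runs p \<sigma> \<sigma>' T" "(\<And>w. \<sigma> r \<noteq> 1 # w) \<Longrightarrow> runs q \<sigma> \<sigma>' T"
  shows "runs (IfOne r p q) \<sigma> \<sigma>' (T + 1)"
proof (cases "\<exists>w. \<sigma> r = 1 # w")
  case True
  then obtain w t where "\<sigma> r = 1 # w" "t \<le> T" "exec p \<sigma> t \<sigma>'" using assms(1) unfolding runs_def by blast
  then have "exec (IfOne r p q) \<sigma> (t + 1) \<sigma>'" by (intro exec_IfOne)
  moreover have "t + 1 \<le> T + 1" using \<open>t \<le> T\<close> by simp
  ultimately show ?thesis unfolding runs_def by blast
next
  case False
  then obtain t where "t \<le> T" "exec q \<sigma> t \<sigma>'" using assms(2) unfolding runs_def by blast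
  then have "exec (IfOne r p q) \<sigma> (t + 1) \<sigma>'" using False by (intro exec_IfNotOne) auto
  moreover have "t + 1 \<le> T + 1" using \<open>t \<le> T\<close> by simp
  ultimately show ?thesis unfolding runs_def by blast
qed

text \<open>\<open>S j\<close> is the state before round \<open>j\<close>; the added 1s pay for the
  tests, including the final one.\<close>

lemma runs_While:
  assumes "\<And>j. j < N \<Longrightarrow> S j r \<noteq> []" "\<And>j. j < N \<Longrightarrow> runs p (S j) (S (Suc j)) T" "S N r = []"
  shows "runs (WhileNonempty r p) (S 0) (S N) (N * (T + 1) + 1)"
  using assms
proof (induction N arbitrary: S)
  case 0
  then show ?case unfolding runs_def using exec_WhileEmpty by force
next
  case (Suc N)
  have "runs (WhileNonempty r p) (S (Suc 0)) (S (Suc N)) (N * (T + 1) + 1)"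
    using Suc.IH[of "\<lambda>j. S (Suc j)"] Suc.prems by simp
  then obtain t' where t': "t' \<le> N * (T + 1) + 1" "exec (WhileNonempty r p) (S (Suc 0)) t' (S (Suc N))"
    unfolding runs_def by blast
  obtain t where t: "t \<le> T" "exec p (S 0) t (S (Suc 0))" using Suc.prems(2)[of 0] unfolding runs_def by blast
  have "exec (WhileNonempty r p) (S 0) (t + t' + 1) (S (Suc N))"
    using Suc.prems(1)[of 0] t(2) t'(2) by (intro exec_WhileNonempty) auto
  moreover have "t + t' + 1 \<le> Suc N * (T + 1) + 1" using t(1) t'(1) by simp
  ultimately show ?case unfolding runs_def by blast
qed

section \<open>Relocating and calling subprograms\<close>

lemma exec_length: "exec p \<sigma> t \<sigma>' \<Longrightarrow> length (\<sigma>' r) \<le> length (\<sigma> r) + t"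
  by (induction rule: exec.induct) auto

text \<open>An exclusive bound on the registers mentioned; it delimits what has to be cleared after
  a call.\<close>

primrec prog_bound :: "prog \<Rightarrow> nat" where
  "prog_bound (Push r a) = Suc r"
| "prog_bound (Pop r) = Suc r"
| "prog_bound (Seq p q) = max (prog_bound p) (prog_bound q)"
| "prog_bound (IfOne r p q) = max (Suc r) (max (prog_bound p) (prog_bound q))"
| "prog_bound (WhileNonempty r p) = max (Suc r) (prog_bound p)"

lemma exec_frame: "exec p \<sigma> t \<sigma>' \<Longrightarrow> prog_bound p \<le> r \<Longrightarrow> \<sigma>' r = \<sigma> r"
  by (induction rule: exec.induct) auto

text \<open>Subprograms share one global register file with their caller; relocation above
  \<open>K\<close> protects the caller's registers.\<close>

primrec shift :: "nat \<Rightarrow> prog \<Rightarrow> prog" where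
  "shift K (Push r a) = Push (K + r) a"
| "shift K (Pop r) = Pop (K + r)"
| "shift K (Seq p q) = Seq (shift K p) (shift K q)"
| "shift K (IfOne r p q) = IfOne (K + r) (shift K p) (shift K q)"
| "shift K (WhileNonempty r p) = WhileNonempty (K + r) (shift K p)"

definition comb :: "nat \<Rightarrow> state \<Rightarrow> state \<Rightarrow> state" where
  "comb K \<tau> \<sigma> = (\<lambda>r. if r < K then \<tau> r else \<sigma> (r - K))"

lemma comb_at [simp]: "comb K \<tau> \<sigma> (K + r) = \<sigma> r"
  unfolding comb_def by simp

lemma comb_upd: "comb K \<tau> (\<sigma>(r := v)) = (comb K \<tau> \<sigma>)(K + r := v)"
  unfolding comb_def by (auto simp: fun_eq_iff)

lemma exec_shift: "exec p \<sigma> t \<sigma>' \<Longrightarrow> exec (shift K p) (comb K \<tau> \<sigma>) t (comb K \<tau> \<sigma>')"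
proof (induction rule: exec.induct)
  case (exec_Push r a \<sigma>)
  show ?case unfolding shift.simps comb_upd
    using exec.exec_Push[of "K + r" a "comb K \<tau> \<sigma>"] unfolding comb_at .
next
  case (exec_Pop r \<sigma>)
  show ?case unfolding shift.simps comb_upd
    using exec.exec_Pop[of "K + r" "comb K \<tau> \<sigma>"] unfolding comb_at .
next
  case (exec_Seq p \<sigma> t \<sigma>' q t' \<sigma>'')
  show ?case unfolding shift.simps by (rule exec.exec_Seq[OF exec_Seq.IH])
next
  case (exec_IfOne \<sigma> r w p t \<sigma>' q)
  have "comb K \<tau> \<sigma> (K + r) = 1 # w" using exec_IfOne.hyps by simp
  then show ?case unfolding shift.simps by (rule exec.exec_IfOne[OF _ exec_IfOne.IH])
next
  case (exec_IfNotOne \<sigma> r q t \<sigma>' p)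
  have "\<forall>w. comb K \<tau> \<sigma> (K + r) \<noteq> 1 # w" using exec_IfNotOne.hyps by simp
  then show ?case unfolding shift.simps by (rule exec.exec_IfNotOne[OF _ exec_IfNotOne.IH])
next
  case (exec_WhileEmpty \<sigma> r p)
  show ?case using exec.exec_WhileEmpty[of "comb K \<tau> \<sigma>" "K + r" "shift K p"] exec_WhileEmpty by simp
next
  case (exec_WhileNonempty \<sigma> r p t \<sigma>' t' \<sigma>'')
  show ?case using exec.exec_WhileNonempty[of "comb K \<tau> \<sigma>" "K + r" "shift K p"] exec_WhileNonempty by simp
qed

definition clear :: "nat \<Rightarrow> prog" where
  "clear r = WhileNonempty r (Pop r)"

lemma runs_clear: "length (\<sigma> r) \<le> B \<Longrightarrow> runs (clear r) \<sigma> (\<sigma>(r := [])) (2 * B + 1)"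
proof -
  assume B: "length (\<sigma> r) \<le> B"
  have "runs (clear r) (\<sigma>(r := drop 0 (\<sigma> r))) (\<sigma>(r := drop (length (\<sigma> r)) (\<sigma> r))) (length (\<sigma> r) * (1 + 1) + 1)"
    unfolding clear_def
  proof (rule runs_While[where S = "\<lambda>j. \<sigma>(r := drop j (\<sigma> r))"])
    show "runs (Pop r) (\<sigma>(r := drop j (\<sigma> r))) (\<sigma>(r := drop (Suc j) (\<sigma> r))) 1" for j
      by (rule runs_Pop) (simp add: tl_drop drop_Suc)
  qed simp_all
  moreover have "length (\<sigma> r) * (1 + 1) + 1 \<le> 2 * B + 1" using B by simp
  ultimately have "runs (clear r) (\<sigma>(r := drop 0 (\<sigma> r))) (\<sigma>(r := drop (length (\<sigma> r)) (\<sigma> r))) (2 * B + 1)"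
    by (rule runs_mono)
  then show ?thesis by simp
qed

text \<open>There is no empty program, so a bit is pushed and popped again.\<close>

definition skip :: prog where
  "skip = Seq (Push 0 0) (Pop 0)"

lemma runs_skip: "runs skip \<sigma> \<sigma> 2"
proof -
  have "runs (Seq (Push 0 0) (Pop 0)) \<sigma> \<sigma> (1 + 1)"
    by (rule runs_Seq[OF runs_Push[OF refl] runs_Pop]) simp
  then show ?thesis unfolding skip_def one_add_one .
qed

primrec clears :: "nat list \<Rightarrow> prog" where
  "clears [] = skip"
| "clears (r # rs) = Seq (clear r) (clears rs)"

lemma runs_clears:
  "(\<And>r. length (\<sigma> r) \<le> B) \<Longrightarrow>
     runs (clears rs) \<sigma> (\<lambda>r. if r \<in> set rs then [] else \<sigma> r) (length rs * (2 * B + 1) + 2)"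
proof (induction rs arbitrary: \<sigma>)
  case Nil
  have "(\<lambda>r. if r \<in> set [] then [] else \<sigma> r) = \<sigma>" by simp
  then show ?case unfolding clears.simps by (simp only:) (rule runs_mono[OF runs_skip], simp)
next
  case (Cons r rs)
  have "runs (clears rs) (\<sigma>(r := [])) (\<lambda>r'. if r' \<in> set rs then [] else (\<sigma>(r := [])) r') (length rs * (2 * B + 1) + 2)"
    using Cons.prems by (intro Cons.IH) auto
  moreover have "(\<lambda>r'. if r' \<in> set rs then [] else (\<sigma>(r := [])) r') = (\<lambda>r'. if r' \<in> set (r # rs) then [] else \<sigma> r')"
    by (auto simp: fun_eq_iff)
  ultimately have IH: "runs (clears rs) (\<sigma>(r := [])) (\<lambda>r'. if r' \<in> set (r # rs) then [] else \<sigma> r') (length rs * (2 * B + 1) + 2)"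
    by (simp only:)
  from runs_Seq[OF runs_clear[where B = B] IH] show ?case
    unfolding clears.simps by (rule runs_mono) (use Cons.prems in simp_all)
qed

section \<open>Register contents as lists, and moving words between registers\<close>

definition mst :: "bits list \<Rightarrow> state" where
  "mst xs = (\<lambda>r. if r < length xs then xs ! r else [])"

lemma mst_nth [simp]: "r < length xs \<Longrightarrow> mst xs r = xs ! r"
  unfolding mst_def by simp

lemma mst_ge [simp]: "length xs \<le> r \<Longrightarrow> mst xs r = []"
  unfolding mst_def by simp

lemma mst_upd: "r < length xs \<Longrightarrow> (mst xs)(r := v) = mst (xs[r := v])"
  unfolding mst_def by (auto simp: fun_eq_iff nth_list_update)

lemma mst_upd_new: "r = length xs \<Longrightarrow> (mst xs)(r := v) = mst (xs @ [v])"
  unfolding mst_def by (auto simp: fun_eq_iff nth_append)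

lemma mst_trailing_Nil: "mst (xs @ [[]]) = mst xs"
  unfolding mst_def by (auto simp: fun_eq_iff nth_append)

lemma mst_append_Nils: "mst (xs @ replicate k []) = mst xs"
  unfolding mst_def by (auto simp: fun_eq_iff nth_append)

lemma comb_mst: "length xs = K \<Longrightarrow> comb K (mst xs) (mst ys) = mst (xs @ ys)"
  unfolding comb_def mst_def by (auto simp: fun_eq_iff nth_append)

lemma computes_runs: "computes p ins out T \<longleftrightarrow> (\<exists>\<sigma>. runs p (mst ins) \<sigma> T \<and> \<sigma> 0 = out)"
  unfolding computes_def runs_def mst_def by auto

text \<open>A subprogram may leave anything in its registers. Clearing all of them except its output
  register gives a state that is known exactly again.\<close>

definition call :: "nat \<Rightarrow> prog \<Rightarrow> nat \<Rightarrow> prog" where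
  "call K p N = Seq (shift K p) (clears [Suc K..<K + N])"

text \<open>After the call, only the output register of the subprogram is nonempty above \<open>K\<close>.\<close>

lemma runs_call:
  assumes c: "computes p ins out T" and N: "length ins \<le> N" "prog_bound p \<le> N"
    and B: "\<And>w. w \<in> set ins \<Longrightarrow> length w \<le> B" and xs: "length xs = K" "\<And>w. w \<in> set xs \<Longrightarrow> length w \<le> B"
  shows "runs (call K p N) (mst (xs @ ins)) (mst (xs @ [out])) (T + (N * (2 * (B + T) + 1) + 2))"
proof -
  obtain \<sigma> t where t: "t \<le> T" "exec p (mst ins) t \<sigma>" and out: "\<sigma> 0 = out"
    using c unfolding computes_runs runs_def by blast
  have 1: "runs (shift K p) (mst (xs @ ins)) (comb K (mst xs) \<sigma>) T"
    using exec_shift[OF t(2), of K "mst xs"] t(1) unfolding comb_mst[OF xs(1)] runs_def by blast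
  have len: "length (comb K (mst xs) \<sigma> r) \<le> B + T" for r
  proof (cases "r < K")
    case True
    then show ?thesis using xs unfolding comb_def by (simp add: trans_le_add1)
  next
    case False
    have "length (mst ins (r - K)) \<le> B" unfolding mst_def using B by auto
    then show ?thesis using exec_length[OF t(2), of "r - K"] t(1) False unfolding comb_def by simp
  qed
  have "(\<lambda>r. if r \<in> set [Suc K..<K + N] then [] else comb K (mst xs) \<sigma> r) = mst (xs @ [out])"
  proof
    fix r
    consider "r < K" | "r = K" | "K < r" "r < K + N" | "K + N \<le> r" "K < r" by linarith
    then show "(if r \<in> set [Suc K..<K + N] then [] else comb K (mst xs) \<sigma> r) = mst (xs @ [out]) r"
    proof cases
      \<comment> \<open>These registers lie beyond the program's bound and beyond its inputs, so
        they were empty and stay so.\<close>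
      case 4
      then have "\<sigma> (r - K) = mst ins (r - K)" using N by (intro exec_frame[OF t(2)]) linarith
      also have "\<dots> = []"
      proof -
        have "\<not> r - K < length ins" using 4 N by linarith
        then show ?thesis unfolding mst_def by simp
      qed
      finally show ?thesis using 4 xs(1) unfolding comb_def mst_def by simp
    qed (use xs(1) out in \<open>auto simp: comb_def mst_def nth_append\<close>)
  qed
  then have "runs (clears [Suc K..<K + N]) (comb K (mst xs) \<sigma>) (mst (xs @ [out]))
      (length [Suc K..<K + N] * (2 * (B + T) + 1) + 2)"
    using runs_clears[of "comb K (mst xs) \<sigma>" "B + T" "[Suc K..<K + N]", OF len] by simp
  then have "runs (clears [Suc K..<K + N]) (comb K (mst xs) \<sigma>) (mst (xs @ [out])) (N * (2 * (B + T) + 1) + 2)"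
    by (rule runs_mono, intro add_right_mono mult_right_mono) simp_all
  from runs_Seq[OF 1 this] show ?thesis unfolding call_def by (simp add: add.assoc)
qed

text \<open>Moving a stack bit by bit reverses it.\<close>

definition move :: "nat \<Rightarrow> nat \<Rightarrow> prog" where
  "move r d = WhileNonempty r (Seq (IfOne r (Push d 1) (Push d 0)) (Pop r))"

definition move2 :: "nat \<Rightarrow> nat \<Rightarrow> nat \<Rightarrow> prog" where
  "move2 r d e = WhileNonempty r (Seq (IfOne r (Seq (Push d 1) (Push e 1)) (Seq (Push d 0) (Push e 0))) (Pop r))"

lemma rev_take_Suc: "j < length w \<Longrightarrow> rev (take (Suc j) w) = w ! j # rev (take j w)"
  by (simp add: take_Suc_conv_app_nth)

lemma drop_head: "j < length w \<Longrightarrow> drop j w = w ! j # drop (Suc j) w"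
  by (simp add: Cons_nth_drop_Suc)

lemma runs_move:
  assumes "r \<noteq> d"
  shows "runs (move r d) \<sigma> (\<sigma>(r := [], d := rev (\<sigma> r) @ \<sigma> d)) (4 * length (\<sigma> r) + 1)"
proof -
  define w where "w = \<sigma> r"
  define S where "S = (\<lambda>j. \<sigma>(r := drop j w, d := rev (take j w) @ \<sigma> d))"
  have "runs (move r d) (S 0) (S (length w)) (length w * ((1 + 1 + 1) + 1) + 1)"
    unfolding move_def
  proof (rule runs_While)
    fix j assume j: "j < length w"
    show "S j r \<noteq> []" using j assms unfolding S_def by simp
    have "runs (IfOne r (Push d 1) (Push d 0)) (S j) ((S j)(d := w ! j # S j d)) (1 + 1)"
      using j assms by (intro runs_IfOne runs_Push) (cases "w ! j"; auto simp: S_def drop_head)+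
    moreover have "runs (Pop r) ((S j)(d := w ! j # S j d)) (S (Suc j)) 1"
      using j assms by (intro runs_Pop) (auto simp: S_def fun_eq_iff rev_take_Suc tl_drop drop_Suc)
    ultimately show "runs (Seq (IfOne r (Push d 1) (Push d 0)) (Pop r)) (S j) (S (Suc j)) (1 + 1 + 1)"
      by (rule runs_Seq)
  qed (use assms in \<open>simp add: S_def\<close>)
  moreover have "S 0 = \<sigma>" "S (length w) = \<sigma>(r := [], d := rev (\<sigma> r) @ \<sigma> d)" unfolding S_def w_def by auto
  ultimately show ?thesis unfolding w_def by (auto elim: runs_mono)
qed

lemma runs_move2:
  assumes "r \<noteq> d" "r \<noteq> e" "d \<noteq> e"
  shows "runs (move2 r d e) \<sigma> (\<sigma>(r := [], d := rev (\<sigma> r) @ \<sigma> d, e := rev (\<sigma> r) @ \<sigma> e)) (5 * length (\<sigma> r) + 1)"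
proof -
  define w where "w = \<sigma> r"
  define S where "S = (\<lambda>j. \<sigma>(r := drop j w, d := rev (take j w) @ \<sigma> d, e := rev (take j w) @ \<sigma> e))"
  have "runs (move2 r d e) (S 0) (S (length w)) (length w * ((((1 + 1) + 1) + 1) + 1) + 1)"
    unfolding move2_def
  proof (rule runs_While)
    fix j assume j: "j < length w"
    show "S j r \<noteq> []" using j assms unfolding S_def by simp
    define S' where "S' = (S j)(d := w ! j # S j d, e := w ! j # S j e)"
    have two: "runs (Seq (Push d a) (Push e a)) (S j) S' (1 + 1)" if "a = w ! j" for a
      using assms that by (intro runs_Seq[OF runs_Push[OF refl] runs_Push]) (auto simp: S'_def)
    have "runs (IfOne r (Seq (Push d 1) (Push e 1)) (Seq (Push d 0) (Push e 0))) (S j) S' ((1 + 1) + 1)"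
    proof (rule runs_IfOne)
      show "runs (Seq (Push d 1) (Push e 1)) (S j) S' (1 + 1)" if "S j r = 1 # v" for v
        using that j assms by (intro two) (auto simp: S_def drop_head)
      show "runs (Seq (Push d 0) (Push e 0)) (S j) S' (1 + 1)" if "\<And>v. S j r \<noteq> 1 # v"
        using that j assms by (intro two) (cases "w ! j"; auto simp: S_def drop_head)
    qed
    moreover have "runs (Pop r) S' (S (Suc j)) 1"
      using j assms by (intro runs_Pop) (auto simp: S_def S'_def fun_eq_iff rev_take_Suc tl_drop drop_Suc)
    ultimately show "runs (Seq (IfOne r (Seq (Push d 1) (Push e 1)) (Seq (Push d 0) (Push e 0))) (Pop r)) (S j) (S (Suc j)) (((1 + 1) + 1) + 1)"
      by (rule runs_Seq)
  qed (use assms in \<open>simp add: S_def\<close>)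
  moreover have "S 0 = \<sigma>" "S (length w) = \<sigma>(r := [], d := rev (\<sigma> r) @ \<sigma> d, e := rev (\<sigma> r) @ \<sigma> e)"
    unfolding S_def w_def by auto
  ultimately show ?thesis unfolding w_def by (auto elim: runs_mono)
qed

text \<open>The word travels to the scratch register \<open>t\<close> and back, so that its two
  reversals cancel while \<open>d\<close> receives a second copy.\<close>

definition copy :: "nat \<Rightarrow> nat \<Rightarrow> nat \<Rightarrow> prog" where
  "copy r d t = Seq (move r t) (move2 t r d)"

lemma runs_copy:
  assumes "distinct [r, d, t]" "\<sigma> t = []" "length (\<sigma> r) \<le> B" "\<sigma>' = \<sigma>(d := \<sigma> r @ \<sigma> d)"
  shows "runs (copy r d t) \<sigma> \<sigma>' (9 * B + 2)"
proof -
  define \<sigma>1 where "\<sigma>1 = \<sigma>(r := [], t := rev (\<sigma> r) @ \<sigma> t)"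
  have 1: "runs (move r t) \<sigma> \<sigma>1 (4 * B + 1)"
    unfolding \<sigma>1_def by (rule runs_mono[OF runs_move]) (use assms in auto)
  have "runs (move2 t r d) \<sigma>1 (\<sigma>1(t := [], r := rev (\<sigma>1 t) @ \<sigma>1 r, d := rev (\<sigma>1 t) @ \<sigma>1 d)) (5 * B + 1)"
    by (rule runs_mono[OF runs_move2]) (use assms in \<open>auto simp: \<sigma>1_def\<close>)
  moreover have "\<sigma>1(t := [], r := rev (\<sigma>1 t) @ \<sigma>1 r, d := rev (\<sigma>1 t) @ \<sigma>1 d) = \<sigma>'"
    using assms unfolding \<sigma>1_def by (auto simp: fun_eq_iff)
  ultimately have "runs (move2 t r d) \<sigma>1 \<sigma>' (5 * B + 1)" by simp
  from runs_Seq[OF 1 this] show ?thesis unfolding copy_def by (rule runs_mono) simp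
qed

text \<open>In continuation style: \<open>q\<close> runs once the arguments have been laid out in
  consecutive registers from \<open>d\<close> on.\<close>

primrec copies :: "nat \<Rightarrow> nat list \<Rightarrow> nat \<Rightarrow> prog \<Rightarrow> prog" where
  "copies d [] t q = q"
| "copies d (r # rs) t q = Seq (copy r d t) (copies (Suc d) rs t q)"

lemma runs_copies:
  assumes "runs q (mst (xs @ ys @ map ((!) xs) rs)) \<sigma> T" "d = length (xs @ ys)"
    and "\<And>r. r \<in> set rs \<Longrightarrow> r < length xs \<and> r \<noteq> t \<and> length (xs ! r) \<le> B" "t < length xs" "xs ! t = []"
  shows "runs (copies d rs t q) (mst (xs @ ys)) \<sigma> (length rs * (9 * B + 2) + T)"
  using assms
proof (induction rs arbitrary: ys d)
  case Nil
  then show ?case by simp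
next
  case (Cons r rs)
  have r: "r < length xs" "r \<noteq> t" "length (xs ! r) \<le> B" using Cons.prems(3)[of r] by auto
  have at: "mst (xs @ ys) r = xs ! r" "mst (xs @ ys) t = []" "mst (xs @ ys) d = []"
    using r Cons.prems(2,4,5) unfolding mst_def by (auto simp: nth_append)
  have "runs (copy r d t) (mst (xs @ ys)) (mst (xs @ (ys @ [xs ! r]))) (9 * B + 2)"
  proof (rule runs_copy)
    show "mst (xs @ (ys @ [xs ! r])) = (mst (xs @ ys))(d := mst (xs @ ys) r @ mst (xs @ ys) d)"
      unfolding at using mst_upd_new[of d "xs @ ys" "xs ! r"] Cons.prems(2) by simp
  qed (use r at Cons.prems(2,4) in auto)
  moreover have "runs (copies (Suc d) rs t q) (mst (xs @ (ys @ [xs ! r]))) \<sigma> (length rs * (9 * B + 2) + T)"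
    using Cons.prems by (intro Cons.IH) auto
  ultimately have "runs (Seq (copy r d t) (copies (Suc d) rs t q)) (mst (xs @ ys)) \<sigma> ((9 * B + 2) + (length rs * (9 * B + 2) + T))"
    by (rule runs_Seq)
  then show ?case unfolding copies.simps by (rule runs_mono) simp
qed

section \<open>The program for the construction\<close>

definition callA :: "prog \<Rightarrow> nat \<Rightarrow> prog" where
  "callA PA N = copies 16 [0, 2, 14, 15] 9 (call 16 PA N)"

definition flip :: "nat \<Rightarrow> prog" where
  "flip r = IfOne r (Seq (Pop r) (Push r 0)) (Seq (Pop r) (Push r 1))"

text \<open>A matrix entry is requested only where the bits of \<open>x\<close> and \<open>y\<close>
  are both 1, so that adding its term to the parity is a conditional flip of the
  accumulator.\<close>

definition bodyC :: "prog \<Rightarrow> nat \<Rightarrow> prog" where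
  "bodyC PA N = Seq (callA PA N) (Seq (IfOne 16 (flip 10) skip) (clear 16))"

definition loopC :: "prog \<Rightarrow> nat \<Rightarrow> prog" where
  "loopC PA N = Seq (copy 7 12 9)
     (Seq (WhileNonempty 12 (Seq (IfOne 12 (bodyC PA N) skip) (Seq (Pop 12) (Push 15 1)))) (clear 15))"

definition loopR :: "prog \<Rightarrow> nat \<Rightarrow> prog" where
  "loopR PA N = Seq (copy 8 13 9)
     (Seq (WhileNonempty 13 (Seq (IfOne 13 (loopC PA N) skip) (Seq (Pop 13) (Push 14 1)))) (clear 14))"

text \<open>The unary index is counted down, so that pushing the parities on a stack leaves them in
  increasing order.\<close>

definition loopI :: "prog \<Rightarrow> nat \<Rightarrow> prog" where
  "loopI PA N = WhileNonempty 2 (Seq (Push 10 0) (Seq (loopR PA N) (Seq (move 10 11) (Pop 2))))"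

definition callE :: "prog \<Rightarrow> nat \<Rightarrow> prog" where
  "callE PE N = copies 16 [0, 3, 4, 5] 9
     (IfOne 1 (copies 20 [8, 11] 9 (call 16 PE N)) (copies 20 [7, 11] 9 (call 16 PE N)))"

text \<open>The unary \<open>m\<close> serves as the loop counter. The kept bits arrive reversed in
  the scratch register, and the final \<open>move\<close> restores their order.\<close>

definition truncate :: prog where
  "truncate = Seq (clear 0) (Seq (WhileNonempty 6 (Seq (IfOne 16 (Push 9 1) (Push 9 0)) (Seq (Pop 16) (Pop 6)))) (move 9 0))"

definition deor_prog :: "prog \<Rightarrow> nat \<Rightarrow> prog \<Rightarrow> nat \<Rightarrow> prog" where
  "deor_prog PA N PE N' = Seq (loopI PA N) (Seq (callE PE N') truncate)"

text \<open>Registers 0 to 8 hold the inputs; 9 is scratch, 10 an accumulator bit, 11 collects the seed, 12 and 13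
  are consumed copies of the sources, 14 and 15 count rows and columns; subprograms run from 16 on.\<close>

abbreviation regs where
  "regs n s i k b t m x y z sd xl yl r c \<equiv> [unary n, s, unary i, k, b, t, m, x, y, [], z, sd, xl, yl, unary r, unary c]"

text \<open>Room for both callers: at most six copies and one branch precede the call.\<close>

definition t_call :: "nat \<Rightarrow> nat \<Rightarrow> nat \<Rightarrow> nat" where
  "t_call B T N = 8 * (9 * B + 3) + (T + (N * (2 * (B + T) + 1) + 2))"

definition t_bodyC where "t_bodyC B T N = t_call B T N + 10" for B T N :: nat
definition t_loopC where "t_loopC B T N = (9 * B + 2) + ((B * ((t_bodyC B T N + 1 + 2) + 1) + 1) + (2 * B + 1))" for B T N :: nat
definition t_loopR where "t_loopR B T N = (9 * B + 2) + ((B * ((t_loopC B T N + 1 + 2) + 1) + 1) + (2 * B + 1))" for B T N :: nat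
definition t_loopI where "t_loopI B T N = B * ((1 + (t_loopR B T N + (5 + 1))) + 1) + 1" for B T N :: nat

lemma unary_simps [simp]: "unary 0 = []" "unary (Suc k) = 1 # unary k" "length (unary k) = k"
  unfolding unary_def by simp_all

lemma runs_callA:
  assumes PA: "computes PA [unary n, unary i, unary r, unary c] [a] T" and N: "4 \<le> N" "prog_bound PA \<le> N"
    and B: "\<And>w. w \<in> set (regs n s i k b t m x y z sd xl yl r c) \<Longrightarrow> length w \<le> B"
  shows "runs (callA PA N) (mst (regs n s i k b t m x y z sd xl yl r c))
     (mst (regs n s i k b t m x y z sd xl yl r c @ [[a]])) (t_call B T N)"
proof -
  define xs where "xs = regs n s i k b t m x y z sd xl yl r c"
  have xs: "length xs = 16" "xs ! 9 = []" "map ((!) xs) [0, 2, 14, 15] = [unary n, unary i, unary r, unary c]"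
    unfolding xs_def by simp_all
  have Bx: "length w \<le> B" if "w \<in> set xs" for w using B that unfolding xs_def .
  have Bn: "length (xs ! r) \<le> B" if "r < 16" for r using Bx[of "xs ! r"] xs(1) that by simp
  have "set (map ((!) xs) [0, 2, 14, 15]) \<subseteq> set xs" using xs(1) by auto
  then have "runs (call 16 PA N) (mst (xs @ map ((!) xs) [0, 2, 14, 15])) (mst (xs @ [[a]])) (T + (N * (2 * (B + T) + 1) + 2))"
    unfolding xs(3)
  proof (intro runs_call[OF PA _ N(2) _ xs(1) Bx])
    show "length [unary n, unary i, unary r, unary c] \<le> N" using N by simp
  qed (use Bx in blast)+
  then have "runs (call 16 PA N) (mst (xs @ [] @ map ((!) xs) [0, 2, 14, 15])) (mst (xs @ [[a]])) (T + (N * (2 * (B + T) + 1) + 2))"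
    unfolding xs(3) append_Nil .
  then have "runs (callA PA N) (mst (xs @ [])) (mst (xs @ [[a]]))
      (length [0::nat, 2, 14, 15] * (9 * B + 2) + (T + (N * (2 * (B + T) + 1) + 2)))"
    unfolding callA_def by (rule runs_copies) (use xs(1,2) Bn in auto)
  then have "runs (callA PA N) (mst xs) (mst (xs @ [[a]])) (t_call B T N)"
    unfolding append_Nil2 by (rule runs_mono) (simp add: t_call_def)
  then show ?thesis unfolding xs_def .
qed

lemma runs_flip: "\<sigma> r = [a] \<Longrightarrow> \<sigma>' = \<sigma>(r := [a + 1]) \<Longrightarrow> runs (flip r) \<sigma> \<sigma>' 3"
proof -
  assume a: "\<sigma> r = [a]" and \<sigma>': "\<sigma>' = \<sigma>(r := [a + 1])"
  have "runs (flip r) \<sigma> \<sigma>' ((1 + 1) + 1)" unfolding flip_def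
  proof (rule runs_IfOne)
    show "runs (Seq (Pop r) (Push r 0)) \<sigma> \<sigma>' (1 + 1)" if "\<sigma> r = 1 # w" for w
      using that a unfolding \<sigma>' by (intro runs_Seq[OF runs_Pop[OF refl] runs_Push]) auto
    show "runs (Seq (Pop r) (Push r 1)) \<sigma> \<sigma>' (1 + 1)" if "\<And>w. \<sigma> r \<noteq> 1 # w"
      using that a unfolding \<sigma>' by (intro runs_Seq[OF runs_Pop[OF refl] runs_Push]) (cases a; auto)
  qed
  then show ?thesis by (simp add: numeral_3_eq_3)
qed

lemma runs_bodyC:
  assumes PA: "computes PA [unary n, unary i, unary r, unary c] [a] T" and N: "4 \<le> N" "prog_bound PA \<le> N"
    and B: "\<And>w. w \<in> set (regs n s i k b t m x y [z] sd xl yl r c) \<Longrightarrow> length w \<le> B"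
  shows "runs (bodyC PA N) (mst (regs n s i k b t m x y [z] sd xl yl r c))
     (mst (regs n s i k b t m x y [z + a] sd xl yl r c)) (t_bodyC B T N)"
proof -
  let ?xs = "\<lambda>z. regs n s i k b t m x y [z] sd xl yl r c"
  have 1: "runs (callA PA N) (mst (?xs z)) (mst (?xs z @ [[a]])) (t_call B T N)"
    by (rule runs_callA[OF PA N B])
  have "runs (IfOne 16 (flip 10) skip) (mst (?xs z @ [[a]])) (mst (?xs (z + a) @ [[a]])) (3 + 1)"
  proof (rule runs_IfOne)
    show "runs (flip 10) (mst (?xs z @ [[a]])) (mst (?xs (z + a) @ [[a]])) 3" if "mst (?xs z @ [[a]]) 16 = 1 # w" for w
      using that by (intro runs_flip[where a = z]) (auto simp: mst_upd)
    show "runs skip (mst (?xs z @ [[a]])) (mst (?xs (z + a) @ [[a]])) 3" if "\<And>w. mst (?xs z @ [[a]]) 16 \<noteq> 1 # w"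
      using that by (cases a) (auto intro: runs_mono[OF runs_skip])
  qed
  moreover have "runs (clear 16) (mst (?xs (z + a) @ [[a]])) (mst (?xs (z + a))) (2 * 1 + 1)"
    using runs_clear[of "mst (?xs (z + a) @ [[a]])" 16 1] mst_trailing_Nil[of "?xs (z + a)"] by (simp add: mst_upd)
  ultimately have "runs (Seq (IfOne 16 (flip 10) skip) (clear 16)) (mst (?xs z @ [[a]])) (mst (?xs (z + a))) (3 + 1 + (2 * 1 + 1))"
    by (rule runs_Seq)
  from runs_Seq[OF 1 this] show ?thesis unfolding bodyC_def t_bodyC_def by (rule runs_mono) simp
qed

lemma runs_loopC:
  assumes PA: "\<And>c. c < n \<Longrightarrow> computes PA [unary n, unary i, unary r, unary c] [A c] T" and N: "4 \<le> N" "prog_bound PA \<le> N"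
    and B: "\<And>w. w \<in> set (regs n s i k b t m x y [z] sd [] yl r 0) \<Longrightarrow> length w \<le> B" and x: "length x = n"
  shows "runs (loopC PA N) (mst (regs n s i k b t m x y [z] sd [] yl r 0))
     (mst (regs n s i k b t m x y [z + (\<Sum>c<n. A c * x ! c)] sd [] yl r 0)) (t_loopC B T N)"
proof -
  have Bs: "\<forall>w\<in>set (regs n s i k b t m x y [z] sd [] yl r 0). length w \<le> B" using B by blast
  have nB: "n \<le> B" "1 \<le> B" using B[of x] B[of "[z]"] x by auto
  define a where "a = (\<lambda>j. z + (\<Sum>c<j. A c * x ! c))"
  have a: "a 0 = z" "a (Suc j) = a j + A j * x ! j" for j
    unfolding a_def by (simp, simp only: sum.lessThan_Suc add.assoc)
  define S where "S = (\<lambda>j. mst (regs n s i k b t m x y [a j] sd (drop j x) yl r j))"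
  have 1: "runs (copy 7 12 9) (mst (regs n s i k b t m x y [z] sd [] yl r 0)) (S 0) (9 * B + 2)"
    unfolding S_def using nB x by (intro runs_copy) (auto simp: mst_upd a)
  have "runs (WhileNonempty 12 (Seq (IfOne 12 (bodyC PA N) skip) (Seq (Pop 12) (Push 15 1)))) (S 0) (S n)
      (n * ((t_bodyC B T N + 1 + 2) + 1) + 1)"
  proof (rule runs_While)
    fix j assume j: "j < n"
    show "S j 12 \<noteq> []" unfolding S_def using j x by simp
    let ?S = "mst (regs n s i k b t m x y [a (Suc j)] sd (drop j x) yl r j)"
    have dj: "drop j x = x ! j # drop (Suc j) x" using j x by (simp add: drop_head)
    have "runs (IfOne 12 (bodyC PA N) skip) (S j) ?S (t_bodyC B T N + 1)"
    proof (rule runs_IfOne)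
      assume "\<And>w. S j 12 \<noteq> 1 # w"
      then have "x ! j = 0" using dj unfolding S_def by (cases "x ! j") auto
      then have eq: "a (Suc j) = a j" by (simp only: a mult_zero_right add_0_right)
      show "runs skip (S j) ?S (t_bodyC B T N)"
        unfolding S_def eq by (rule runs_mono[OF runs_skip]) (simp add: t_bodyC_def)
    next
      fix w assume "S j 12 = 1 # w"
      then have "x ! j = 1" using dj unfolding S_def by simp
      then have eq: "a (Suc j) = a j + A j" by (simp only: a mult_1_right)
      show "runs (bodyC PA N) (S j) ?S (t_bodyC B T N)"
        unfolding S_def eq by (rule runs_bodyC[OF PA[OF j] N], erule bspec[rotated]) (use Bs nB j x in simp)
    qed
    moreover have "runs (Seq (Pop 12) (Push 15 1)) ?S (S (Suc j)) (1 + 1)"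
      unfolding S_def by (intro runs_Seq[OF runs_Pop[OF refl] runs_Push]) (simp add: mst_upd tl_drop drop_Suc)
    ultimately show "runs (Seq (IfOne 12 (bodyC PA N) skip) (Seq (Pop 12) (Push 15 1))) (S j) (S (Suc j)) (t_bodyC B T N + 1 + 2)"
      unfolding one_add_one by (rule runs_Seq)
  qed (use x in \<open>simp add: S_def\<close>)
  then have 2: "runs (WhileNonempty 12 (Seq (IfOne 12 (bodyC PA N) skip) (Seq (Pop 12) (Push 15 1)))) (S 0) (S n)
      (B * ((t_bodyC B T N + 1 + 2) + 1) + 1)"
    by (rule runs_mono, intro add_right_mono mult_right_mono) (use nB in auto)
  have 3: "runs (clear 15) (S n) (mst (regs n s i k b t m x y [a n] sd [] yl r 0)) (2 * B + 1)"
    using runs_clear[of "S n" 15 B] nB x unfolding S_def by (simp add: mst_upd)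
  show ?thesis unfolding loopC_def t_loopC_def using runs_Seq[OF 1 runs_Seq[OF 2 3]] unfolding a_def .
qed

lemma runs_loopR:
  assumes PA: "\<And>r c. r < n \<Longrightarrow> c < n \<Longrightarrow> computes PA [unary n, unary i, unary r, unary c] [A r c] T" and N: "4 \<le> N" "prog_bound PA \<le> N"
    and B: "\<And>w. w \<in> set (regs n s i k b t m x y [z] sd [] [] 0 0) \<Longrightarrow> length w \<le> B" and x: "length x = n" and y: "length y = n"
  shows "runs (loopR PA N) (mst (regs n s i k b t m x y [z] sd [] [] 0 0))
     (mst (regs n s i k b t m x y [z + (\<Sum>r<n. (\<Sum>c<n. A r c * x ! c) * y ! r)] sd [] [] 0 0)) (t_loopR B T N)"
proof -
  have Bs: "\<forall>w\<in>set (regs n s i k b t m x y [z] sd [] [] 0 0). length w \<le> B" using B by blast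
  have nB: "n \<le> B" "1 \<le> B" using B[of x] B[of "[z]"] x by auto
  define g where "g = (\<lambda>r. \<Sum>c<n. A r c * x ! c)"
  define a where "a = (\<lambda>j. z + (\<Sum>r<j. g r * y ! r))"
  have a: "a 0 = z" "a (Suc j) = a j + g j * y ! j" for j
    unfolding a_def by (simp, simp only: sum.lessThan_Suc add.assoc)
  define S where "S = (\<lambda>j. mst (regs n s i k b t m x y [a j] sd [] (drop j y) j 0))"
  have 1: "runs (copy 8 13 9) (mst (regs n s i k b t m x y [z] sd [] [] 0 0)) (S 0) (9 * B + 2)"
    unfolding S_def using nB y by (intro runs_copy) (auto simp: mst_upd a)
  have "runs (WhileNonempty 13 (Seq (IfOne 13 (loopC PA N) skip) (Seq (Pop 13) (Push 14 1)))) (S 0) (S n)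
      (n * ((t_loopC B T N + 1 + 2) + 1) + 1)"
  proof (rule runs_While)
    fix j assume j: "j < n"
    show "S j 13 \<noteq> []" unfolding S_def using j y by simp
    let ?S = "mst (regs n s i k b t m x y [a (Suc j)] sd [] (drop j y) j 0)"
    have dj: "drop j y = y ! j # drop (Suc j) y" using j y by (simp add: drop_head)
    have "runs (IfOne 13 (loopC PA N) skip) (S j) ?S (t_loopC B T N + 1)"
    proof (rule runs_IfOne)
      assume "\<And>w. S j 13 \<noteq> 1 # w"
      then have "y ! j = 0" using dj unfolding S_def by (cases "y ! j") auto
      then have eq: "a (Suc j) = a j" by (simp only: a mult_zero_right add_0_right)
      show "runs skip (S j) ?S (t_loopC B T N)"
        unfolding S_def eq by (rule runs_mono[OF runs_skip]) (simp add: t_loopC_def)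
    next
      fix w assume "S j 13 = 1 # w"
      then have "y ! j = 1" using dj unfolding S_def by simp
      then have "a (Suc j) = a j + g j" by (simp only: a mult_1_right)
      then have eq: "a (Suc j) = a j + (\<Sum>c<n. A j c * x ! c)" unfolding g_def .
      show "runs (loopC PA N) (S j) ?S (t_loopC B T N)"
        unfolding S_def eq by (rule runs_loopC[OF PA[OF j] N], assumption, erule bspec[rotated]) (use Bs nB j x y in simp_all)
    qed
    moreover have "runs (Seq (Pop 13) (Push 14 1)) ?S (S (Suc j)) (1 + 1)"
      unfolding S_def by (intro runs_Seq[OF runs_Pop[OF refl] runs_Push]) (simp add: mst_upd tl_drop drop_Suc)
    ultimately show "runs (Seq (IfOne 13 (loopC PA N) skip) (Seq (Pop 13) (Push 14 1))) (S j) (S (Suc j)) (t_loopC B T N + 1 + 2)"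
      unfolding one_add_one by (rule runs_Seq)
  qed (use y in \<open>simp add: S_def\<close>)
  then have 2: "runs (WhileNonempty 13 (Seq (IfOne 13 (loopC PA N) skip) (Seq (Pop 13) (Push 14 1)))) (S 0) (S n)
      (B * ((t_loopC B T N + 1 + 2) + 1) + 1)"
    by (rule runs_mono, intro add_right_mono mult_right_mono) (use nB in auto)
  have 3: "runs (clear 14) (S n) (mst (regs n s i k b t m x y [a n] sd [] [] 0 0)) (2 * B + 1)"
    using runs_clear[of "S n" 14 B] nB y unfolding S_def by (simp add: mst_upd)
  show ?thesis unfolding loopR_def t_loopR_def using runs_Seq[OF 1 runs_Seq[OF 2 3]] unfolding a_def g_def .
qed

lemma runs_loopI:
  assumes PA: "\<And>i r c. i \<in> {1..l} \<Longrightarrow> r < n \<Longrightarrow> c < n \<Longrightarrow> computes PA [unary n, unary i, unary r, unary c] [A i r c] T"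
    and N: "4 \<le> N" "prog_bound PA \<le> N"
    and B: "\<And>w. w \<in> set (regs n s l k b t m x y [0] [] [] [] 0 0) \<Longrightarrow> length w \<le> B" and x: "length x = n" and y: "length y = n"
  defines "h \<equiv> \<lambda>i. \<Sum>r<n. (\<Sum>c<n. A i r c * x ! c) * y ! r"
  shows "runs (loopI PA N) (mst (regs n s l k b t m x y [] [] [] [] 0 0))
     (mst (regs n s 0 k b t m x y [] (map h [1..<Suc l]) [] [] 0 0)) (t_loopI B T N)"
proof -
  have Bs: "\<forall>w\<in>set (regs n s l k b t m x y [0] [] [] [] 0 0). length w \<le> B" using B by blast
  have lB: "l \<le> B" "1 \<le> B" using B[of "unary l"] B[of "[0]"] by auto
  \<comment> \<open>After \<open>j\<close> rounds the index register holds \<open>l - j\<close>, and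
    the parities above it have been collected.\<close>
  define S where "S = (\<lambda>j. mst (regs n s (l - j) k b t m x y [] (map h [Suc (l - j)..<Suc l]) [] [] 0 0))"
  have "runs (loopI PA N) (S 0) (S l) (l * ((1 + (t_loopR B T N + (5 + 1))) + 1) + 1)"
    unfolding loopI_def
  proof (rule runs_While)
    fix j assume j: "j < l"
    define i where "i = l - j"
    have i: "i \<in> {1..l}" "l - Suc j = i - 1" "i = Suc (i - 1)" using j unfolding i_def by auto
    have ui: "unary i = 1 # unary (i - 1)" using unary_simps(2)[of "i - 1"] unfolding i(3)[symmetric] .
    show "S j 2 \<noteq> []" unfolding S_def i_def[symmetric] by (simp add: ui)
    define sd where "sd = map h [Suc i..<Suc l]"
    have lsd: "length sd \<le> B" using lB unfolding sd_def by (simp del: upt_Suc)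
    let ?R = "\<lambda>i z sd. mst (regs n s i k b t m x y z sd [] [] 0 0)"
    have 1: "runs (Push 10 0) (S j) (?R i [0] sd) 1"
      unfolding S_def i_def[symmetric] sd_def[symmetric] by (rule runs_Push) (simp add: mst_upd)
    have 2: "runs (loopR PA N) (?R i [0] sd) (?R i [0 + h i] sd) (t_loopR B T N)"
      unfolding h_def by (rule runs_loopR[OF PA[OF i(1)] N], assumption, assumption, erule bspec[rotated]) (use Bs lB lsd i(1) x y in simp_all)
    have "runs (move 10 11) (?R i [h i] sd) ((?R i [h i] sd)(10 := [], 11 := rev (?R i [h i] sd 10) @ ?R i [h i] sd 11)) (4 * length (?R i [h i] sd 10) + 1)"
      by (rule runs_move) simp
    then have 3: "runs (move 10 11) (?R i [0 + h i] sd) (?R i [] (h i # sd)) 5"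
      unfolding add_0_left by (simp add: mst_upd)
    have sd: "h i # sd = map h [Suc (i - 1)..<Suc l]" using i(1) upt_conv_Cons[of i "Suc l"]
      unfolding i(3)[symmetric] sd_def by simp
    have 4: "runs (Pop 2) (?R i [] (h i # sd)) (S (Suc j)) 1"
      unfolding S_def i(2) sd by (rule runs_Pop) (simp add: mst_upd ui)
    show "runs (Seq (Push 10 0) (Seq (loopR PA N) (Seq (move 10 11) (Pop 2)))) (S j) (S (Suc j))
        (1 + (t_loopR B T N + (5 + 1)))"
      by (rule runs_Seq[OF 1 runs_Seq[OF 2 runs_Seq[OF 3 4]]])
  qed (simp add: S_def)
  moreover have "S 0 = mst (regs n s l k b t m x y [] [] [] [] 0 0)"
    "S l = mst (regs n s 0 k b t m x y [] (map h [1..<Suc l]) [] [] 0 0)"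
    unfolding S_def by auto
  ultimately have "runs (loopI PA N) (mst (regs n s l k b t m x y [] [] [] [] 0 0))
     (mst (regs n s 0 k b t m x y [] (map h [1..<Suc l]) [] [] 0 0)) (l * ((1 + (t_loopR B T N + (5 + 1))) + 1) + 1)"
    by simp
  then show ?thesis unfolding t_loopI_def
    by (rule runs_mono, intro add_right_mono mult_right_mono) (use lB in auto)
qed

lemma runs_callE:
  assumes PE: "computes PE [unary n, k, b, t, if s = 0 then x else y, sd] out T" and N: "6 \<le> N" "prog_bound PE \<le> N"
    and B: "\<And>w. w \<in> set (regs n [s] 0 k b t m x y [] sd [] [] 0 0) \<Longrightarrow> length w \<le> B"
  shows "runs (callE PE N) (mst (regs n [s] 0 k b t m x y [] sd [] [] 0 0))
     (mst (regs n [s] 0 k b t m x y [] sd [] [] 0 0 @ [out])) (t_call B T N)"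
proof -
  define xs where "xs = regs n [s] 0 k b t m x y [] sd [] [] 0 0"
  have xs: "length xs = 16" "xs ! 9 = []" "xs ! 1 = [s]" "map ((!) xs) [0, 3, 4, 5] = [unary n, k, b, t]"
    "map ((!) xs) [8, 11] = [y, sd]" "map ((!) xs) [7, 11] = [x, sd]"
    unfolding xs_def by simp_all
  have Bx: "length w \<le> B" if "w \<in> set xs" for w using B that unfolding xs_def .
  have Bn: "length (xs ! r) \<le> B" if "r < 16" for r using Bx[of "xs ! r"] xs(1) that by simp
  let ?T = "T + (N * (2 * (B + T) + 1) + 2)"
  let ?Q = "IfOne 1 (copies 20 [8, 11] 9 (call 16 PE N)) (copies 20 [7, 11] 9 (call 16 PE N))"
  have ins: "set [unary n, k, b, t, if s = 0 then x else y, sd] \<subseteq> set xs" unfolding xs_def by simp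
  have call: "runs (call 16 PE N) (mst (xs @ [unary n, k, b, t, if s = 0 then x else y, sd])) (mst (xs @ [out])) ?T"
  proof (intro runs_call[OF PE _ N(2) _ xs(1) Bx])
    show "length [unary n, k, b, t, if s = 0 then x else y, sd] \<le> N" using N by simp
  qed (use ins Bx in blast)+
  have "runs ?Q (mst (xs @ [unary n, k, b, t])) (mst (xs @ [out])) (2 * (9 * B + 2) + ?T + 1)"
  proof (rule runs_IfOne)
    have *: "runs (copies 20 rs 9 (call 16 PE N)) (mst (xs @ [unary n, k, b, t])) (mst (xs @ [out])) (length rs * (9 * B + 2) + ?T)"
      if "map ((!) xs) rs = [if s = 0 then x else y, sd]" "\<And>r. r \<in> set rs \<Longrightarrow> r < 16 \<and> r \<noteq> 9" for rs
      using call xs(1,2) Bn that(2) unfolding that(1)[symmetric] by (intro runs_copies) auto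
    show "runs (copies 20 [8, 11] 9 (call 16 PE N)) (mst (xs @ [unary n, k, b, t])) (mst (xs @ [out])) (2 * (9 * B + 2) + ?T)"
      if "mst (xs @ [unary n, k, b, t]) 1 = 1 # w" for w
    proof -
      have "[s] = 1 # w" using that xs(1) unfolding xs(3)[symmetric] by (simp add: nth_append)
      then have "s = 1" unfolding list.inject by (rule conjunct1)
      then have "map ((!) xs) [8, 11] = [if s = 0 then x else y, sd]" unfolding xs(5) by simp
      from *[OF this] have "runs (copies 20 [8, 11] 9 (call 16 PE N)) (mst (xs @ [unary n, k, b, t])) (mst (xs @ [out])) (length [8::nat, 11] * (9 * B + 2) + ?T)"
        unfolding list.set by fastforce
      then show ?thesis by (rule runs_mono) simp
    qed
    show "runs (copies 20 [7, 11] 9 (call 16 PE N)) (mst (xs @ [unary n, k, b, t])) (mst (xs @ [out])) (2 * (9 * B + 2) + ?T)"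
      if "\<And>w. mst (xs @ [unary n, k, b, t]) 1 \<noteq> 1 # w"
    proof -
      have "mst (xs @ [unary n, k, b, t]) 1 = [s]" using xs(1) unfolding xs(3)[symmetric] by (simp add: nth_append)
      then have "s \<noteq> 1" using that[of "[]"] by metis
      then have "s = 0" unfolding bit_not_one_iff .
      then have "map ((!) xs) [7, 11] = [if s = 0 then x else y, sd]" unfolding xs(6) by simp
      from *[OF this] have "runs (copies 20 [7, 11] 9 (call 16 PE N)) (mst (xs @ [unary n, k, b, t])) (mst (xs @ [out])) (length [7::nat, 11] * (9 * B + 2) + ?T)"
        unfolding list.set by fastforce
      then show ?thesis by (rule runs_mono) simp
    qed
  qed
  then have "runs ?Q (mst (xs @ [] @ map ((!) xs) [0, 3, 4, 5])) (mst (xs @ [out])) (2 * (9 * B + 2) + ?T + 1)"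
    unfolding xs(4) append_Nil .
  then have "runs (callE PE N) (mst (xs @ [])) (mst (xs @ [out])) (length [0::nat, 3, 4, 5] * (9 * B + 2) + (2 * (9 * B + 2) + ?T + 1))"
    unfolding callE_def by (rule runs_copies) (use xs(1,2) Bn in auto)
  then have "runs (callE PE N) (mst xs) (mst (xs @ [out])) (t_call B T N)"
    unfolding append_Nil2 by (rule runs_mono) (simp add: t_call_def)
  then show ?thesis unfolding xs_def .
qed

lemma runs_truncate:
  assumes m: "m \<le> length out" "m \<le> B" "n \<le> B"
  shows "\<exists>\<sigma>. runs truncate (mst (regs n s 0 k b t (unary m) x y [] sd [] [] 0 0 @ [out])) \<sigma> (11 * B + 3) \<and> \<sigma> 0 = take m out"
proof -
  let ?R = "\<lambda>z0 m z9 w. mst ([z0, s, [], k, b, t, unary m, x, y, z9, [], sd, [], [], [], [], w])"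
  have 1: "runs (clear 0) (?R (unary n) m [] out) (?R [] m [] out) (2 * B + 1)"
    using runs_clear[of "?R (unary n) m [] out" 0 B] m by (simp add: mst_upd)
  define S where "S = (\<lambda>j. ?R [] (m - j) (rev (take j out)) (drop j out))"
  have "runs (WhileNonempty 6 (Seq (IfOne 16 (Push 9 1) (Push 9 0)) (Seq (Pop 16) (Pop 6)))) (S 0) (S m)
      (m * (((1 + 1) + (1 + 1)) + 1) + 1)"
  proof (rule runs_While)
    fix j assume j: "j < m"
    have mj: "unary (m - j) = 1 # unary (m - Suc j)" using j by (simp add: Suc_diff_Suc[symmetric])
    show "S j 6 \<noteq> []" unfolding S_def by (simp add: mj)
    have jo: "j < length out" using j m by simp
    let ?S = "?R [] (m - j) (rev (take (Suc j) out)) (drop j out)"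
    have "runs (IfOne 16 (Push 9 1) (Push 9 0)) (S j) ?S (1 + 1)"
    proof (rule runs_IfOne)
      show "runs (Push 9 1) (S j) ?S 1" if "S j 16 = 1 # w" for w
        using that jo unfolding S_def by (intro runs_Push) (simp add: mst_upd rev_take_Suc drop_head)
      show "runs (Push 9 0) (S j) ?S 1" if "\<And>w. S j 16 \<noteq> 1 # w"
      proof -
        have "out ! j = 0" using that jo unfolding S_def by (cases "out ! j") (auto simp: drop_head)
        then show ?thesis using jo unfolding S_def by (intro runs_Push) (simp add: mst_upd rev_take_Suc)
      qed
    qed
    moreover have "runs (Seq (Pop 16) (Pop 6)) ?S (S (Suc j)) (1 + 1)"
      unfolding S_def by (intro runs_Seq[OF runs_Pop[OF refl] runs_Pop]) (simp add: mst_upd tl_drop drop_Suc mj)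
    ultimately show "runs (Seq (IfOne 16 (Push 9 1) (Push 9 0)) (Seq (Pop 16) (Pop 6))) (S j) (S (Suc j)) ((1 + 1) + (1 + 1))"
      by (rule runs_Seq)
  qed (simp add: S_def)
  then have 2: "runs (WhileNonempty 6 (Seq (IfOne 16 (Push 9 1) (Push 9 0)) (Seq (Pop 16) (Pop 6)))) (?R [] m [] out) (S m) (5 * B + 1)"
    using m unfolding S_def by (auto elim!: runs_mono)
  have "runs (move 9 0) (S m) ((S m)(9 := [], 0 := rev (S m 9) @ S m 0)) (4 * length (S m 9) + 1)"
    by (rule runs_move) simp
  then have 3: "runs (move 9 0) (S m) ((S m)(9 := [], 0 := rev (S m 9) @ S m 0)) (4 * B + 1)"
    by (rule runs_mono) (use m in \<open>simp add: S_def\<close>)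
  have "runs truncate (?R (unary n) m [] out) ((S m)(9 := [], 0 := rev (S m 9) @ S m 0)) (2 * B + 1 + (5 * B + 1 + (4 * B + 1)))"
    unfolding truncate_def by (rule runs_Seq[OF 1 runs_Seq[OF 2 3]])
  then have "runs truncate (?R (unary n) m [] out) ((S m)(9 := [], 0 := rev (S m 9) @ S m 0)) (11 * B + 3)"
    by (rule runs_mono) simp
  moreover have "((S m)(9 := [], 0 := rev (S m 9) @ S m 0)) 0 = take m out" unfolding S_def by simp
  ultimately show ?thesis by auto
qed

lemma computes_deor_prog:
  assumes PA: "\<And>i r c. i \<in> {1..l} \<Longrightarrow> r < n \<Longrightarrow> c < n \<Longrightarrow> computes PA [unary n, unary i, unary r, unary c] [A i r c] T"
    and N: "6 \<le> N" "prog_bound PA \<le> N" "prog_bound PE \<le> N"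
    and x: "length x = n" and y: "length y = n" and B: "1 \<le> B" "n \<le> B" "l \<le> B" "length k \<le> B" "length b \<le> B" "length t \<le> B" "m \<le> B"
    and sd: "sd = map (\<lambda>i. \<Sum>r<n. (\<Sum>c<n. A i r c * x ! c) * y ! r) [1..<Suc l]"
    and PE: "computes PE [unary n, k, b, t, if s = 0 then x else y, sd] out T'" and m: "m \<le> length out"
  shows "computes (deor_prog PA N PE N) [unary n, [s], unary l, k, b, t, unary m, x, y] (take m out)
     (t_loopI B T N + (t_call B T' N + (11 * B + 3)))"
proof -
  have 1: "runs (loopI PA N) (mst (regs n [s] l k b t (unary m) x y [] [] [] [] 0 0))
     (mst (regs n [s] 0 k b t (unary m) x y [] sd [] [] 0 0)) (t_loopI B T N)"
    unfolding sd by (rule runs_loopI[OF PA]) (use N x y B in auto)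
  have 2: "runs (callE PE N) (mst (regs n [s] 0 k b t (unary m) x y [] sd [] [] 0 0))
     (mst (regs n [s] 0 k b t (unary m) x y [] sd [] [] 0 0 @ [out])) (t_call B T' N)"
    by (rule runs_callE[OF PE]) (use N x y B sd in auto)
  obtain \<sigma> where 3: "runs truncate (mst (regs n [s] 0 k b t (unary m) x y [] sd [] [] 0 0 @ [out])) \<sigma> (11 * B + 3)"
    and out: "\<sigma> 0 = take m out"
    using runs_truncate[OF m B(7,2)] by blast
  \<comment> \<open>The nine inputs are followed by seven empty work registers, which do not change
    the state.\<close>
  have init: "mst (regs n [s] l k b t (unary m) x y [] [] [] [] 0 0) = mst [unary n, [s], unary l, k, b, t, unary m, x, y]"
    using mst_append_Nils[of "[unary n, [s], unary l, k, b, t, unary m, x, y]" 7] by (simp add: numeral_eq_Suc)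
  have "runs (deor_prog PA N PE N) (mst [unary n, [s], unary l, k, b, t, unary m, x, y]) \<sigma>
     (t_loopI B T N + (t_call B T' N + (11 * B + 3)))"
    unfolding deor_prog_def init[symmetric] by (rule runs_Seq[OF 1 runs_Seq[OF 2 3]])
  then show ?thesis unfolding computes_runs using out by blast
qed

text \<open>Bounds by a single monomial from 1 on; the closure rules spare explicit degrees for the
  nested loops.\<close>

definition pbound :: "(nat \<Rightarrow> nat) \<Rightarrow> bool" where
  "pbound f \<longleftrightarrow> (\<exists>a e. \<forall>n\<ge>1. f n \<le> a * n ^ e)"

lemma pbound_const: "pbound (\<lambda>_. c)"
  unfolding pbound_def by (rule exI[of _ c], rule exI[of _ 0]) simp

lemma pbound_id: "pbound (\<lambda>n. n)"
  unfolding pbound_def by (rule exI[of _ 1], rule exI[of _ 1]) simp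

lemma pbound_add:
  assumes "pbound f" "pbound g"
  shows "pbound (\<lambda>n. f n + g n)"
proof -
  obtain a e a' e' where f: "\<And>n. 1 \<le> n \<Longrightarrow> f n \<le> a * n ^ e" and g: "\<And>n. 1 \<le> n \<Longrightarrow> g n \<le> a' * n ^ e'"
    using assms unfolding pbound_def by blast
  have "f n + g n \<le> (a + a') * n ^ (e + e')" if n: "1 \<le> n" for n
  proof -
    have "n ^ e \<le> n ^ (e + e')" "n ^ e' \<le> n ^ (e + e')" using n by (auto intro: power_increasing)
    then have "f n \<le> a * n ^ (e + e')" "g n \<le> a' * n ^ (e + e')"
      by (auto intro: order.trans[OF f[OF n]] order.trans[OF g[OF n]])
    then show ?thesis unfolding distrib_right by (rule add_mono)
  qed
  then show ?thesis unfolding pbound_def by blast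
qed

lemma pbound_mult:
  assumes "pbound f" "pbound g"
  shows "pbound (\<lambda>n. f n * g n)"
proof -
  obtain a e a' e' where f: "\<And>n. 1 \<le> n \<Longrightarrow> f n \<le> a * n ^ e" and g: "\<And>n. 1 \<le> n \<Longrightarrow> g n \<le> a' * n ^ e'"
    using assms unfolding pbound_def by blast
  have "f n * g n \<le> (a * a') * n ^ (e + e')" if n: "1 \<le> n" for n
    using mult_mono[OF f[OF n] g[OF n]] by (simp add: power_add mult_ac)
  then show ?thesis unfolding pbound_def by blast
qed

lemma pbound_power: "pbound f \<Longrightarrow> pbound (\<lambda>n. f n ^ e)"
  by (induction e) (auto intro: pbound_const pbound_mult)

subsection \<open>Parameters\<close>

text \<open>Half of the error is left to the seeded extractor, whose error is \<open>2\<close> to the power \<open>-t\<close>, and half to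
  its seed. The constant \<open>54\<close> is \<open>2 \<cdot> 3\<^sup>3\<close>: the seeded extractor's \<open>log (n / \<epsilon>')\<close> is at most
  \<open>3 log (n / \<epsilon>)\<close>, and the seed has about half of the length that \<open>C\<close> provides.\<close>

lemma deor_parameters:
  fixes CS cS k1 k2 \<epsilon> :: real and n b1 b2 :: nat
  defines "C \<equiv> 8 + 54 * \<bar>CS\<bar>" and "c \<equiv> 18 + \<bar>cS\<bar>"
  defines "k \<equiv> nat \<lfloor>k1\<rfloor>" and "l \<equiv> nat \<lfloor>(k1 + k2 - real n - 2 * real b2) / 2 - log 2 (1 / \<epsilon>)\<rfloor>"
    and "t \<equiv> nat \<lceil>1 + log 2 (1 / \<epsilon>)\<rceil>"
  assumes n: "2 \<le> n" and k1: "0 \<le> k1" "k1 \<le> real n" and k2: "k2 \<le> real n" and \<epsilon>: "0 < \<epsilon>" "\<epsilon> < 1"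
    and big: "k1 + k2 - 2 * max (real b1) (real b2) > real n + C * (log 2 (real n / \<epsilon>)) ^ 3"
    and m: "real m \<le> (1 - 1 / (log 2 (real n))\<^sup>2) * (k1 - real b2)
        + 1 / 2 * (k1 - 2 * real b1 + k2 - 2 * real b2 - real n) - 9 * log 2 (1 / \<epsilon>) - c"
  shows "l \<le> n" and "dpvr_params CS n k (b1 + b2) t l" and "t \<le> 2 * n" and "m \<le> 2 * n" and "real k \<le> k1"
    and "1 / 2 ^ t + 2 ^ l * 2 powr ((real n - k1 - k2) / 2 + real b2) / 2 \<le> \<epsilon>"
    and "real m \<le> real l + real k - real (b1 + b2) - 8 * log 2 (real k - real (b1 + b2))
        - 8 * log 2 (1 / (1 / 2 ^ t)) - cS"
proof -
  define e where "e = log 2 (1 / \<epsilon>)"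
  define g where "g = log 2 (real n)"
  define L where "L = log 2 (real n / \<epsilon>)"
  have L: "L = g + e" unfolding L_def g_def e_def using n \<epsilon> by (simp add: log_divide)
  have e: "0 < e" "2 powr e = 1 / \<epsilon>" unfolding e_def using \<epsilon> by simp_all
  have g: "1 \<le> g" unfolding g_def using n by simp
  have L1: "1 \<le> L" using L e g by simp
  have L3: "L \<le> L ^ 3" "1 \<le> L ^ 3" using L1 power_increasing[of 1 3 L] by simp_all
  have C8: "8 \<le> C" "54 * \<bar>CS\<bar> = C - 8" unfolding C_def by simp_all
  have CL: "8 * L ^ 3 \<le> C * L ^ 3" by (rule mult_right_mono) (use C8 L3 in linarith)+
  have big': "k1 + k2 > real n + C * L ^ 3 + 2 * real b1" "k1 + k2 > real n + C * L ^ 3 + 2 * real b2"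
    using big unfolding L_def by (auto simp: max_def split: if_splits)
  \<comment> \<open>The seed length before rounding, chosen so that \<open>2\<close> to the power
    \<open>X\<close> times the bias bound of a parity is exactly \<open>\<epsilon>\<close>.\<close>
  define X where "X = (k1 + k2 - real n - 2 * real b2) / 2 - e"
  have X: "C * L ^ 3 / 2 - L \<le> X" using big'(2) L g unfolding X_def by simp
  have X0: "0 < X" using X CL L3 by linarith
  have l: "real l \<le> X" "X - 1 < real l" unfolding l_def e_def[symmetric] X_def[symmetric] using X0 by linarith+
  have k: "real k \<le> k1" "k1 - 1 < real k" unfolding k_def using k1 by linarith+
  have t: "1 + e \<le> real t" "real t < 2 + e" unfolding t_def e_def[symmetric] using e(1) by linarith+
  \<comment> \<open>The average of the two inequalities in \<open>big'\<close> gives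
    \<open>k1 + k2 > n + C * L ^ 3 + b1 + b2\<close>; with \<open>k2 \<le> n\<close> and
    \<open>C * L ^ 3 \<ge> 8\<close> this also covers the rounding of \<open>k1\<close>.\<close>
  have bk: "real (b1 + b2) + 1 < real k" using big' k k2 CL L3 by simp
  show "real k \<le> k1" by (rule k(1))
  have nonneg: "0 \<le> real b1" "0 \<le> real b2" "0 \<le> real n" by simp_all
  have "X \<le> real n" 
    using k1 k2 e(1) nonneg unfolding X_def by argo
  then show "l \<le> n" using l(1) by linarith
  have en: "e \<le> real n / 2" using X0 k1 k2 unfolding X_def by simp
  have tn: "real t \<le> 2 * real n" using t(2) en n by simp
  then show "t \<le> 2 * n" by linarith
  have kn: "k \<le> n" using k(1) k1(2) by linarith
  show "dpvr_params CS n k (b1 + b2) t l"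
    unfolding dpvr_params_def
  proof (intro conjI)
    show "b1 + b2 < k" using bk by linarith
    show "k \<le> n" by (rule kn)
    show "1 \<le> t" using t(1) e(1) by linarith
    define y where "y = log 2 (real n / (1 / 2 ^ t))"
    have "y = g + real t"
      unfolding y_def g_def using n by (simp add: log_mult log_nat_power)
    \<comment> \<open>By \<open>t < 2 + e\<close> the sum is below \<open>L + 2\<close>, and 2 is at
      most \<open>2 * L\<close>.\<close>
    moreover have "g + real t \<le> 3 * L" "0 \<le> g + real t" using t L L1 g by linarith+
    ultimately have "y \<le> 3 * L" "0 \<le> y" by simp_all
    then have "y ^ 3 \<le> (3 * L) ^ 3" "0 \<le> y ^ 3" by (simp_all only: power_mono zero_le_power)
    then have "CS * y ^ 3 \<le> \<bar>CS\<bar> * (3 * L) ^ 3"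
      by (intro mult_mono) auto
    also have "\<dots> = (54 * \<bar>CS\<bar>) * L ^ 3 / 2" by (simp add: power_mult_distrib)
    \<comment> \<open>\<open>54 * \<bar>CS\<bar>\<close> is \<open>C - 8\<close>; the reserved 8
      leaves \<open>4 * L ^ 3\<close>, which covers the losses \<open>L\<close> and 1 in the bound
      for \<open>l\<close>.\<close>
    also have "\<dots> \<le> real l" unfolding C8(2) using l(2) X L3 by (simp add: algebra_simps)
    finally show "CS * (log 2 (real n / (1 / 2 ^ t))) ^ 3 \<le> real l" unfolding y_def .
  qed
  have "1 / 2 ^ t = (2::real) powr (- real t)" by (simp add: powr_minus powr_realpow divide_inverse)
  also have "\<dots> \<le> 2 powr (- (1 + e))" using t(1) by (intro powr_mono) auto
  also have "\<dots> = \<epsilon> / 2" unfolding minus_add_distrib powr_add powr_minus e(2) by simp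
  finally have 1: "1 / 2 ^ t \<le> \<epsilon> / 2" .
  have "2 ^ l * 2 powr ((real n - k1 - k2) / 2 + real b2) = 2 powr (real l + ((real n - k1 - k2) / 2 + real b2))"
    by (simp add: powr_add powr_realpow)
  also have "\<dots> \<le> 2 powr (- e)" using l(1) unfolding X_def by (intro powr_mono) (simp_all add: field_simps)
  also have "\<dots> = \<epsilon>" using e(2) by (simp add: powr_minus)
  finally show "1 / 2 ^ t + 2 ^ l * 2 powr ((real n - k1 - k2) / 2 + real b2) / 2 \<le> \<epsilon>" using 1 by simp
  define x where "x = k1 - real b2"
  have x: "C * L ^ 3 \<le> x" "x \<le> real n" using big'(2) k1 k2 unfolding x_def by simp_all
  have "g ^ 3 \<le> L ^ 3" using g L e by (intro power_mono) auto
  then have "8 * g ^ 3 \<le> C * L ^ 3" using CL by linarith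
  then have xg: "8 * g ^ 3 \<le> x" using x by linarith
  have "8 * g * g\<^sup>2 \<le> x" using xg by (simp add: power3_eq_cube power2_eq_square)
  \<comment> \<open>The amount that the factor \<open>1 - \<delta> n\<close> takes off the output
    length; it pays for the term \<open>8 * log 2 (k - b)\<close> of the seeded extractor.\<close>
  define D where "D = 1 / g\<^sup>2 * x"
  have D: "8 * g \<le> D" using \<open>8 * g * g\<^sup>2 \<le> x\<close> g unfolding D_def by (simp add: pos_le_divide_eq)
  have m': "real m \<le> x - D + 1 / 2 * (k1 - 2 * real b1 + k2 - 2 * real b2 - real n) - 9 * e - c"
    using m unfolding e_def[symmetric] g_def[symmetric] x_def[symmetric] D_def left_diff_distrib mult_1 .
  \<comment> \<open>18 is \<open>8 * 2\<close> from \<open>t < 2 + e\<close>, plus 1 for each of the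
    roundings of the seed length and of \<open>k1\<close>.\<close>
  have c: "18 + cS \<le> c" "0 \<le> c" unfolding c_def by simp_all
  have "real m \<le> 2 * real n" using m' D g x(2) e(1) c k1 k2 nonneg by argo
  then show "m \<le> 2 * n" by linarith
  have lk: "log 2 (real k - real (b1 + b2)) \<le> g" unfolding g_def using bk kn by simp
  have lt: "log 2 (1 / (1 / 2 ^ t)) = real t" by (simp add: log_nat_power)
  show "real m \<le> real l + real k - real (b1 + b2) - 8 * log 2 (real k - real (b1 + b2))
        - 8 * log 2 (1 / (1 / 2 ^ t)) - cS"
    using m' D l(2) k(2) t(2) c lk unfolding lt X_def x_def of_nat_add by argo
qed

lemma log_inverse_square_tendsto_0: "(\<lambda>n. 1 / (log 2 (real n))\<^sup>2) \<longlonglongrightarrow> 0"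
proof -
  have "filterlim (log (2::real)) at_top at_top" by real_asymp
  then have "filterlim (\<lambda>n. log 2 (real n)) at_top sequentially"
    by (rule filterlim_compose[OF _ filterlim_real_sequentially])
  then have "filterlim (\<lambda>n. (log 2 (real n))\<^sup>2) at_top sequentially"
    by (intro filterlim_pow_at_top) auto
  from tendsto_inverse_0_at_top[OF this] show ?thesis by (simp add: divide_inverse)
qed

lemma log_inverse_square_bounds: "1 / (log 2 (real n))\<^sup>2 \<in> {0..1}"
proof (cases "2 \<le> n")
  case True
  then have "1 \<le> log 2 (real n)" by simp
  then have "1 \<le> (log 2 (real n))\<^sup>2" by (rule one_le_power)
  then show ?thesis by (simp add: divide_le_eq_1)
next
  case False
  \<comment> \<open>In both cases the logarithm is 0, at \<open>n = 0\<close> by convention, and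
    division by zero yields 0.\<close>
  then have "n = 0 \<or> n = 1" by linarith
  then show ?thesis by (auto simp: log_def)
qed

section \<open>Explicitness and assembly\<close>

lemma computes_mono: "computes P ins out T \<Longrightarrow> T \<le> T' \<Longrightarrow> computes P ins out T'"
  unfolding computes_runs using runs_mono by blast

lemma polytime_iff:
  "polytime G \<longleftrightarrow> (\<exists>P a e. \<forall>ins out. (ins, out) \<in> G \<longrightarrow> computes P ins out (a * Suc (sum_list (map length ins)) ^ e))"
  unfolding polytime_def by fast

lemma E_D_sum:
  assumes A: "\<And>i. i \<in> {1..n} \<Longrightarrow> A n i \<in> carrier_mat n n" and l: "l \<le> n" and x: "x \<in> bitstr n" and y: "y \<in> bitstr n"
  shows "E_D A n l x y = map (\<lambda>i. \<Sum>r<n. (\<Sum>c<n. A n i $$ (r, c) * x ! c) * y ! r) [1..<Suc l]"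
  unfolding E_D_def
proof (rule map_cong[OF refl])
  fix i assume "i \<in> set [1..<Suc l]"
  then have Ai: "A n i \<in> carrier_mat n n" using l by (intro A) auto
  show "scalar_prod (A n i *\<^sub>v vec_of_list x) (vec_of_list y) = (\<Sum>r<n. (\<Sum>c<n. A n i $$ (r, c) * x ! c) * y ! r)"
    unfolding scalar_prod_sum[OF vec_of_list_bitstr[OF y]]
  proof (rule sum.cong[OF refl])
    fix r assume "r \<in> {..<n}"
    then have "r < n" by simp
    then show "(A n i *\<^sub>v vec_of_list x) $ r * vec_of_list y $ r = (\<Sum>c<n. A n i $$ (r, c) * x ! c) * y ! r"
      by (simp only: mult_mat_vec_sum[OF Ai vec_of_list_bitstr[OF x]] vec_of_list_index)
  qed
qed

text \<open>One program serves all parameters, which it receives in unary. Since \<open>k\<close>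
  and \<open>b\<close> are at most \<open>n\<close> by \<open>dpvr_params\<close>, and
  \<open>t\<close> and \<open>m\<close> at most \<open>2 * n\<close>, all inputs have length linear
  in \<open>n\<close>, and polynomial time in the input length becomes polynomial time in
  \<open>n\<close>. The length condition on the seeded extractor's output ensures that truncation
  finds \<open>m\<close> bits.\<close>

lemma deor_polytime:
  assumes A: "deor_matrices A" and ES: "dpvr_extractor CS cS ES"
  shows "\<exists>P a e. \<forall>n s l k b t m x y.
    1 \<le> n \<longrightarrow> l \<le> n \<longrightarrow> t \<le> 2 * n \<longrightarrow> m \<le> 2 * n \<longrightarrow> dpvr_params CS n k b t l \<longrightarrow> x \<in> bitstr n \<longrightarrow> y \<in> bitstr n \<longrightarrow>
    m \<le> length (ES n k b t (if s = 0 then x else y) (E_D A n l x y)) \<longrightarrow>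
    computes P [unary n, [s], unary l, unary k, unary b, unary t, unary m, x, y] (deor A ES n s l k b t m x y) (a * n ^ e)"
proof -
  have Ac: "A n i \<in> carrier_mat n n" if "i \<in> {1..n}" for n i using A that unfolding deor_matrices_def by blast
  have "polytime {([unary n, unary i, unary r, unary c], [A n i $$ (r, c)]) | n i r c.
                 i \<in> {1..n} \<and> r < n \<and> c < n}" (is "polytime ?GA")
    using A unfolding deor_matrices_def by (elim conjE)
  then obtain PA aA eA where PA0: "\<forall>ins out. (ins, out) \<in> ?GA \<longrightarrow> computes PA ins out (aA * Suc (sum_list (map length ins)) ^ eA)"
    unfolding polytime_iff by (elim exE)
  have "polytime {([unary n, unary k, unary b, unary t, x, u], ES n k b t x u) | n k b t x u.
                 dpvr_params CS n k b t (length u) \<and> x \<in> bitstr n}" (is "polytime ?GE")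
    using ES unfolding dpvr_extractor_def by (rule conjunct2)
  then obtain PE aE eE where PE0: "\<forall>ins out. (ins, out) \<in> ?GE \<longrightarrow> computes PE ins out (aE * Suc (sum_list (map length ins)) ^ eE)"
    unfolding polytime_iff by (elim exE)
  \<comment> \<open>The entry program has four inputs of length at most \<open>n\<close>. In
    \<open>TE\<close> below, the 7 stands for five inputs of length at most \<open>n\<close> and the
    input \<open>t\<close> of length at most \<open>2 * n\<close>.\<close>
  define TA where "TA = (\<lambda>n::nat. aA * (1 + 4 * n) ^ eA)"
  define TE where "TE = (\<lambda>n::nat. aE * (1 + 7 * n) ^ eE)"
  have PA: "computes PA [unary n, unary i, unary r, unary c] [A n i $$ (r, c)] (TA n)"
    if "i \<in> {1..n}" "r < n" "c < n" for n i r c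
  proof -
    have "computes PA [unary n, unary i, unary r, unary c] [A n i $$ (r, c)]
        (aA * Suc (sum_list (map length [unary n, unary i, unary r, unary c])) ^ eA)"
      using that by (intro PA0[rule_format]) blast
    then show ?thesis
      unfolding TA_def by (rule computes_mono, intro mult_left_mono power_mono) (use that in auto)
  qed
  have PE: "computes PE [unary n, unary k, unary b, unary t, x, u] (ES n k b t x u) (TE n)"
    if p: "dpvr_params CS n k b t (length u)" "x \<in> bitstr n" and s: "t \<le> 2 * n" "length u \<le> n" for n k b t x u
  proof -
    have kb: "k \<le> n" "b \<le> n" using p(1) unfolding dpvr_params_def by auto
    have "computes PE [unary n, unary k, unary b, unary t, x, u] (ES n k b t x u)
        (aE * Suc (sum_list (map length [unary n, unary k, unary b, unary t, x, u])) ^ eE)"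
      using p by (intro PE0[rule_format]) blast
    then show ?thesis
      unfolding TE_def by (rule computes_mono, intro mult_left_mono power_mono) (use kb p(2) s in \<open>auto simp: bitstr_def\<close>)
  qed
  \<comment> \<open>6 is the largest number of arguments of a call, that of the seeded
    extractor.\<close>
  define N where "N = 6 + prog_bound PA + prog_bound PE"
  define time where "time = (\<lambda>n. t_loopI (4 * n) (TA n) N + (t_call (4 * n) (TE n) N + (11 * (4 * n) + 3)))"
  have "pbound time"
    unfolding time_def TA_def TE_def t_loopI_def t_loopR_def t_loopC_def t_bodyC_def t_call_def
    by (intro pbound_add pbound_mult pbound_power pbound_const pbound_id)
  then obtain a e where ae: "\<And>n. 1 \<le> n \<Longrightarrow> time n \<le> a * n ^ e" unfolding pbound_def by blast
  have "computes (deor_prog PA N PE N) [unary n, [s], unary l, unary k, unary b, unary t, unary m, x, y]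
      (deor A ES n s l k b t m x y) (a * n ^ e)"
    if n: "1 \<le> n" and l: "l \<le> n" and t: "t \<le> 2 * n" and m: "m \<le> 2 * n" and p: "dpvr_params CS n k b t l"
      and x: "x \<in> bitstr n" and y: "y \<in> bitstr n"
      and len: "m \<le> length (ES n k b t (if s = 0 then x else y) (E_D A n l x y))" for n s l k b t m x y
  proof -
    have kb: "k \<le> n" "b \<le> n" using p unfolding dpvr_params_def by auto
    have xy: "length x = n" "length y = n" using x y unfolding bitstr_def by auto
    have PE': "computes PE [unary n, unary k, unary b, unary t, if s = 0 then x else y, E_D A n l x y]
        (ES n k b t (if s = 0 then x else y) (E_D A n l x y)) (TE n)"
      using p x y t l by (intro PE) simp_all
    have "computes (deor_prog PA N PE N) [unary n, [s], unary l, unary k, unary b, unary t, unary m, x, y]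
        (take m (ES n k b t (if s = 0 then x else y) (E_D A n l x y))) (time n)"
      unfolding time_def
    proof (rule computes_deor_prog[where A = "\<lambda>i r c. A n i $$ (r, c)" and sd = "E_D A n l x y" and x = x and y = y
          and T = "TA n" and T' = "TE n" and l = l and s = s])
      show "E_D A n l x y = map (\<lambda>i. \<Sum>r<n. (\<Sum>c<n. A n i $$ (r, c) * x ! c) * y ! r) [1..<Suc l]"
        by (rule E_D_sum) (rule Ac l x y, assumption?)+
      show "computes PA [unary n, unary i, unary r, unary c] [A n i $$ (r, c)] (TA n)"
        if "i \<in> {1..l}" "r < n" "c < n" for i r c by (rule PA) (use that l in auto)
      show "6 \<le> N" "prog_bound PA \<le> N" "prog_bound PE \<le> N" unfolding N_def by simp_all
      show "1 \<le> 4 * n" "n \<le> 4 * n" "l \<le> 4 * n" "length (unary k) \<le> 4 * n" "length (unary b) \<le> 4 * n"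
        "length (unary t) \<le> 4 * n" "m \<le> 4 * n" using n l kb t m by simp_all
    qed (rule xy PE' len)+
    then show ?thesis unfolding deor_def by (rule computes_mono[OF _ ae[OF n]])
  qed
  then show ?thesis by (intro exI allI impI)
qed

text \<open>The seeded extractor is applied to the source that attains the maximum in the output
  length; the second case is the first with the parties exchanged.\<close>

lemma deor_extractor:
  fixes CS cS k1 k2 \<epsilon> :: real
  defines "C \<equiv> 8 + 54 * \<bar>CS\<bar>" and "c \<equiv> 18 + \<bar>cS\<bar>"
  assumes A: "deor_matrices A" and ES: "dpvr_extractor CS cS ES"
    and n: "2 \<le> n" and k1: "0 \<le> k1" "k1 \<le> real n" and k2: "0 \<le> k2" "k2 \<le> real n" and \<epsilon>: "0 < \<epsilon>" "\<epsilon> < 1"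
    and big: "k1 + k2 - 2 * max (real b1) (real b2) > real n + C * (log 2 (real n / \<epsilon>)) ^ 3"
    and m: "real m \<le> (1 - 1 / (log 2 (real n))\<^sup>2) * max (k1 - real b2) (k2 - real b1)
        + 1 / 2 * (k1 - 2 * real b1 + k2 - 2 * real b2 - real n) - 9 * log 2 (1 / \<epsilon>) - c"
  shows "\<exists>s l k b t. l \<le> n \<and> t \<le> 2 * n \<and> m \<le> 2 * n \<and> dpvr_params CS n k b t l \<and>
    two_source_extractor n m k1 k2 \<epsilon> b1 b2 (deor A ES n s l k b t m) \<and>
    (\<forall>x\<in>bitstr n. \<forall>y\<in>bitstr n. m \<le> length (ES n k b t (if s = 0 then x else y) (E_D A n l x y)))"
proof -
  have ext: "\<exists>m'. seeded_extractor n l m' (real k) (1 / 2 ^ t) b (ES n k b t) \<and> m \<le> m'"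
    if "dpvr_params CS n k b t l"
      "real m \<le> real l + real k - real b - 8 * log 2 (real k - real b) - 8 * log 2 (1 / (1 / 2 ^ t)) - cS" for l k b t
  proof -
    have "\<forall>n k b t d. dpvr_params CS n k b t d \<longrightarrow>
        (\<exists>m. seeded_extractor n d m (real k) (1 / 2 ^ t) b (ES n k b t) \<and>
             real d + real k - real b - 8 * log 2 (real k - real b) - 8 * log 2 (1 / (1 / 2 ^ t)) - cS
               \<le> real m)"
      using ES unfolding dpvr_extractor_def by (rule conjunct1)
    from this[rule_format, OF that(1)] obtain m' where "seeded_extractor n l m' (real k) (1 / 2 ^ t) b (ES n k b t)"
      "real l + real k - real b - 8 * log 2 (real k - real b) - 8 * log 2 (1 / (1 / 2 ^ t)) - cS \<le> real m'"
      by (elim exE conjE)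
    moreover have "m \<le> m'" using order.trans[OF that(2) calculation(2)] by simp
    ultimately show ?thesis by (intro exI conjI)
  qed
  have len: "m \<le> length (ES n k b t x (E_D A n l x' y'))"
    if "seeded_extractor n l m' (real k) (1 / 2 ^ t) b (ES n k b t)" "m \<le> m'" "x \<in> bitstr n" for l k b t m' x x' y'
  proof -
    have "E_D A n l x' y' \<in> bitstr l" unfolding bitstr_def by simp
    then have "ES n k b t x (E_D A n l x' y') \<in> bitstr m'" using that(1,3) unfolding seeded_extractor_def by blast
    then show ?thesis using that(2) unfolding bitstr_def by simp
  qed
  show ?thesis
  proof (cases "k2 - real b1 \<le> k1 - real b2")
    case True
    then have "max (k1 - real b2) (k2 - real b1) = k1 - real b2" by simp
    note P = deor_parameters[of n k1 k2 \<epsilon> CS b1 b2 m cS, OF n k1 k2(2) \<epsilon> big[unfolded C_def] m[unfolded c_def this]]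
    obtain m' where m': "seeded_extractor n (nat \<lfloor>(k1 + k2 - real n - 2 * real b2) / 2 - log 2 (1 / \<epsilon>)\<rfloor>) m'
        (real (nat \<lfloor>k1\<rfloor>)) (1 / 2 ^ nat \<lceil>1 + log 2 (1 / \<epsilon>)\<rceil>) (b1 + b2)
        (ES n (nat \<lfloor>k1\<rfloor>) (b1 + b2) (nat \<lceil>1 + log 2 (1 / \<epsilon>)\<rceil>))" "m \<le> m'"
      using ext[OF P(2,7)] by blast
    have two: "two_source_extractor n m k1 k2 \<epsilon> b1 b2 (deor A ES n 0 (nat \<lfloor>(k1 + k2 - real n - 2 * real b2) / 2 - log 2 (1 / \<epsilon>)\<rfloor>)
        (nat \<lfloor>k1\<rfloor>) (b1 + b2) (nat \<lceil>1 + log 2 (1 / \<epsilon>)\<rceil>) m)"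
      using deor_left_extractor[OF A P(1,5) m'(2,1) P(6)] unfolding deor_def if_P[OF refl] .
    show ?thesis
      by (rule exI[of _ 0], intro exI conjI, rule P(1), rule P(3), rule P(4), rule P(2), rule two, intro ballI, rule len[OF m']) simp
  next
    case False
    then have "max (k1 - real b2) (k2 - real b1) = k2 - real b1" by simp
    with m have m2: "real m \<le> (1 - 1 / (log 2 (real n))\<^sup>2) * (k2 - real b1)
        + 1 / 2 * (k2 - 2 * real b2 + k1 - 2 * real b1 - real n) - 9 * log 2 (1 / \<epsilon>) - (18 + \<bar>cS\<bar>)"
      unfolding c_def by (simp add: algebra_simps)
    have big2: "k2 + k1 - 2 * max (real b2) (real b1) > real n + (8 + 54 * \<bar>CS\<bar>) * (log 2 (real n / \<epsilon>)) ^ 3"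
      using big unfolding C_def by (simp add: add.commute max.commute)
    \<comment> \<open>The same choice of parameters with both the sources and the storage bounds
      exchanged; the total storage is brought back to the form \<open>b1 + b2\<close>.\<close>
    note P = deor_parameters[of n k2 k1 \<epsilon> CS b2 b1 m cS, OF n k2 k1(2) \<epsilon> big2 m2, unfolded add.commute[of b2 b1]]
    obtain m' where m': "seeded_extractor n (nat \<lfloor>(k2 + k1 - real n - 2 * real b1) / 2 - log 2 (1 / \<epsilon>)\<rfloor>) m'
        (real (nat \<lfloor>k2\<rfloor>)) (1 / 2 ^ nat \<lceil>1 + log 2 (1 / \<epsilon>)\<rceil>) (b1 + b2)
        (ES n (nat \<lfloor>k2\<rfloor>) (b1 + b2) (nat \<lceil>1 + log 2 (1 / \<epsilon>)\<rceil>))" "m \<le> m'"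
      using ext[OF P(2,7)] by blast
    have comm: "real n - k2 - k1 = real n - k1 - k2" by simp
    have two: "two_source_extractor n m k1 k2 \<epsilon> b1 b2 (deor A ES n 1 (nat \<lfloor>(k2 + k1 - real n - 2 * real b1) / 2 - log 2 (1 / \<epsilon>)\<rfloor>)
        (nat \<lfloor>k2\<rfloor>) (b1 + b2) (nat \<lceil>1 + log 2 (1 / \<epsilon>)\<rceil>) m)"
      using deor_right_extractor[OF A P(1,5) m'(2,1) P(6)[unfolded comm]] unfolding deor_def if_not_P[OF one_neq_zero] .
    show ?thesis
      by (rule exI[of _ 1], intro exI conjI, rule P(1), rule P(3), rule P(4), rule P(2), rule two, intro ballI, rule len[OF m']) simp
  qed
qed

text \<open>The program and its time bound come from \<open>deor_polytime\<close> and are thus fixed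
  before \<open>n\<close>, the entropies, the storage sizes and the error are given.\<close>

lemma deor_explicit_extractor:
  fixes CS cS :: real
  defines "C \<equiv> 8 + 54 * \<bar>CS\<bar>" and "c \<equiv> 18 + \<bar>cS\<bar>" and "\<delta> \<equiv> \<lambda>n. 1 / (log 2 (real n))\<^sup>2"
  assumes A: "deor_matrices A" and ES: "dpvr_extractor CS cS ES"
  shows "\<exists>P a e. \<forall>(n :: nat) (k1 :: real) (k2 :: real) (b1 :: nat) (b2 :: nat) (\<epsilon> :: real) (m :: nat).
        2 \<le> n \<and> k1 \<in> {0..real n} \<and> k2 \<in> {0..real n} \<and> \<epsilon> \<in> {0<..<1} \<and>
        k1 + k2 - 2 * max (real b1) (real b2) > real n + C * (log 2 (real n / \<epsilon>)) ^ 3 \<and>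
        int m = \<lfloor>(1 - \<delta> n) * max (k1 - real b2) (k2 - real b1)
                  + 1 / 2 * (k1 - 2 * real b1 + k2 - 2 * real b2 - real n)
                  - 9 * log 2 (1 / \<epsilon>) - c\<rfloor> \<and>
        1 \<le> m \<longrightarrow>
        (\<exists>s l k b t E. l \<le> n \<and> dpvr_params CS n k b t l \<and> E = deor A ES n s l k b t m \<and>
          two_source_extractor n m k1 k2 \<epsilon> b1 b2 E \<and>
          (\<forall>x \<in> bitstr n. \<forall>y \<in> bitstr n.
             computes P [unary n, [s], unary l, unary k, unary b, unary t, unary m, x, y]
               (E x y) (a * n ^ e)))"
proof -
  obtain P a e where P: "\<forall>n s l k b t m x y.
      1 \<le> n \<longrightarrow> l \<le> n \<longrightarrow> t \<le> 2 * n \<longrightarrow> m \<le> 2 * n \<longrightarrow> dpvr_params CS n k b t l \<longrightarrow> x \<in> bitstr n \<longrightarrow> y \<in> bitstr n \<longrightarrow>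
      m \<le> length (ES n k b t (if s = 0 then x else y) (E_D A n l x y)) \<longrightarrow>
      computes P [unary n, [s], unary l, unary k, unary b, unary t, unary m, x, y] (deor A ES n s l k b t m x y) (a * n ^ e)"
    using deor_polytime[OF A ES] by (elim exE)
  show ?thesis
  proof (rule exI[of _ P], rule exI[of _ a], rule exI[of _ e], intro allI impI, elim conjE)
    fix n :: nat and k1 k2 :: real and b1 b2 :: nat and \<epsilon> :: real and m :: nat
    assume n: "2 \<le> n" and k: "k1 \<in> {0..real n}" "k2 \<in> {0..real n}" "\<epsilon> \<in> {0<..<1}"
      and big: "k1 + k2 - 2 * max (real b1) (real b2) > real n + C * (log 2 (real n / \<epsilon>)) ^ 3"
      and m: "int m = \<lfloor>(1 - \<delta> n) * max (k1 - real b2) (k2 - real b1)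
                + 1 / 2 * (k1 - 2 * real b1 + k2 - 2 * real b2 - real n)
                - 9 * log 2 (1 / \<epsilon>) - c\<rfloor>"
    have "real m = of_int (int m)" by simp
    also have "\<dots> \<le> (1 - \<delta> n) * max (k1 - real b2) (k2 - real b1)
                + 1 / 2 * (k1 - 2 * real b1 + k2 - 2 * real b2 - real n) - 9 * log 2 (1 / \<epsilon>) - c"
      unfolding m by (rule of_int_floor_le)
    finally have m': "real m \<le> (1 - \<delta> n) * max (k1 - real b2) (k2 - real b1)
                + 1 / 2 * (k1 - 2 * real b1 + k2 - 2 * real b2 - real n) - 9 * log 2 (1 / \<epsilon>) - c" .
    obtain s l k b t where 1: "l \<le> n" "t \<le> 2 * n" "m \<le> 2 * n" "dpvr_params CS n k b t l"
      and 2: "two_source_extractor n m k1 k2 \<epsilon> b1 b2 (deor A ES n s l k b t m)"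
      and 3: "\<And>x y. x \<in> bitstr n \<Longrightarrow> y \<in> bitstr n \<Longrightarrow> m \<le> length (ES n k b t (if s = 0 then x else y) (E_D A n l x y))"
      using deor_extractor[OF A ES n _ _ _ _ _ _ big[unfolded C_def] m'[unfolded \<delta>_def c_def]] k by auto
    have n1: "1 \<le> n" using n by simp
    have 4: "computes P [unary n, [s], unary l, unary k, unary b, unary t, unary m, x, y] (deor A ES n s l k b t m x y) (a * n ^ e)"
      if "x \<in> bitstr n" "y \<in> bitstr n" for x y
      by (rule P[rule_format, OF n1 1 that 3[OF that]])
    show "\<exists>s l k b t E. l \<le> n \<and> dpvr_params CS n k b t l \<and> E = deor A ES n s l k b t m \<and>
        two_source_extractor n m k1 k2 \<epsilon> b1 b2 E \<and>
        (\<forall>x \<in> bitstr n. \<forall>y \<in> bitstr n.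
           computes P [unary n, [s], unary l, unary k, unary b, unary t, unary m, x, y]
             (E x y) (a * n ^ e))"
      by (rule exI[of _ s], rule exI[of _ l], rule exI[of _ k], rule exI[of _ b], rule exI[of _ t],
        rule exI[of _ "deor A ES n s l k b t m"], intro conjI ballI) (rule 1 2 refl 4, assumption?)+
  qed
qed

theorem theorem3:
  fixes CS cS :: real
  shows "\<exists>C>0. \<exists>c>0. \<exists>\<delta> :: nat \<Rightarrow> real. (\<forall>n. \<delta> n \<in> {0..1}) \<and> \<delta> \<longlonglongrightarrow> 0 \<and>
    (\<forall>A ES. deor_matrices A \<and> dpvr_extractor CS cS ES \<longrightarrow>
      (\<exists>P a e. \<forall>(n :: nat) (k1 :: real) (k2 :: real) (b1 :: nat) (b2 :: nat) (\<epsilon> :: real) (m :: nat).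
        2 \<le> n \<and> k1 \<in> {0..real n} \<and> k2 \<in> {0..real n} \<and> \<epsilon> \<in> {0<..<1} \<and>
        k1 + k2 - 2 * max (real b1) (real b2) > real n + C * (log 2 (real n / \<epsilon>)) ^ 3 \<and>
        int m = \<lfloor>(1 - \<delta> n) * max (k1 - real b2) (k2 - real b1)
                  + 1 / 2 * (k1 - 2 * real b1 + k2 - 2 * real b2 - real n)
                  - 9 * log 2 (1 / \<epsilon>) - c\<rfloor> \<and>
        1 \<le> m \<longrightarrow>
        (\<exists>s l k b t E. l \<le> n \<and> dpvr_params CS n k b t l \<and> E = deor A ES n s l k b t m \<and>
          two_source_extractor n m k1 k2 \<epsilon> b1 b2 E \<and>
          (\<forall>x \<in> bitstr n. \<forall>y \<in> bitstr n.
             computes P [unary n, [s], unary l, unary k, unary b, unary t, unary m, x, y]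
               (E x y) (a * n ^ e)))))"
proof -
  define C c \<delta> where "C = 8 + 54 * \<bar>CS\<bar>" and "c = 18 + \<bar>cS\<bar>" and "\<delta> = (\<lambda>n. 1 / (log 2 (real n))\<^sup>2)"
  have pos: "C > 0" "c > 0" unfolding C_def c_def by simp_all
  have \<delta>: "\<forall>n. \<delta> n \<in> {0..1}" unfolding \<delta>_def by (intro allI log_inverse_square_bounds)
  have lim: "\<delta> \<longlonglongrightarrow> 0" unfolding \<delta>_def by (rule log_inverse_square_tendsto_0)
  show ?thesis
  proof (rule exI[of _ C], rule conjI[OF pos(1)], rule exI[of _ c], rule conjI[OF pos(2)], rule exI[of _ \<delta>],
      rule conjI[OF \<delta>], rule conjI[OF lim], rule allI, rule allI, rule impI, erule conjE, goal_cases)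
    case (1 A ES)
    show ?case unfolding C_def c_def \<delta>_def by (rule deor_explicit_extractor[OF 1])
  qed
qed

end
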